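(* Let $n\ge 1$ and $w\in S_n$. If there exists a diagonal term order $\sigma$ such that the CDG generators of the Schubert determinantal ideal $I_w$ form a Gröbner basis under $\sigma$, then $w$ avoids all eight of the patterns \[ 13254,\ 21543,\ 214635,\ 215364,\ 215634,\ 241635,\ 315264,\ 4261735. \]
   Context: Write $[n]=\{1,\dots,n\}$. A permutation $w\in S_n$ is written in one-line notation $w=w_1w_2\cdots w_n$, $w_i=w(i)$. For $v=v_1\cdots v_k\in S_k$ with $k\le n$, $w$ contains $v$ if there are indices $i_1<\cdots<i_k$ with $w_{i_j}<w_{i_\ell}$ exactly when $v_j<v_\ell$ (for all $j,\ell$); otherwise $w$ avoids $v$. The Rothe diagram is $D_w=\{(i,j)\in[n]\times[n] : w(i)>j,\ w^{-1}(j)>i\}$. The essential set is $\mathrm{Ess}(w)=\{(i,j)\in D_w : (i+1,j)\notin D_w,\ (i,j+1)\notin D_w\}$. The rank function is $\mathrm{rank}_w(i,j)=|\{k\le i : w(k)\le j\}|$. The dominant part is $\mathrm{Dom}(w)=\{(i,j)\in D_w : \mathrm{rank}_w(i,j)=0\}$. Let $Z=(z_{i,j})_{(i,j)\in[n]\times[n]}$ be a matrix of distinct indeterminates and $R=\mathbb{C}[Z]$. For $M$ an $n\times n$ matrix, $M_{[i],[j]}$ is the submatrix of the first $i$ rows and first $j$ columns. The Schubert determinantal ideal of $w$ is $I_w=\big((\mathrm{rank}_w(i,j)+1)\text{-minors of } Z_{[i],[j]} : (i,j)\in[n]\times[n]\big)\subseteq R$. Let $Z'$ be obtained from $Z$ by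 replacing $z_{i,j}$ by $0$ whenever $(i,j)\in\mathrm{Dom}(w)$. The set of CDG generators of $I_w$ is \[G_w=\{(\mathrm{rank}_w(i,j)+1)\text{-minors of } Z'_{[i],[j]} : (i,j)\in\mathrm{Ess}(w)\setminus\mathrm{Dom}(w)\}\cup\{z_{i,j} : (i,j)\in\mathrm{Dom}(w)\}.\] A diagonal term order on $R$ is a term (monomial) order under which the leading term of every minor of $Z$ is the product of the entries on the main diagonal of the corresponding submatrix. A generating set $\mathcal{G}$ of an ideal $I$ is a Gröbner basis if the ideal of leading terms of $I$ is generated by the leading terms of the nonzero elements of $\mathcal{G}$. *)

theory Defs
  imports Complex_Main
    "HOL-Library.Poly_Mapping"
    "HOL-Combinatorics.Permutations"
    "HOL-Algebra.Ideal"
    "Jordan_Normal_Form.Determinant"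
    "Jordan_Normal_Form.DL_Submatrix"
begin

section \<open>Permutations\<close>

text \<open>An element of \<open>S\<^sub>n\<close> is a function \<open>w\<close> with \<open>w permutes {1..n}\<close>. A pattern is the list of
  its one-line notation, so its positions are counted from 0.\<close>

definition contains_pattern :: "nat \<Rightarrow> (nat \<Rightarrow> nat) \<Rightarrow> nat list \<Rightarrow> bool" where
  "contains_pattern n w v \<longleftrightarrow>
     (\<exists>f. f ` {..<length v} \<subseteq> {1..n} \<and> strict_mono_on {..<length v} f \<and>
       (\<forall>j<length v. \<forall>l<length v. w (f j) < w (f l) \<longleftrightarrow> v ! j < v ! l))"

abbreviation avoids_pattern :: "nat \<Rightarrow> (nat \<Rightarrow> nat) \<Rightarrow> nat list \<Rightarrow> bool" where
  "avoids_pattern n w v \<equiv> \<not> contains_pattern n w v"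

definition rothe_diagram :: "nat \<Rightarrow> (nat \<Rightarrow> nat) \<Rightarrow> (nat \<times> nat) set" where
  "rothe_diagram n w =
     {(i, j). i \<in> {1..n} \<and> j \<in> {1..n} \<and> w i > j \<and> inv_into UNIV w j > i}"

definition essential_set :: "nat \<Rightarrow> (nat \<Rightarrow> nat) \<Rightarrow> (nat \<times> nat) set" where
  "essential_set n w =
     {(i, j). (i, j) \<in> rothe_diagram n w \<and>
        (i + 1, j) \<notin> rothe_diagram n w \<and> (i, j + 1) \<notin> rothe_diagram n w}"

definition rank_fun :: "(nat \<Rightarrow> nat) \<Rightarrow> nat \<Rightarrow> nat \<Rightarrow> nat" where
  "rank_fun w i j = card {k \<in> {1..i}. w k \<le> j}"

definition dominant_part :: "nat \<Rightarrow> (nat \<Rightarrow> nat) \<Rightarrow> (nat \<times> nat) set" where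
  "dominant_part n w = {(i, j). (i, j) \<in> rothe_diagram n w \<and> rank_fun w i j = 0}"

section \<open>The polynomial ring in the entries of a generic matrix\<close>

text \<open>The variable \<open>z\<^sub>i\<^sub>j\<close> is indexed by the pair \<open>(i, j)\<close>; a monomial is its finitely supported
  exponent function, and a polynomial is a finitely supported family of complex coefficients.
  Products of monomials are sums of exponents. The type allows all pairs of natural numbers as
  indices; the ring \<open>\<complex>[Z]\<close> for an \<open>n \<times> n\<close> matrix \<open>Z\<close> is the subring \<open>poly_ring n\<close>.\<close>

type_synonym monomial = "(nat \<times> nat) \<Rightarrow>\<^sub>0 nat"
type_synonym mpoly = "monomial \<Rightarrow>\<^sub>0 complex"

definition monomials :: "nat \<Rightarrow> monomial set" where
  "monomials n = {m. Poly_Mapping.keys m \<subseteq> {1..n} \<times> {1..n}}"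

definition poly_ring :: "nat \<Rightarrow> mpoly ring" where
  "poly_ring n =
     \<lparr>carrier = {p. Poly_Mapping.keys p \<subseteq> monomials n}, monoid.mult = (*), one = 1, zero = 0, add = (+)\<rparr>"

definition indet :: "nat \<Rightarrow> nat \<Rightarrow> mpoly" where
  "indet i j = Poly_Mapping.single (Poly_Mapping.single (i, j) 1) 1"

lemma cring_poly_ring: "cring (poly_ring n)"
proof (rule cringI)
  have 0: "0 \<in> monomials n"
    by (simp add: monomials_def)
  have add: "a + b \<in> monomials n" if "a \<in> monomials n" "b \<in> monomials n" for a b
    using that keys_add[of a b] unfolding monomials_def by blast
  show "abelian_group (poly_ring n)"
  proof (rule abelian_groupI)
    fix x assume "x \<in> carrier (poly_ring n)"
    then show "\<exists>y\<in>carrier (poly_ring n). y \<oplus>\<^bsub>poly_ring n\<^esub> x = \<zero>\<^bsub>poly_ring n\<^esub>"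
      by (intro bexI[of _ "- x"]) (auto simp: poly_ring_def)
  qed (use keys_add in \<open>force simp: poly_ring_def algebra_simps\<close>)+
  show "comm_monoid (poly_ring n)"
  proof (rule comm_monoidI)
    fix x y assume "x \<in> carrier (poly_ring n)" "y \<in> carrier (poly_ring n)"
    then show "x \<otimes>\<^bsub>poly_ring n\<^esub> y \<in> carrier (poly_ring n)"
      using keys_mult[of x y] add by (fastforce simp: poly_ring_def)
  qed (use 0 in \<open>auto simp: poly_ring_def algebra_simps\<close>)
qed (auto simp: poly_ring_def algebra_simps)

section \<open>Term orders and Groebner bases\<close>

text \<open>\<open>(a, b) \<in> \<sigma>\<close> means \<open>a \<le> b\<close>; the exponent function \<open>0\<close> is the monomial 1.\<close>

definition term_order :: "nat \<Rightarrow> monomial rel \<Rightarrow> bool" where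
  "term_order n \<sigma> \<longleftrightarrow>
     linear_order_on (monomials n) \<sigma> \<and>
     (\<forall>a\<in>monomials n. (0, a) \<in> \<sigma>) \<and>
     (\<forall>a\<in>monomials n. \<forall>b\<in>monomials n. \<forall>c\<in>monomials n. (a, b) \<in> \<sigma> \<longrightarrow> (a + c, b + c) \<in> \<sigma>)"

text \<open>The next two notions are meaningful for \<open>p \<noteq> 0\<close> only. The leading term includes the
  leading coefficient.\<close>

definition leading_monomial :: "monomial rel \<Rightarrow> mpoly \<Rightarrow> monomial" where
  "leading_monomial \<sigma> p = (THE m. m \<in> Poly_Mapping.keys p \<and> (\<forall>m'\<in>Poly_Mapping.keys p. (m', m) \<in> \<sigma>))"

definition leading_term :: "monomial rel \<Rightarrow> mpoly \<Rightarrow> mpoly" where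
  "leading_term \<sigma> p =
     Poly_Mapping.single (leading_monomial \<sigma> p) (Poly_Mapping.lookup p (leading_monomial \<sigma> p))"

definition groebner_basis :: "nat \<Rightarrow> monomial rel \<Rightarrow> mpoly set \<Rightarrow> mpoly set \<Rightarrow> bool" where
  "groebner_basis n \<sigma> G I \<longleftrightarrow>
     G \<subseteq> carrier (poly_ring n) \<and>
     I = Idl\<^bsub>poly_ring n\<^esub> G \<and>
     Idl\<^bsub>poly_ring n\<^esub> (leading_term \<sigma> ` (I - {0})) =
       Idl\<^bsub>poly_ring n\<^esub> (leading_term \<sigma> ` (G - {0}))"

section \<open>Minors and Schubert determinantal ideals\<close>

text \<open>Rows and columns of the library's matrices are counted from 0, whence the \<open>Suc\<close>.\<close>

definition generic_mat :: "nat \<Rightarrow> mpoly mat" where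
  "generic_mat n = mat n n (\<lambda>(a, b). indet (Suc a) (Suc b))"

definition generic_mat_dom :: "nat \<Rightarrow> (nat \<Rightarrow> nat) \<Rightarrow> mpoly mat" where
  "generic_mat_dom n w =
     mat n n (\<lambda>(a, b). if (Suc a, Suc b) \<in> dominant_part n w then 0 else indet (Suc a) (Suc b))"

definition northwest :: "'a mat \<Rightarrow> nat \<Rightarrow> nat \<Rightarrow> 'a mat" where
  "northwest M i j = submatrix M {..<i} {..<j}"

definition minors :: "nat \<Rightarrow> 'a::comm_ring_1 mat \<Rightarrow> 'a set" where
  "minors k M = {det (submatrix M A B) | A B.
     A \<subseteq> {..<dim_row M} \<and> B \<subseteq> {..<dim_col M} \<and> card A = k \<and> card B = k}"

definition diagonal_term_order :: "nat \<Rightarrow> monomial rel \<Rightarrow> bool" where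
  "diagonal_term_order n \<sigma> \<longleftrightarrow>
     term_order n \<sigma> \<and>
     (\<forall>A B. A \<subseteq> {..<n} \<and> B \<subseteq> {..<n} \<and> card A = card B \<longrightarrow>
        leading_term \<sigma> (det (submatrix (generic_mat n) A B)) =
          prod_list (diag_mat (submatrix (generic_mat n) A B)))"

definition schubert_ideal :: "nat \<Rightarrow> (nat \<Rightarrow> nat) \<Rightarrow> mpoly set" where
  "schubert_ideal n w =
     Idl\<^bsub>poly_ring n\<^esub>
       (\<Union>(i, j)\<in>{1..n} \<times> {1..n}. minors (rank_fun w i j + 1) (northwest (generic_mat n) i j))"

definition CDG_generators :: "nat \<Rightarrow> (nat \<Rightarrow> nat) \<Rightarrow> mpoly set" where
  "CDG_generators n w =
     (\<Union>(i, j)\<in>essential_set n w - dominant_part n w.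
        minors (rank_fun w i j + 1) (northwest (generic_mat_dom n w) i j)) \<union>
     {indet i j | i j. (i, j) \<in> dominant_part n w}"

end

theory Submission
  imports Defs
begin

text \<open>
  View \<open>w\<close> as a set \<open>D\<close> of dots, or more generally take any partial permutation. Modulo the variables
  in the dominant part, the leading monomials of the CDG generators are supported on chains that run
  NW to SE, except for inversions across the dominant part, and are longer than the rank permits;
  sets of cells containing such a chain are called bad. So the Groebner property fails as
  soon as the ideal contains a nonzero polynomial, free of the dominant variables, whose leading
  monomial has no bad chain in its support; call \<open>D\<close> good in this case. Chio condensation at the entry
  of a left-to-right minimum shows that goodness of \<open>D\<close> without this dot is inherited by \<open>D\<close>.

  The eight patterns are covered by five configurations (one of them the transpose of another). By
  induction, every left-to-right minimum may be assumed to be indispensable for the configuration.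
  Then \<open>D\<close> has one, two or three left-to-right minima and the dots near the configuration are
  controlled, so that a good polynomial can be given: for 13254 as an element of minimal leading
  monomial in a space of multilinear polynomials, otherwise by eliminating one or two variables from
  two or three minors, which leaves an element of the ideal in variables that contain no bad chain.
\<close>

text \<open>A diagonal order \<sigma> is known on minors and hardly anywhere else, so the leading
  monomial of another element of the ideal can be controlled only indirectly. For 13254, minimality
  in a finite set of candidates replaces this knowledge. In the other configurations the entries at
  the left-to-right minima are the ones that have to disappear, either by elimination or because the
  chosen blocks omit them. Once they are gone, a chain in the remaining variables that uses the row
  of such a minimum cannot use its column: the two cells would form an inversion whose north-west
  corner is the minimum itself, a cell of positive rank. This keeps chains from exceeding the rank;
  the blocks are chosen so that the rest is a pigeonhole argument. That the elimination does not end
  in 0 is checked at a single 0-1 point. It is built so that each minor involved has one matching or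
  none there, so that no cancellation between matchings has to be followed.\<close>

type_synonym cell = "nat \<times> nat"

abbreviation (input) "keys \<equiv> Poly_Mapping.keys"

abbreviation (input) "lookup \<equiv> Poly_Mapping.lookup"

section \<open>Constants, variables and squarefree monomials\<close>

abbreviation cst :: "complex \<Rightarrow> mpoly" where
  "cst a \<equiv> Poly_Mapping.single 0 a"

definition var :: "cell \<Rightarrow> mpoly" where
  "var c = Poly_Mapping.single (Poly_Mapping.single c 1) 1"

definition mon :: "cell set \<Rightarrow> monomial" where
  "mon C = (\<Sum>c\<in>C. Poly_Mapping.single c 1)"

lemma lookup_mon: "finite C \<Longrightarrow> lookup (mon C) c = (if c \<in> C then 1 else 0)"
  by (simp add: mon_def lookup_sum lookup_single when_def)

lemma keys_mon [simp]: "finite C \<Longrightarrow> keys (mon C) = C"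
  by (auto simp: in_keys_iff lookup_mon split: if_splits)

lemma mon_inj: "finite C \<Longrightarrow> finite D \<Longrightarrow> mon C = mon D \<Longrightarrow> C = D"
  using keys_mon by metis

lemma mon_Un: "finite C \<Longrightarrow> finite D \<Longrightarrow> C \<inter> D = {} \<Longrightarrow> mon (C \<union> D) = mon C + mon D"
  by (simp add: mon_def sum.union_disjoint)

lemma prod_var: "(\<Prod>c\<in>C. var c) = Poly_Mapping.single (mon C) 1"
proof (cases "finite C")
  case True
  then show ?thesis
    by induction (simp_all add: mon_def var_def mult_single)
qed (simp add: mon_def)

lemma poly_expand: "(p :: mpoly) = (\<Sum>m\<in>keys p. Poly_Mapping.single m (lookup p m))"
  by (rule poly_mapping_eqI) (simp add: lookup_sum lookup_single when_def in_keys_iff)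

lemma single_expand: "Poly_Mapping.single m a = cst a * Poly_Mapping.single m 1"
  by (simp add: mult_single)

lemma monomial_expand: "(m :: monomial) = (\<Sum>c\<in>keys m. Poly_Mapping.single c (lookup m c))"
  by (rule poly_mapping_eqI) (simp add: lookup_sum lookup_single when_def in_keys_iff)

lemma var_power: "var c ^ k = Poly_Mapping.single (Poly_Mapping.single c k) 1"
  by (induction k) (simp_all add: var_def mult_single single_add[symmetric])

lemma single_prod: "finite C \<Longrightarrow>
  (\<Prod>c\<in>C. Poly_Mapping.single (f c) (1::complex)) = Poly_Mapping.single (\<Sum>c\<in>C. f c :: monomial) 1"
  by (induction rule: finite_induct) (simp_all add: mult_single)

lemma monomial_as_prod: "Poly_Mapping.single m 1 = (\<Prod>c\<in>keys m. var c ^ lookup m c)"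
  unfolding var_power by (subst monomial_expand[of m], subst single_prod) simp_all

section \<open>Polynomials in a given set of variables\<close>

definition pols :: "cell set \<Rightarrow> mpoly set" where
  "pols V = {p. \<forall>m\<in>keys p. keys m \<subseteq> V}"

lemma pols_mono: "V \<subseteq> W \<Longrightarrow> pols V \<subseteq> pols W"
  by (auto simp: pols_def)

lemma pols_0 [simp]: "0 \<in> pols V" and pols_cst [simp]: "cst a \<in> pols V" and pols_1 [simp]: "1 \<in> pols V"
  by (auto simp: pols_def)

lemma pols_var [simp]: "var c \<in> pols V \<longleftrightarrow> c \<in> V"
  by (auto simp: pols_def var_def)

lemma pols_single: "keys m \<subseteq> V \<Longrightarrow> Poly_Mapping.single m a \<in> pols V"
  by (auto simp: pols_def)

lemma pols_add: "p \<in> pols V \<Longrightarrow> q \<in> pols V \<Longrightarrow> p + q \<in> pols V"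
  using keys_add[of p q] by (auto simp: pols_def)

lemma pols_uminus: "p \<in> pols V \<Longrightarrow> - p \<in> pols V"
  by (auto simp: pols_def)

lemma pols_diff: "p \<in> pols V \<Longrightarrow> q \<in> pols V \<Longrightarrow> p - q \<in> pols V"
  using pols_add[OF _ pols_uminus] by fastforce

lemma pols_mult: "p \<in> pols V \<Longrightarrow> q \<in> pols V \<Longrightarrow> p * q \<in> pols V"
  unfolding pols_def mem_Collect_eq
proof
  fix m assume pq: "\<forall>m\<in>keys p. keys m \<subseteq> V" "\<forall>m\<in>keys q. keys m \<subseteq> V" and "m \<in> keys (p * q)"
  then obtain a b where "m = a + b" "a \<in> keys p" "b \<in> keys q"
    using keys_mult[of p q] by blast
  with pq show "keys m \<subseteq> V"
    using keys_add[of a b] by blast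
qed

lemma pols_sum: "(\<And>i. i \<in> I \<Longrightarrow> f i \<in> pols V) \<Longrightarrow> sum f I \<in> pols V"
  by (induction I rule: infinite_finite_induct) (auto intro: pols_add)

lemma pols_prod: "(\<And>i. i \<in> I \<Longrightarrow> f i \<in> pols V) \<Longrightarrow> prod f I \<in> pols V"
  by (induction I rule: infinite_finite_induct) (auto intro: pols_mult)

lemma pols_power: "p \<in> pols V \<Longrightarrow> p ^ k \<in> pols V"
  by (induction k) (auto intro: pols_mult)

lemma carrier_poly_ring: "carrier (poly_ring n) = pols ({1..n} \<times> {1..n})"
  by (auto simp: poly_ring_def pols_def monomials_def)

text \<open>Lets statements about evaluation, substitution and pseudo-division be checked on
  constants and variables. The proof climbs from powers of a variable to monomials and then to
  finite sums.\<close>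

lemma pols_induct [consumes 1, case_names cst var add mult]:
  assumes "p \<in> pols V"
    and "\<And>a. P (cst a)"
    and "\<And>c. c \<in> V \<Longrightarrow> P (var c)"
    and "\<And>p q. p \<in> pols V \<Longrightarrow> q \<in> pols V \<Longrightarrow> P p \<Longrightarrow> P q \<Longrightarrow> P (p + q)"
    and "\<And>p q. p \<in> pols V \<Longrightarrow> q \<in> pols V \<Longrightarrow> P p \<Longrightarrow> P q \<Longrightarrow> P (p * q)"
  shows "P p"
proof -
  have P0: "P 0" and P1: "P 1"
    using assms(2)[of 0] assms(2)[of 1] by (simp_all)
  have pow: "P (var c ^ k) \<and> var c ^ k \<in> pols V" if "c \<in> V" for c k
    using that by (induction k) (auto intro: assms P1 pols_mult)
  have prod: "P (\<Prod>c\<in>C. var c ^ f c) \<and> (\<Prod>c\<in>C. var c ^ f c) \<in> pols V" if "finite C" "C \<subseteq> V" for C f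
    using that by (induction rule: finite_induct) (auto simp: P1 pow intro!: assms(5) pols_mult)
  have single: "P (Poly_Mapping.single m a) \<and> Poly_Mapping.single m a \<in> pols V" if "keys m \<subseteq> V" for m a
    using prod[of "keys m" "lookup m"] that
    by (subst (1 2) single_expand) (auto simp: monomial_as_prod intro!: assms(2,5) pols_mult)
  have "P (\<Sum>m\<in>M. Poly_Mapping.single m (f m)) \<and> (\<Sum>m\<in>M. Poly_Mapping.single m (f m)) \<in> pols V"
    if "finite M" "\<forall>m\<in>M. keys m \<subseteq> V" for M f
    using that by (induction rule: finite_induct) (auto simp: P0 single intro!: assms(4) pols_add)
  from this[of "keys p" "lookup p"] show ?thesis
    using assms(1) poly_expand[of p] by (auto simp: pols_def)
qed

text \<open>Evaluation of a polynomial at \<open>s\<close>, with coefficients mapped by \<open>c\<close>; it serves both for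
  points (\<open>c = id\<close>) and for substitutions (\<open>c = cst\<close>).\<close>

definition ev :: "(complex \<Rightarrow> 'b::comm_ring_1) \<Rightarrow> (cell \<Rightarrow> 'b) \<Rightarrow> mpoly \<Rightarrow> 'b" where
  "ev c s p = (\<Sum>m\<in>keys p. c (lookup p m) * (\<Prod>x\<in>keys m. s x ^ lookup m x))"

section \<open>Evaluation homomorphisms\<close>

locale coeff_hom =
  fixes c :: "complex \<Rightarrow> 'b::comm_ring_1"
  assumes c_0: "c 0 = 0" and c_1: "c 1 = 1"
    and c_add: "c (a + b) = c a + c b" and c_mult: "c (a * b) = c a * c b"
begin

lemma ev_superset:
  assumes "finite K" "keys p \<subseteq> K"
  shows "ev c s p = (\<Sum>m\<in>K. c (lookup p m) * (\<Prod>x\<in>keys m. s x ^ lookup m x))"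
  unfolding ev_def by (rule sum.mono_neutral_left) (use assms in \<open>auto simp: in_keys_iff c_0\<close>)

lemma ev_add [simp]: "ev c s (p + q) = ev c s p + ev c s q"
proof -
  define K where "K = keys p \<union> keys q"
  have "finite K" "keys p \<subseteq> K" "keys q \<subseteq> K" "keys (p + q) \<subseteq> K"
    using keys_add[of p q] by (auto simp: K_def)
  then show ?thesis
    by (simp add: ev_superset lookup_add c_add algebra_simps sum.distrib)
qed

lemma ev_0 [simp]: "ev c s 0 = 0"
  by (simp add: ev_def)

lemma ev_sum [simp]: "ev c s (sum f A) = (\<Sum>a\<in>A. ev c s (f a))"
  by (induction A rule: infinite_finite_induct) simp_all

lemma ev_single [simp]: "ev c s (Poly_Mapping.single m a) = c a * (\<Prod>x\<in>keys m. s x ^ lookup m x)"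
  by (cases "a = 0") (simp_all add: ev_def c_0)

lemma mono_superset:
  assumes "finite K" "keys m \<subseteq> K"
  shows "(\<Prod>x\<in>keys m. s x ^ lookup m x) = (\<Prod>x\<in>K. s x ^ lookup m x :: 'b)"
  by (rule prod.mono_neutral_left) (use assms in \<open>auto simp: in_keys_iff\<close>)

lemma mono_add: "(\<Prod>x\<in>keys (m + m'). s x ^ lookup (m + m') x) =
   (\<Prod>x\<in>keys m. s x ^ lookup m x) * (\<Prod>x\<in>keys m'. s x ^ lookup (m' :: monomial) x :: 'b)"
proof -
  define K where "K = keys m \<union> keys m'"
  have "finite K" "keys m \<subseteq> K" "keys m' \<subseteq> K" "keys (m + m') \<subseteq> K"
    using keys_add[of m m'] by (auto simp: K_def)
  then show ?thesis
    using mono_superset[OF \<open>finite K\<close>, of m s] mono_superset[OF \<open>finite K\<close>, of m' s]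
      mono_superset[OF \<open>finite K\<close>, of "m + m'" s]
    by (simp add: lookup_add power_add prod.distrib)
qed

lemma ev_mult [simp]: "ev c s (p * q) = ev c s p * ev c s q"
proof -
  have "p * q = (\<Sum>m\<in>keys p. \<Sum>m'\<in>keys q. Poly_Mapping.single (m + m') (lookup p m * lookup q m'))"
    by (subst poly_expand[of p], subst poly_expand[of q]) (simp add: sum_product mult_single)
  then have "ev c s (p * q) = (\<Sum>m\<in>keys p. \<Sum>m'\<in>keys q. c (lookup p m * lookup q m') *
      (\<Prod>x\<in>keys (m + m'). s x ^ lookup (m + m') x))"
    by simp
  also have "\<dots> = ev c s p * ev c s q"
    unfolding ev_def sum_product mono_add by (simp add: c_mult algebra_simps)
  finally show ?thesis .
qed

lemma ev_cst [simp]: "ev c s (cst a) = c a"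
  by simp

lemma ev_1 [simp]: "ev c s 1 = 1"
  using ev_cst[of s 1] by (simp add: c_1 del: ev_single)

lemma ev_var [simp]: "ev c s (var x) = s x"
  by (simp add: var_def c_1)

lemma c_uminus: "c (- a) = - c a"
  using c_add[of a "- a"] by (simp add: c_0 eq_neg_iff_add_eq_0 add.commute)

lemma ev_uminus [simp]: "ev c s (- p) = - ev c s p"
  using ev_add[of s p "- p"] by (simp add: eq_neg_iff_add_eq_0 add.commute)

lemma ev_diff [simp]: "ev c s (p - q) = ev c s p - ev c s q"
  using ev_add[of s p "- q"] by simp

lemma ev_prod [simp]: "ev c s (prod f A) = (\<Prod>a\<in>A. ev c s (f a))"
  by (induction A rule: infinite_finite_induct) simp_all

lemma ev_power [simp]: "ev c s (p ^ k) = ev c s p ^ k"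
  by (induction k) simp_all

end

interpretation at_pt: coeff_hom "\<lambda>a::complex. a"
  by unfold_locales simp_all

interpretation subst: coeff_hom cst
  by unfold_locales (rule single_zero, rule single_one, rule single_add, simp only: mult_single add_0_right)

abbreviation at_pt :: "(cell \<Rightarrow> complex) \<Rightarrow> mpoly \<Rightarrow> complex" where
  "at_pt \<equiv> ev (\<lambda>a. a)"

abbreviation subst :: "(cell \<Rightarrow> mpoly) \<Rightarrow> mpoly \<Rightarrow> mpoly" where
  "subst \<equiv> ev cst"

lemma subst_id:
  assumes "p \<in> pols V" "\<And>x. x \<in> V \<Longrightarrow> s x = var x"
  shows "subst s p = p"
  using assms(1) by (induction rule: pols_induct) (simp_all add: assms(2))

lemma subst_in_pols:
  assumes "p \<in> pols V" "\<And>x. x \<in> V \<Longrightarrow> s x \<in> pols W"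
  shows "subst s p \<in> pols W"
  using assms(1) by (induction rule: pols_induct) (simp_all add: assms(2) pols_add pols_mult del: subst.ev_single)

lemma subst_subst: "subst s (subst t p) = subst (\<lambda>x. subst s (t x)) p"
proof -
  have "p \<in> pols UNIV"
    by (simp add: pols_def)
  then show ?thesis
    by (induction rule: pols_induct) simp_all
qed

section \<open>Ideals of polynomials\<close>

text \<open>Here all pairs of natural numbers are variables, not only the cells of the \<open>n \<times> n\<close> matrix.\<close>

inductive_set idl :: "mpoly set \<Rightarrow> mpoly set" for G where
  zero: "0 \<in> idl G"
| step: "f \<in> idl G \<Longrightarrow> g \<in> G \<Longrightarrow> c * g + f \<in> idl G"

lemma idl_gen: "g \<in> G \<Longrightarrow> g \<in> idl G"
  using idl.step[OF idl.zero, of g G 1] by simp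

lemma idl_add: "f \<in> idl G \<Longrightarrow> h \<in> idl G \<Longrightarrow> f + h \<in> idl G"
  by (induction rule: idl.induct) (auto simp: add.assoc intro: idl.intros)

lemma idl_mult: "f \<in> idl G \<Longrightarrow> h * f \<in> idl G"
  by (induction rule: idl.induct) (auto simp: distrib_left mult.assoc[symmetric] intro: idl.intros)

lemma idl_uminus: "f \<in> idl G \<Longrightarrow> - f \<in> idl G"
  using idl_mult[of f G "- 1"] by simp

lemma idl_diff: "f \<in> idl G \<Longrightarrow> h \<in> idl G \<Longrightarrow> f - h \<in> idl G"
  using idl_add[OF _ idl_uminus] by fastforce

lemma idl_sum: "(\<And>i. i \<in> I \<Longrightarrow> f i \<in> idl G) \<Longrightarrow> sum f I \<in> idl G"
  by (induction I rule: infinite_finite_induct) (auto intro: idl_add idl.zero)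

lemma idl_subset: "G \<subseteq> idl H \<Longrightarrow> idl G \<subseteq> idl H"
proof
  fix f assume "G \<subseteq> idl H" "f \<in> idl G"
  from this(2) show "f \<in> idl H"
    by induction (use \<open>G \<subseteq> idl H\<close> in \<open>auto intro: idl.zero idl_add idl_mult\<close>)
qed

text \<open>The factor \<open>d\<close> is carried along because the Schur substitution takes a
  generator into the target ideal only after multiplication by the pivot variable.\<close>

lemma idl_subst:
  assumes "f \<in> idl G" "\<And>g. g \<in> G \<Longrightarrow> d * subst s g \<in> idl H"
  shows "d * subst s f \<in> idl H"
  using assms(1)
proof induction
  case (step f g c)
  have "d * subst s (c * g + f) = subst s c * (d * subst s g) + d * subst s f"
    by (simp add: algebra_simps)
  with step assms(2) show ?case
    by (simp add: idl_add idl_mult)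
qed (simp add: idl.zero)

text \<open>Setting the variables outside the box to 0 is a retraction onto
  \<open>poly_ring n\<close>. It fixes \<open>f\<close> and \<open>G\<close> and turns arbitrary
  coefficients into coefficients of that ring.\<close>

lemma idl_le_Idl:
  assumes "f \<in> idl G" "f \<in> pols ({1..n} \<times> {1..n})" "G \<subseteq> pols ({1..n} \<times> {1..n})"
  shows "f \<in> Idl\<^bsub>poly_ring n\<^esub> G"
proof -
  interpret cring "poly_ring n"
    by (rule cring_poly_ring)
  define V where "V = {1..n} \<times> {1..n}"
  define s where "s = (\<lambda>x. if x \<in> V then var x else 0)"
  interpret I: ideal "Idl\<^bsub>poly_ring n\<^esub> G" "poly_ring n"
    by (rule genideal_ideal) (use assms(3) in \<open>simp add: carrier_poly_ring\<close>)
  have sub: "G \<subseteq> Idl\<^bsub>poly_ring n\<^esub> G"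
    by (rule genideal_self) (use assms(3) in \<open>simp add: carrier_poly_ring\<close>)
  have s: "subst s q \<in> carrier (poly_ring n)" for q
    unfolding carrier_poly_ring
    by (rule subst_in_pols[of _ UNIV]) (auto simp: pols_def s_def V_def var_def)
  from assms(1) have "subst s f \<in> Idl\<^bsub>poly_ring n\<^esub> G"
  proof induction
    case zero
    then show ?case using I.zero_closed by (simp add: poly_ring_def)
  next
    case (step f g c)
    have "subst s g = g"
      by (rule subst_id[of _ V]) (use step assms in \<open>auto simp: V_def s_def\<close>)
    moreover have "subst s c * g \<in> Idl\<^bsub>poly_ring n\<^esub> G"
      using I.I_l_closed[OF subsetD[OF sub step(2)] s[of c]] by (simp add: poly_ring_def)
    ultimately show ?case
      using I.a_closed[of "subst s c * g" "subst s f"] step by (simp add: poly_ring_def)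
  qed
  also have "subst s f = f"
    by (rule subst_id[of _ V]) (use assms in \<open>auto simp: V_def s_def\<close>)
  finally show ?thesis .
qed

subsection \<open>Minors\<close>

lemma pick_bij:
  assumes "finite A"
  shows "bij_betw (pick A) {..<card A} A"
proof (rule bij_betw_imageI)
  show inj: "inj_on (pick A) {..<card A}"
    by (rule inj_onI) (metis lessThan_iff linorder_neqE_nat nat_neq_iff pick_mono_le)
  have "pick A ` {..<card A} \<subseteq> A"
    by (auto intro: pick_in_set_le)
  then show "pick A ` {..<card A} = A"
    using assms by (intro card_subset_eq) (simp_all add: card_image[OF inj])
qed

text \<open>Rows and columns are listed by \<open>u\<close> and \<open>v\<close> in any order, as
  condensation wants its pivot in front, whereas \<open>mn\<close> takes the increasing order.
  \<open>dm_eq_mn\<close> passes between the two up to a sign, which an ideal does not see.\<close>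

definition dm :: "(cell \<Rightarrow> 'a::comm_ring_1) \<Rightarrow> (nat \<Rightarrow> nat) \<Rightarrow> (nat \<Rightarrow> nat) \<Rightarrow> nat \<Rightarrow> 'a" where
  "dm s u v k = det (mat k k (\<lambda>(i, j). s (u i, v j)))"

definition mn :: "(cell \<Rightarrow> 'a::comm_ring_1) \<Rightarrow> nat set \<Rightarrow> nat set \<Rightarrow> 'a" where
  "mn s A B = dm s (pick A) (pick B) (card A)"

lemma dm_perm_rows:
  assumes "p permutes {..<k}"
  shows "dm s (u \<circ> p) v k = signof p * dm s u v k"
proof -
  have "dm s (u \<circ> p) v k = det (mat k k (\<lambda>(i, j). mat k k (\<lambda>(i, j). s (u i, v j)) $$ (p i, j)))"
    unfolding dm_def
    by (rule arg_cong[of _ _ det], rule eq_matI) (simp_all add: permutes_in_image[OF assms, simplified])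
  also have "\<dots> = signof p * dm s u v k"
    unfolding dm_def by (rule det_permute_rows) (use assms in \<open>auto simp: lessThan_atLeast0\<close>)
  finally show ?thesis .
qed

lemma dm_transpose: "dm (s \<circ> prod.swap) v u k = dm s u v k"
proof -
  have "mat k k (\<lambda>(i, j). (s \<circ> prod.swap) (v i, u j)) = transpose_mat (mat k k (\<lambda>(i, j). s (u i, v j)))"
    by (rule eq_matI) auto
  then show ?thesis
    by (simp add: dm_def det_transpose[of _ k])
qed

lemma dm_perm_cols:
  assumes "p permutes {..<k}"
  shows "dm s u (v \<circ> p) k = signof p * dm s u v k"
  using dm_perm_rows[OF assms, of "s \<circ> prod.swap" v u]
  by (simp only: dm_transpose)

lemma bij_betw_permutation:
  assumes "bij_betw u {..<k} A" "bij_betw u' {..<k} A"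
  obtains p where "p permutes {..<k}" "\<And>i. i < k \<Longrightarrow> u' i = u (p i)"
proof -
  define p where "p i = (if i < k then inv_into {..<k} u (u' i) else i)" for i
  have "bij_betw (inv_into {..<k} u \<circ> u') {..<k} {..<k}"
    using assms bij_betw_trans bij_betw_inv_into by blast
  then have "bij_betw p {..<k} {..<k}"
    by (rule bij_betw_cong[THEN iffD1, rotated]) (simp add: p_def)
  then have "p permutes {..<k}"
    by (rule bij_imp_permutes) (simp add: p_def)
  moreover have "u (p i) = u' i" if "i < k" for i
    using that assms by (simp add: p_def bij_betw_inv_into_right bij_betwE)
  ultimately show ?thesis
    using that by metis
qed

lemma signof_cases: "signof p = (1 :: 'a::comm_ring_1) \<or> signof p = (- 1 :: 'a)"
  by (simp add: sign_def)

lemma dm_cong: "(\<And>i j. i < k \<Longrightarrow> j < k \<Longrightarrow> s (u i, v j) = s' (u' i, v' j)) \<Longrightarrow> dm s u v k = dm s' u' v' k"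
  unfolding dm_def by (intro arg_cong[of _ _ det]) auto

lemma dm_eq_mn:
  assumes "bij_betw u {..<k} A" "bij_betw v {..<k} B"
  shows "dm s u v k = mn s A B \<or> dm s u v k = - mn s A B"
proof -
  have fin: "finite A" "finite B" and k: "card A = k" "card B = k"
    using assms bij_betw_finite bij_betw_same_card by fastforce+
  obtain p where p: "p permutes {..<k}" "\<And>i. i < k \<Longrightarrow> u i = pick A (p i)"
    using bij_betw_permutation[OF _ assms(1), of "pick A"] pick_bij[OF fin(1)] k by auto
  obtain q where q: "q permutes {..<k}" "\<And>i. i < k \<Longrightarrow> v i = pick B (q i)"
    using bij_betw_permutation[OF _ assms(2), of "pick B"] pick_bij[OF fin(2)] k by auto
  have "dm s u v k = dm s (pick A \<circ> p) (pick B \<circ> q) k"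
    by (rule dm_cong) (simp add: p q)
  also have "\<dots> = signof p * (signof q * mn s A B)"
    by (simp add: dm_perm_rows[OF p(1)] dm_perm_cols[OF q(1)] mn_def k)
  finally show ?thesis
    using signof_cases[of p, where ?'a = 'a] signof_cases[of q, where ?'a = 'a] by fastforce
qed

lemma mn_transpose: "card A = card B \<Longrightarrow> mn (s \<circ> prod.swap) B A = mn s A B"
  by (simp add: mn_def dm_transpose)

text \<open>The supports of the monomials of a minor.\<close>

definition matchings :: "nat set \<Rightarrow> nat set \<Rightarrow> cell set set" where
  "matchings A B = {C. bij_betw fst C A \<and> bij_betw snd C B}"

lemma matchings_finite: "finite A \<Longrightarrow> C \<in> matchings A B \<Longrightarrow> finite C"
  unfolding matchings_def using bij_betw_finite by blast

lemma matchings_card: "C \<in> matchings A B \<Longrightarrow> card C = card A"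
  unfolding matchings_def using bij_betw_same_card by blast

lemma matchings_subset: "C \<in> matchings A B \<Longrightarrow> C \<subseteq> A \<times> B"
  unfolding matchings_def bij_betw_def by force

lemma finite_matchings: "finite A \<Longrightarrow> finite B \<Longrightarrow> finite (matchings A B)"
  by (rule finite_subset[of _ "Pow (A \<times> B)"]) (use matchings_subset in auto)

definition perm_cells :: "nat set \<Rightarrow> nat set \<Rightarrow> (nat \<Rightarrow> nat) \<Rightarrow> cell set" where
  "perm_cells A B p = (\<lambda>i. (pick A i, pick B (p i))) ` {..<card A}"

text \<open>The sign of the permutation encoded by a matching, recovered by inverting
  \<open>perm_cells\<close>. After the expansion of a minor, only its being 1 or -1 matters.\<close>

definition msign :: "nat set \<Rightarrow> nat set \<Rightarrow> cell set \<Rightarrow> int" where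
  "msign A B C = sign (inv_into {p. p permutes {..<card A}} (perm_cells A B) C)"

lemma msign_cases: "msign A B C = 1 \<or> msign A B C = - 1"
  by (simp add: msign_def sign_def)

lemma perm_cells_bij:
  assumes "finite A" "finite B" "card A = card B"
  shows "bij_betw (perm_cells A B) {p. p permutes {..<card A}} (matchings A B)"
proof (rule bij_betw_imageI)
  let ?k = "card A"
  note bA = pick_bij[OF assms(1)] and bB = pick_bij[OF assms(2), folded assms(3)]
  show "inj_on (perm_cells A B) {p. p permutes {..<?k}}"
  proof (rule inj_onI, clarsimp)
    fix p q assume pq: "p permutes {..<?k}" "q permutes {..<?k}" and eq: "perm_cells A B p = perm_cells A B q"
    have "p i = q i" if "i < ?k" for i
    proof -
      have "(pick A i, pick B (p i)) \<in> perm_cells A B q"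
        using that unfolding eq[symmetric] by (auto simp: perm_cells_def)
      then obtain j where j: "j < ?k" "pick A i = pick A j" "pick B (p i) = pick B (q j)"
        by (auto simp: perm_cells_def)
      then have "i = j"
        using bA that by (auto simp: bij_betw_def inj_on_def)
      moreover have "p i < ?k" "q j < ?k"
        using pq that j by (auto simp: permutes_in_image[of _ "{..<?k}", simplified])
      ultimately show ?thesis
        using bB j by (auto simp: bij_betw_def inj_on_def)
    qed
    then show "p = q"
      using pq by (metis ext lessThan_iff permutes_not_in)
  qed
  show "perm_cells A B ` {p. p permutes {..<?k}} = matchings A B"
  proof
    show "perm_cells A B ` {p. p permutes {..<?k}} \<subseteq> matchings A B"
    proof clarsimp
      fix p assume p: "p permutes {..<?k}"
      have i: "inj_on (\<lambda>i. (pick A i, pick B (p i))) {..<?k}"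
        using bA by (auto simp: bij_betw_def inj_on_def)
      have "bij_betw (pick A) {..<?k} A" "bij_betw (pick B \<circ> p) {..<?k} B"
        using bA bB p permutes_imp_bij bij_betw_trans by blast+
      then have "bij_betw (fst \<circ> (\<lambda>i. (pick A i, pick B (p i)))) {..<?k} A"
        "bij_betw (snd \<circ> (\<lambda>i. (pick A i, pick B (p i)))) {..<?k} B"
        by (simp_all add: comp_def)
      then show "perm_cells A B p \<in> matchings A B"
        unfolding perm_cells_def matchings_def mem_Collect_eq
          bij_betw_comp_iff[OF inj_on_imp_bij_betw[OF i], symmetric] by (rule conjI)
    qed
    show "matchings A B \<subseteq> perm_cells A B ` {p. p permutes {..<?k}}"
    proof
      fix C assume C: "C \<in> matchings A B"
      then have f: "bij_betw fst C A" and g: "bij_betw snd C B"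
        by (auto simp: matchings_def)
      define h where "h = inv_into C fst"
      have h: "bij_betw h A C" "\<And>a. a \<in> A \<Longrightarrow> fst (h a) = a"
        using f bij_betw_inv_into bij_betw_inv_into_right unfolding h_def by fastforce+
      have "bij_betw (snd \<circ> (h \<circ> pick A)) {..<?k} B"
        by (rule bij_betw_trans[OF bij_betw_trans[OF bA h(1)] g])
      then obtain p where p: "p permutes {..<?k}" "\<And>i. i < ?k \<Longrightarrow> (snd \<circ> (h \<circ> pick A)) i = pick B (p i)"
        using bij_betw_permutation[OF bB] by metis
      have "(pick A i, pick B (p i)) = h (pick A i)" if "i < ?k" for i
        by (rule prod_eqI) (simp_all add: h(2)[OF pick_in_set_le[OF that]] p(2)[OF that, symmetric])
      then have "perm_cells A B p = (h \<circ> pick A) ` {..<?k}"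
        unfolding perm_cells_def by (intro image_cong) auto
      also have "\<dots> = C"
        using bij_betw_trans[OF bA h(1)] by (simp add: bij_betw_def)
      finally show "C \<in> perm_cells A B ` {p. p permutes {..<?k}}"
        using p(1) by blast
    qed
  qed
qed

lemma mn_expand:
  assumes "finite A" "finite B" "card A = card B"
  shows "mn s A B = (\<Sum>C\<in>matchings A B. of_int (msign A B C) * (\<Prod>c\<in>C. s c))"
proof -
  let ?k = "card A" and ?P = "{p. p permutes {..<card A}}"
  note bA = pick_bij[OF assms(1)]
  have 1: "of_int (msign A B (perm_cells A B p)) * (\<Prod>c\<in>perm_cells A B p. s c) =
      signof p * (\<Prod>i<?k. s (pick A i, pick B (p i)))" if "p permutes {..<?k}" for p
  proof -
    have i: "inj_on (\<lambda>i. (pick A i, pick B (p i))) {..<?k}"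
      using bA by (auto simp: bij_betw_def inj_on_def)
    have "inv_into ?P (perm_cells A B) (perm_cells A B p) = p"
      by (rule inv_into_f_f) (use perm_cells_bij[OF assms] that in \<open>auto simp: bij_betw_def\<close>)
    then show ?thesis
      by (simp add: msign_def perm_cells_def prod.reindex[OF i])
  qed
  have "mn s A B = (\<Sum>p\<in>?P. signof p * (\<Prod>i<?k. s (pick A i, pick B (p i))))"
    unfolding mn_def dm_def
    by (subst det_def'[of _ ?k]) (auto simp: atLeast0LessThan permutes_in_image[of _ "{..<?k}", simplified]
        intro!: sum.cong prod.cong)
  also have "\<dots> = (\<Sum>p\<in>?P. of_int (msign A B (perm_cells A B p)) * (\<Prod>c\<in>perm_cells A B p. s c))"
    by (rule sum.cong) (simp_all add: 1)
  also have "\<dots> = (\<Sum>C\<in>matchings A B. of_int (msign A B C) * (\<Prod>c\<in>C. s c))"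
    by (rule sum.reindex_bij_betw[OF perm_cells_bij[OF assms]])
  finally show ?thesis .
qed

lemma (in coeff_hom) c_of_int: "c (of_int k) = of_int k"
proof -
  have nat: "c (of_nat m) = of_nat m" for m
    by (induction m) (simp_all add: c_0 c_1 c_add)
  show ?thesis
  proof (cases k rule: int_cases2)
    case (nonneg m)
    then show ?thesis by (simp add: nat)
  next
    case (nonpos m)
    then show ?thesis by (simp add: nat c_uminus)
  qed
qed

lemma (in coeff_hom) ev_of_int [simp]: "ev c s (of_int k) = of_int k"
  using ev_cst[of s "of_int k"] by (simp add: c_of_int del: ev_single flip: single_of_int)

lemma (in coeff_hom) ev_mn:
  assumes "finite A" "finite B" "card A = card B"
  shows "ev c s (mn t A B) = mn (\<lambda>x. ev c s (t x)) A B"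
  by (simp add: mn_expand[OF assms])

lemma mn_in_pols:
  assumes "finite A" "finite B" "card A = card B" "\<And>x. x \<in> A \<times> B \<Longrightarrow> s x \<in> pols V"
  shows "mn s A B \<in> pols V"
proof -
  have "of_int k \<in> pols V" for k
    using pols_cst[of "of_int k" V] by simp
  then show ?thesis
    unfolding mn_expand[OF assms(1-3)]
    by (intro pols_sum pols_mult pols_prod assms(4)) (use matchings_subset in blast)+
qed

definition zvar :: "cell set \<Rightarrow> cell \<Rightarrow> mpoly" where
  "zvar N x = (if x \<in> N then 0 else var x)"

lemma prod_zvar:
  assumes "finite C"
  shows "(\<Prod>c\<in>C. zvar N c) = (if C \<inter> N = {} then Poly_Mapping.single (mon C) 1 else 0)"
proof (cases "C \<inter> N = {}")
  case True
  then have "(\<Prod>c\<in>C. zvar N c) = (\<Prod>c\<in>C. var c)"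
    by (intro prod.cong) (auto simp: zvar_def)
  with True show ?thesis by (simp add: prod_var)
next
  case False
  then show ?thesis
    using assms by (auto simp: zvar_def intro!: prod_zero)
qed

lemma lookup_mn_zvar:
  assumes "finite A" "finite B" "card A = card B"
  shows "lookup (mn (zvar N) A B) m = (\<Sum>C\<in>matchings A B. if C \<inter> N = {} \<and> m = mon C then of_int (msign A B C) else 0)"
proof -
  have "lookup (of_int k * (\<Prod>c\<in>C. zvar N c)) m = (if C \<inter> N = {} \<and> m = mon C then of_int k else 0)"
    if "C \<in> matchings A B" for k C
    using matchings_finite[OF assms(1) that]
    by (auto simp: prod_zvar lookup_single when_def mult_single simp flip: single_of_int)
  then show ?thesis
    by (simp add: mn_expand[OF assms] lookup_sum)
qed

text \<open>Nothing cancels: different matchings give different squarefree monomials, and each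
  coefficient is 1 or -1.\<close>

lemma keys_mn_zvar:
  assumes "finite A" "finite B" "card A = card B"
  shows "keys (mn (zvar N) A B) = mon ` {C \<in> matchings A B. C \<inter> N = {}}"
proof -
  have "lookup (mn (zvar N) A B) (mon C) = of_int (msign A B C)" if "C \<in> matchings A B" "C \<inter> N = {}" for C
  proof -
    have "(C' \<inter> N = {} \<and> mon C = mon C') \<longleftrightarrow> C' = C" if "C' \<in> matchings A B" for C'
      using that \<open>C \<in> matchings A B\<close> \<open>C \<inter> N = {}\<close> mon_inj matchings_finite[OF assms(1)] by metis
    then show ?thesis
      using that finite_matchings[OF assms(1,2)] by (simp add: lookup_mn_zvar[OF assms] sum.delta cong: sum.cong if_cong)
  qed
  then have "mon ` {C \<in> matchings A B. C \<inter> N = {}} \<subseteq> keys (mn (zvar N) A B)"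
    using msign_cases[of A B] by (auto simp: in_keys_iff) (metis of_int_eq_0_iff one_neq_zero neg_equal_0_iff_equal)
  moreover have "keys (mn (zvar N) A B) \<subseteq> mon ` {C \<in> matchings A B. C \<inter> N = {}}"
  proof
    fix m assume "m \<in> keys (mn (zvar N) A B)"
    then have "(\<Sum>C\<in>matchings A B. if C \<inter> N = {} \<and> m = mon C then of_int (msign A B C) else 0) \<noteq> (0::complex)"
      by (simp add: in_keys_iff lookup_mn_zvar[OF assms])
    then obtain C where "C \<in> matchings A B" "(if C \<inter> N = {} \<and> m = mon C then of_int (msign A B C) else 0) \<noteq> (0::complex)"
      by (rule sum.not_neutral_contains_not_neutral)
    then show "m \<in> mon ` {C \<in> matchings A B. C \<inter> N = {}}"
      by (auto split: if_splits)
  qed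
  ultimately show ?thesis by blast
qed

lemma zvar_empty: "zvar {} = var"
  by (auto simp: zvar_def)

text \<open>Chio's pivotal condensation.\<close>

lemma chio:
  "s (u 0, v 0) ^ k * dm s u v (Suc k) =
   s (u 0, v 0) * det (mat k k (\<lambda>(i, j). s (u 0, v 0) * s (u (Suc i), v (Suc j)) - s (u (Suc i), v 0) * s (u 0, v (Suc j))))"
    (is "_ = _ * det ?Y")
proof -
  let ?p = "s (u 0, v 0)"
  define W where "W = mat (Suc k) (Suc k) (\<lambda>(i, j). s (u i, v j))"
  \<comment> \<open>Right multiplication by \<open>E\<close> multiplies the columns after the first
    by the pivot and clears the pivot row there. Scaling instead of dividing keeps the identity
    valid in every commutative ring.\<close>
  define E where "E = mat (Suc k) (Suc k) (\<lambda>(i, j). if i = j then (if i = 0 then 1 else ?p) else if i = 0 then - s (u 0, v j) else 0)"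
  have W: "W \<in> carrier_mat (Suc k) (Suc k)" and E: "E \<in> carrier_mat (Suc k) (Suc k)"
    by (auto simp: W_def E_def)
  have "det E = prod_list (diag_mat E)"
    by (rule det_upper_triangular[OF _ E]) (auto simp: E_def)
  also have "diag_mat E = 1 # replicate k ?p"
    by (rule nth_equalityI) (auto simp: diag_mat_def E_def nth_Cons' nth_append)
  finally have dE: "det E = ?p ^ k"
    by simp
  have WE: "(W * E) $$ (i, j) = (if j = 0 then s (u i, v 0) else ?p * s (u i, v j) - s (u i, v 0) * s (u 0, v j))"
    if "i < Suc k" "j < Suc k" for i j
  proof -
    have "(W * E) $$ (i, j) = (\<Sum>l<Suc k. s (u i, v l) * E $$ (l, j))"
      using that E by (auto simp: W_def scalar_prod_def atLeast0LessThan intro!: sum.cong)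
    also have "\<dots> = (\<Sum>l<Suc k. (if l = j then s (u i, v j) * (if j = 0 then 1 else ?p) else 0) +
        (if l = 0 then (if j = 0 then 0 else - s (u i, v 0) * s (u 0, v j)) else 0))"
      using that by (intro sum.cong) (auto simp: E_def)
    also have "\<dots> = (if j = 0 then s (u i, v 0) else ?p * s (u i, v j) - s (u i, v 0) * s (u 0, v j))"
      using that by (simp add: sum.distrib sum.delta algebra_simps del: sum.lessThan_Suc)
    finally show ?thesis .
  qed
  \<comment> \<open>Under transposition the cleared pivot row becomes the zero lower left block that
    the block formula expects.\<close>
  have "transpose_mat (W * E) = four_block_mat (mat 1 1 (\<lambda>_. ?p)) (mat 1 k (\<lambda>(i, j). s (u (Suc j), v 0))) (0\<^sub>m k 1) (transpose_mat ?Y)"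
    (is "_ = ?F")
  proof (rule eq_matI)
    fix i j assume ij: "i < dim_row ?F" "j < dim_col ?F"
    then have "i < Suc k" "j < Suc k" by auto
    then have "transpose_mat (W * E) $$ (i, j) = (W * E) $$ (j, i)"
      using W E by auto
    then show "transpose_mat (W * E) $$ (i, j) = ?F $$ (i, j)"
      using \<open>i < Suc k\<close> \<open>j < Suc k\<close> by (cases i; cases j) (auto simp: WE four_block_mat_def Let_def)
  qed (use W E in auto)
  then have "det (transpose_mat (W * E)) = ?p * det ?Y"
    by (simp only:) (subst det_four_block_mat_lower_left_zero_col[of _ _ k], auto simp: det_transpose[of _ k] det_single)
  moreover have "det (transpose_mat (W * E)) = dm s u v (Suc k) * ?p ^ k"
    using W E unfolding dm_def by (simp add: det_transpose[of _ "Suc k"] det_mult[OF W E] dE flip: W_def)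
  ultimately show ?thesis
    by (simp add: mult.commute)
qed

subsection \<open>Diagonal term orders\<close>

lemma pick_pair:
  assumes "i < i'"
  shows "pick {i, i'} 0 = i" "pick {i, i'} (Suc 0) = i'"
proof -
  have c: "card {i, i'} = 2" using assms by simp
  have "pick {i, i'} 0 \<in> {i, i'}" "pick {i, i'} (Suc 0) \<in> {i, i'}" "pick {i, i'} 0 < pick {i, i'} (Suc 0)"
    by (rule pick_in_set_le pick_mono_le; simp add: c)+
  with assms show "pick {i, i'} 0 = i" "pick {i, i'} (Suc 0) = i'" by auto
qed

lemma pick_Suc_image:
  assumes "finite A" "r < card A"
  shows "pick (Suc ` A) r = Suc (pick A r)"
proof -
  have "{a \<in> Suc ` A. a < Suc (pick A r)} = Suc ` {a \<in> A. a < pick A r}" by auto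
  then have "card {a \<in> Suc ` A. a < Suc (pick A r)} = r"
    using card_pick_le[OF assms(2)] by (simp add: card_image)
  moreover have "Suc (pick A r) \<in> Suc ` A"
    using pick_in_set_le[OF assms(2)] by blast
  ultimately show ?thesis
    using pick_card_in_set by metis
qed

lemma submatrix_mat:
  assumes "A \<subseteq> {..<p}" "B \<subseteq> {..<q}"
  shows "submatrix (mat p q g) A B = mat (card A) (card B) (\<lambda>(i, j). g (pick A i, pick B j))"
proof -
  have "{i. i < p \<and> i \<in> A} = A" "{i. i < q \<and> i \<in> B} = B" using assms by auto
  moreover have "pick A i < p" if "i < card A" for i
    using pick_in_set_le[OF that] assms by auto
  moreover have "pick B i < q" if "i < card B" for i
    using pick_in_set_le[OF that] assms by auto
  ultimately show ?thesis
    by (intro eq_matI) (auto simp: submatrix_def)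
qed

text \<open>Here the 0-based positions of matrices meet the 1-based cells; from now on minors are
  handled as \<open>mn\<close>.\<close>

lemma det_submatrix_mat:
  assumes "A \<subseteq> {..<p}" "B \<subseteq> {..<q}" "card A = card B"
  shows "det (submatrix (mat p q (\<lambda>(a, b). s (Suc a, Suc b))) A B) = mn s (Suc ` A) (Suc ` B)"
proof -
  have fin: "finite A" "finite B" using assms finite_subset by blast+
  have "submatrix (mat p q (\<lambda>(a, b). s (Suc a, Suc b))) A B =
      mat (card A) (card A) (\<lambda>(i, j). s (pick (Suc ` A) i, pick (Suc ` B) j))"
    unfolding submatrix_mat[OF assms(1,2)]
    by (rule eq_matI) (simp_all add: assms(3) pick_Suc_image[OF fin(1), unfolded assms(3)] pick_Suc_image[OF fin(2)])
  then show ?thesis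
    by (simp add: mn_def dm_def card_image)
qed

lemma northwest_mat:
  assumes "i \<le> p" "j \<le> q"
  shows "northwest (mat p q g) i j = mat i j g"
proof -
  have "pick {..<m} a = a" if "a < m" for a m :: nat
  proof -
    have "{x \<in> {..<m}. x < a} = {..<a}" using that by auto
    then show ?thesis
      using pick_card_in_set[of a "{..<m}"] that by simp
  qed
  then show ?thesis
    unfolding northwest_def using assms by (subst submatrix_mat) (auto intro!: eq_matI)
qed

lemma indet_var: "indet i j = var (i, j)"
  by (simp add: indet_def var_def)

lemma generic_mat_var: "generic_mat n = mat n n (\<lambda>(a, b). var (Suc a, Suc b))"
  by (simp add: generic_mat_def indet_var)

lemma generic_mat_dom_zvar: "generic_mat_dom n w = mat n n (\<lambda>(a, b). zvar (dominant_part n w) (Suc a, Suc b))"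
  unfolding generic_mat_dom_def zvar_def indet_var by simp

locale diag_order =
  fixes n :: nat and \<sigma> :: "monomial rel"
  assumes diag: "diagonal_term_order n \<sigma>"
begin

abbreviation "box \<equiv> {1..n} \<times> {1..n}"

lemma linear: "linear_order_on (monomials n) \<sigma>"
  using diag by (auto simp: diagonal_term_order_def term_order_def)

lemma monomials_iff: "m \<in> monomials n \<longleftrightarrow> keys m \<subseteq> box"
  by (simp add: monomials_def)

lemma monomials_add: "a \<in> monomials n \<Longrightarrow> b \<in> monomials n \<Longrightarrow> a + b \<in> monomials n"
  using keys_add[of a b] unfolding monomials_iff by blast

lemma le_refl: "m \<in> monomials n \<Longrightarrow> (m, m) \<in> \<sigma>"
  using linear by (auto simp: linear_order_on_def partial_order_on_def preorder_on_def refl_on_def)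

lemma le_antisym: "(a, b) \<in> \<sigma> \<Longrightarrow> (b, a) \<in> \<sigma> \<Longrightarrow> a = b"
  using linear by (auto simp: linear_order_on_def partial_order_on_def antisym_def)

lemma le_trans: "(a, b) \<in> \<sigma> \<Longrightarrow> (b, c) \<in> \<sigma> \<Longrightarrow> (a, c) \<in> \<sigma>"
  using linear unfolding linear_order_on_def partial_order_on_def preorder_on_def trans_def by blast

lemma le_total: "a \<in> monomials n \<Longrightarrow> b \<in> monomials n \<Longrightarrow> (a, b) \<in> \<sigma> \<or> (b, a) \<in> \<sigma>"
  using linear le_refl by (cases "a = b") (auto simp: linear_order_on_def total_on_def)

lemma le_add: "a \<in> monomials n \<Longrightarrow> b \<in> monomials n \<Longrightarrow> c \<in> monomials n \<Longrightarrow> (a, b) \<in> \<sigma> \<Longrightarrow> (a + c, b + c) \<in> \<sigma>"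
  using diag by (auto simp: diagonal_term_order_def term_order_def)

lemma finite_max:
  assumes "finite K" "K \<noteq> {}" "K \<subseteq> monomials n"
  shows "\<exists>m\<in>K. \<forall>m'\<in>K. (m', m) \<in> \<sigma>"
  using assms
proof (induction K rule: finite_ne_induct)
  case (singleton x)
  then show ?case using le_refl by auto
next
  case (insert x F)
  then obtain m where m: "m \<in> F" "\<forall>m'\<in>F. (m', m) \<in> \<sigma>" by auto
  show ?case
  proof (cases "(x, m) \<in> \<sigma>")
    case True
    with m show ?thesis by blast
  next
    case False
    then have "(m, x) \<in> \<sigma>"
      using le_total[of x m] m insert by blast
    then have "\<forall>m'\<in>insert x F. (m', x) \<in> \<sigma>"
      using m le_refl[of x] insert.prems le_trans by blast
    then show ?thesis by blast
  qed
qed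

abbreviation "lm \<equiv> leading_monomial \<sigma>"

lemma lm_eqI: "m \<in> keys p \<Longrightarrow> (\<And>m'. m' \<in> keys p \<Longrightarrow> (m', m) \<in> \<sigma>) \<Longrightarrow> lm p = m"
  unfolding leading_monomial_def by (rule the_equality) (auto intro: le_antisym)

lemma lm:
  assumes "p \<noteq> 0" "p \<in> pols box"
  shows "lm p \<in> keys p" "m \<in> keys p \<Longrightarrow> (m, lm p) \<in> \<sigma>"
proof -
  have "keys p \<subseteq> monomials n"
    using assms(2) unfolding pols_def monomials_def by auto
  then obtain m' where "m' \<in> keys p" "\<forall>m''\<in>keys p. (m'', m') \<in> \<sigma>"
    using finite_max[of "keys p"] assms(1) by auto
  moreover from this have "lm p = m'"
    by (intro lm_eqI) auto
  ultimately show "lm p \<in> keys p" "m \<in> keys p \<Longrightarrow> (m, lm p) \<in> \<sigma>"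
    by auto
qed

lemma lm_monomials: "p \<noteq> 0 \<Longrightarrow> p \<in> pols box \<Longrightarrow> lm p \<in> monomials n"
  using lm by (auto simp: pols_def monomials_iff)

text \<open>Diagonality enters through 2-minors. Multiplied by the remaining entries, this one
  exchange also compares the monomials of larger minors.\<close>

lemma swap_le:
  assumes "i < i'" "j < j'" "{i, i'} \<times> {j, j'} \<subseteq> box"
  shows "(mon {(i, j'), (i', j)}, mon {(i, j), (i', j')}) \<in> \<sigma>"
proof -
  define A where "A = {i - 1, i' - 1}"
  define B where "B = {j - 1, j' - 1}"
  have gt: "i > 0" "j > 0" and lt: "i - 1 < i' - 1" "j - 1 < j' - 1"
    using assms by auto
  have AB: "A \<subseteq> {..<n}" "B \<subseteq> {..<n}" "card A = 2" "card B = 2" "Suc ` A = {i, i'}" "Suc ` B = {j, j'}"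
    using assms gt lt by (auto simp: A_def B_def)
  note p1 = pick_pair[OF lt(1), unfolded One_nat_def] and p2 = pick_pair[OF lt(2), unfolded One_nat_def]
  let ?p = "mn var {i, i'} {j, j'} :: mpoly"
  have keys: "keys ?p = mon ` matchings {i, i'} {j, j'}"
    using keys_mn_zvar[of "{i, i'}" "{j, j'}" "{}"] assms by (simp add: zvar_empty)
  have "det (submatrix (generic_mat n) A B) = ?p"
    unfolding generic_mat_var using AB by (subst det_submatrix_mat) auto
  then have "leading_term \<sigma> ?p = prod_list (diag_mat (submatrix (generic_mat n) A B))"
    using diag AB unfolding diagonal_term_order_def by metis
  also have "submatrix (generic_mat n) A B = mat 2 2 (\<lambda>(a, b). var (Suc (pick A a), Suc (pick B b)))"
    unfolding generic_mat_var submatrix_mat[OF AB(1,2)] AB(3,4) by (rule eq_matI) auto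
  also have "prod_list (diag_mat \<dots>) = var (i, j) * var (i', j')"
    using gt assms by (simp add: diag_mat_def A_def B_def p1 p2 upt_rec numeral_2_eq_2 del: pick.simps)
  also have "\<dots> = Poly_Mapping.single (mon {(i, j), (i', j')}) 1"
    using assms by (subst prod_var[symmetric]) simp
  finally have "lm ?p = mon {(i, j), (i', j')}"
    unfolding leading_term_def by (metis (no_types, lifting) keys_single singleton_iff zero_neq_one insertI1 single_zero keys_zero empty_iff)
  moreover have "{(i, j'), (i', j)} \<in> matchings {i, i'} {j, j'}"
    using assms by (auto simp: matchings_def bij_betw_def)
  moreover have "?p \<in> pols box"
    by (rule mn_in_pols) (use assms in auto)
  moreover from calculation have "mon {(i, j'), (i', j)} \<in> keys ?p" "?p \<noteq> 0"
    using keys by auto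
  ultimately show ?thesis
    using lm(2)[of ?p "mon {(i, j'), (i', j)}"] by auto
qed

end

subsection \<open>Dot sets\<close>

text \<open>A partial permutation is treated as its set of dots \<open>(i, w i)\<close>, so that dots can be deleted
  without renumbering the remaining rows and columns.\<close>

definition rk :: "cell set \<Rightarrow> nat \<Rightarrow> nat \<Rightarrow> nat" where
  "rk D i j = card {x \<in> D. fst x \<le> i \<and> snd x \<le> j}"

definition pperm :: "nat \<Rightarrow> cell set \<Rightarrow> bool" where
  "pperm n D \<longleftrightarrow> D \<subseteq> {1..n} \<times> {1..n} \<and> inj_on fst D \<and> inj_on snd D"

abbreviation cells :: "cell set \<Rightarrow> cell set" where
  "cells D \<equiv> fst ` D \<times> snd ` D"

definition gens :: "cell set \<Rightarrow> mpoly set" where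
  "gens D = {mn var A B | A B i j. A \<subseteq> fst ` D \<inter> {..i} \<and> B \<subseteq> snd ` D \<inter> {..j} \<and>
     card A = Suc (rk D i j) \<and> card B = Suc (rk D i j)}"

text \<open>The support of the leading monomial of a minor with zeros at the cells of rank 0 is a chain:
  exchanging two entries in NE-SW position gives a larger monomial unless this hits a zero.\<close>

definition chain :: "cell set \<Rightarrow> cell set \<Rightarrow> bool" where
  "chain D C \<longleftrightarrow> inj_on fst C \<and> inj_on snd C \<and>
     (\<forall>x\<in>C. \<forall>y\<in>C. fst x < fst y \<longrightarrow> snd y < snd x \<longrightarrow> rk D (fst x) (snd y) = 0)"

text \<open>Every box counts, not only those at essential cells, so every CDG generator is covered.
  A single cell of rank 0 is already bad, which accounts for the variables of the dominant
  part.\<close>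

definition bad :: "cell set \<Rightarrow> cell set \<Rightarrow> bool" where
  "bad D U \<longleftrightarrow> (\<exists>C i j. C \<subseteq> U \<and> finite C \<and> C \<subseteq> {..i} \<times> {..j} \<and> chain D C \<and> rk D i j < card C)"

lemma pperm_finite: "pperm n D \<Longrightarrow> finite D"
  unfolding pperm_def using finite_subset by blast

lemma pperm_subset: "pperm n D \<Longrightarrow> E \<subseteq> D \<Longrightarrow> pperm n E"
  unfolding pperm_def using inj_on_subset by blast

lemma rk_mono: "finite D \<Longrightarrow> i \<le> i' \<Longrightarrow> j \<le> j' \<Longrightarrow> rk D i j \<le> rk D i' j'"
  unfolding rk_def by (rule card_mono) auto

lemma rk_pos_iff: "finite D \<Longrightarrow> rk D i j > 0 \<longleftrightarrow> (\<exists>x\<in>D. fst x \<le> i \<and> snd x \<le> j)"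
  by (auto simp: rk_def card_gt_0_iff Bex_def)

lemma cells_subset: "pperm n D \<Longrightarrow> cells D \<subseteq> {1..n} \<times> {1..n}"
  unfolding pperm_def by fastforce

context diag_order
begin

definition good :: "cell set \<Rightarrow> bool" where
  "good D \<longleftrightarrow> (\<exists>f. f \<in> idl (gens D) \<and> f \<noteq> 0 \<and> f \<in> pols (cells D) \<and> \<not> bad D (keys (lm f)))"

text \<open>The comparison is \<open>swap_le\<close> multiplied by the monomial of the untouched
  cells \<open>R\<close>.\<close>

lemma matchings_swap:
  assumes C: "C \<in> matchings A B" and xy: "(a, b) \<in> C" "(a', b') \<in> C" "a < a'" "b' < b"
    and A: "A \<subseteq> {1..n}" "B \<subseteq> {1..n}"
  defines "C' \<equiv> insert (a, b') (insert (a', b) (C - {(a, b), (a', b')}))"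
  shows "C' \<in> matchings A B" "(mon C, mon C') \<in> \<sigma>" "mon C \<noteq> mon C'"
proof -
  have fin: "finite A" "finite B" using A finite_subset by blast+
  have CAB: "C \<subseteq> A \<times> B" and finC: "finite C"
    using matchings_subset[OF C] matchings_finite[OF fin(1) C] by auto
  have inj: "inj_on fst C" "inj_on snd C" and im: "fst ` C = A" "snd ` C = B"
    using C by (auto simp: matchings_def bij_betw_def)
  have uniq: "\<And>c. (a, c) \<in> C \<Longrightarrow> c = b" "\<And>c. (a', c) \<in> C \<Longrightarrow> c = b'"
    "\<And>c. (c, b) \<in> C \<Longrightarrow> c = a" "\<And>c. (c, b') \<in> C \<Longrightarrow> c = a'"
    using inj xy unfolding inj_on_def by fastforce+
  define R where "R = C - {(a, b), (a', b')}"
  have R: "R \<subseteq> C" "(a, b') \<notin> C" "(a', b) \<notin> C" "finite R"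
    using uniq(1)[of b'] uniq(2)[of b] xy finC by (auto simp: R_def)
  have C_eq: "C = {(a, b), (a', b')} \<union> R" "C' = {(a, b'), (a', b)} \<union> R"
    using xy by (auto simp: R_def C'_def)
  have im': "fst ` C' = fst ` C" "snd ` C' = snd ` C"
    unfolding C_eq by auto
  \<comment> \<open>Injectivity of the projections by counting: \<open>C'\<close> has as many cells
    as \<open>C\<close> and the same rows and columns.\<close>
  have "card C' = card {(a, b'), (a', b)} + card R" "card C = card {(a, b), (a', b')} + card R"
    unfolding C_eq using R by (subst card_Un_disjoint; auto simp: R_def)+
  then have "card C' = card C" using xy by simp
  then have "card (fst ` C') = card C'" "card (snd ` C') = card C'"
    unfolding im' card_image[OF inj(1)] card_image[OF inj(2)] by simp_all
  moreover have finC': "finite C'"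
    using finC by (simp add: C'_def)
  ultimately have "inj_on fst C'" "inj_on snd C'"
    by (simp_all add: eq_card_imp_inj_on)
  with im' show "C' \<in> matchings A B"
    using im by (simp add: matchings_def bij_betw_def)
  have mon: "mon C = mon {(a, b), (a', b')} + mon R" "mon C' = mon {(a, b'), (a', b)} + mon R"
    unfolding C_eq using R by (subst mon_Un; auto simp: R_def)+
  have box: "C \<subseteq> box" "{a, a'} \<times> {b', b} \<subseteq> box"
    using CAB A xy by blast+
  then have "R \<subseteq> box" using R by blast
  then show "(mon C, mon C') \<in> \<sigma>"
    unfolding mon by (intro le_add swap_le xy) (use box R in \<open>auto simp: monomials_iff\<close>)
  show "mon C \<noteq> mon C'"
  proof
    assume "mon C = mon C'"
    then have "C = C'" by (rule mon_inj[OF finC finC'])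
    moreover have "(a, b') \<in> C'" by (simp add: C'_def)
    ultimately show False using R(2) by simp
  qed
qed

text \<open>\<open>N\<close> will be the dominant part for the CDG generators, and empty for minors
  in a region without cells of rank 0.\<close>

lemma lm_minor_chain:
  assumes "finite D" "A \<subseteq> {1..n}" "B \<subseteq> {1..n}" "card A = card B" "mn (zvar N) A B \<noteq> 0"
    and N: "\<And>a b. a \<in> A \<Longrightarrow> b \<in> B \<Longrightarrow> (a, b) \<in> N \<longleftrightarrow> rk D a b = 0"
  obtains C where "C \<in> matchings A B" "lm (mn (zvar N) A B) = mon C" "chain D C" "C \<inter> N = {}"
proof -
  let ?p = "mn (zvar N) A B"
  have fin: "finite A" "finite B" using assms finite_subset by blast+
  note keys = keys_mn_zvar[OF fin assms(4), of N]
  have p: "?p \<in> pols box"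
    by (rule mn_in_pols) (use fin assms in \<open>auto simp: zvar_def\<close>)
  obtain C where C: "C \<in> matchings A B" "C \<inter> N = {}" "lm ?p = mon C"
    using lm(1)[OF assms(5) p] keys by auto
  have "chain D C"
    unfolding chain_def
  proof (intro conjI ballI impI)
    show "inj_on fst C" "inj_on snd C"
      using C by (auto simp: matchings_def bij_betw_def)
    fix x y assume xy: "x \<in> C" "y \<in> C" "fst x < fst y" "snd y < snd x"
    obtain a b a' b' where [simp]: "x = (a, b)" "y = (a', b')" by (cases x, cases y)
    have AB: "a \<in> A" "a' \<in> A" "b \<in> B" "b' \<in> B"
      using xy matchings_subset[OF C(1)] by auto
    show "rk D (fst x) (snd y) = 0"
    proof (rule ccontr)
      assume nz: "rk D (fst x) (snd y) \<noteq> 0"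
      \<comment> \<open>The cell \<open>(a', b)\<close> lies south-east of \<open>(a, b')\<close>,
        so positive rank at the latter gives positive rank at both new cells, and the exchange stays
        off \<open>N\<close>.\<close>
      then have "rk D a' b \<noteq> 0"
        using rk_mono[OF assms(1), of a a' b' b] xy by simp
      define C' where "C' = insert (a, b') (insert (a', b) (C - {(a, b), (a', b')}))"
      note sw = matchings_swap[OF C(1), of a b a' b', folded C'_def]
      have "C' \<inter> N = {}"
        using C(2) nz \<open>rk D a' b \<noteq> 0\<close> AB N by (auto simp: C'_def)
      then have "mon C' \<in> keys ?p"
        using sw(1) xy assms(2,3) by (auto simp: keys)
      then have "(mon C', mon C) \<in> \<sigma>"
        using lm(2)[OF assms(5) p] C(3) by auto
      then show False
        using sw(2,3) xy assms(2,3) le_antisym by auto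
    qed
  qed
  with C that show ?thesis by blast
qed

end

subsection \<open>Good dot sets refute the Groebner property\<close>

lemma mn_cong: "(\<And>x. x \<in> A \<times> B \<Longrightarrow> s x = t x) \<Longrightarrow> card A = card B \<Longrightarrow> mn s A B = mn t A B"
  unfolding mn_def by (rule dm_cong) (simp add: pick_in_set_le)

lemma mn_single: "mn s {k} {l} = s (k, l)"
proof -
  have "pick {m} 0 = m" for m :: nat
    using pick_in_set_le[of 0 "{m}"] by (simp del: pick.simps)
  then show ?thesis
    by (simp add: mn_def dm_def det_single del: pick.simps)
qed

lemma idealI_poly_ring:
  assumes "J \<subseteq> carrier (poly_ring n)" "0 \<in> J"
    and "\<And>p q. p \<in> J \<Longrightarrow> q \<in> J \<Longrightarrow> p + q \<in> J"
    and "\<And>p q. p \<in> J \<Longrightarrow> q \<in> carrier (poly_ring n) \<Longrightarrow> q * p \<in> J"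
  shows "ideal J (poly_ring n)"
proof -
  interpret cring "poly_ring n" by (rule cring_poly_ring)
  show ?thesis
  proof (rule idealI)
    show "ring (poly_ring n)" by unfold_locales
    show "subgroup J (add_monoid (poly_ring n))"
    proof (rule add.subgroupI)
      fix p assume p: "p \<in> J"
      have c: "- p \<in> carrier (poly_ring n)" "p \<in> carrier (poly_ring n)" "- 1 \<in> carrier (poly_ring n)"
        using p assms(1) by (auto simp: carrier_poly_ring intro: pols_uminus)
      have "\<ominus>\<^bsub>poly_ring n\<^esub> p = - p"
        by (rule minus_equality[OF _ c(2,1)]) (simp add: poly_ring_def)
      then show "\<ominus>\<^bsub>poly_ring n\<^esub> p \<in> J"
        using assms(4)[OF p c(3)] by simp
    qed (use assms in \<open>auto simp: poly_ring_def\<close>)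
  qed (use assms(4) in \<open>auto simp: poly_ring_def mult.commute\<close>)
qed

text \<open>The polynomials whose monomials are all multiples of monomials occurring in
  \<open>S\<close> form an ideal that contains \<open>S\<close>. For a set of leading terms this is
  the usual divisibility test.\<close>

lemma keys_Idl:
  assumes S: "S \<subseteq> carrier (poly_ring n)" and p: "p \<in> Idl\<^bsub>poly_ring n\<^esub> S" and m: "m \<in> keys p"
  shows "\<exists>s\<in>S. \<exists>m'\<in>keys s. \<exists>k. m = m' + k"
proof -
  interpret cring "poly_ring n" by (rule cring_poly_ring)
  define P where "P m \<longleftrightarrow> (\<exists>s\<in>S. \<exists>m'\<in>keys s. \<exists>k. m = m' + k)" for m
  define J where "J = {p \<in> carrier (poly_ring n). \<forall>m\<in>keys p. P m}"
  have P: "P (k + m)" if "P m" for k m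
    using that unfolding P_def by (metis add.assoc add.commute)
  have "ideal J (poly_ring n)"
  proof (rule idealI_poly_ring)
    show "p + q \<in> J" if "p \<in> J" "q \<in> J" for p q
      using that keys_add[of p q] by (auto simp: J_def carrier_poly_ring intro: pols_add)
    show "q * p \<in> J" if "p \<in> J" "q \<in> carrier (poly_ring n)" for p q
      using that keys_mult[of q p] by (fastforce simp: J_def carrier_poly_ring intro: pols_mult P)
  qed (auto simp: J_def carrier_poly_ring)
  moreover have "P m" if "s \<in> S" "m \<in> keys s" for s m
    using that unfolding P_def by (metis add_0_right)
  then have "S \<subseteq> J"
    using S by (auto simp: J_def)
  ultimately have "Idl\<^bsub>poly_ring n\<^esub> S \<subseteq> J"
    by (rule genideal_minimal)
  then show ?thesis
    using p m by (auto simp: J_def P_def)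
qed

lemma bad_mono: "bad D U \<Longrightarrow> U \<subseteq> W \<Longrightarrow> bad D W"
  unfolding bad_def by (meson subset_trans)

definition graph :: "nat \<Rightarrow> (nat \<Rightarrow> nat) \<Rightarrow> cell set" where
  "graph n w = (\<lambda>i. (i, w i)) ` {1..n}"

lemma pperm_graph:
  assumes "w permutes {1..n}"
  shows "pperm n (graph n w)"
proof -
  have "graph n w \<subseteq> {1..n} \<times> {1..n}"
    using permutes_in_image[OF assms] unfolding graph_def by blast
  moreover have "inj_on snd (graph n w)"
    using inj_eq[OF permutes_inj[OF assms]] by (auto simp: graph_def inj_on_def)
  moreover have "inj_on fst (graph n w)"
    by (auto simp: graph_def inj_on_def)
  ultimately show ?thesis
    by (simp add: pperm_def)
qed

lemma rk_graph:
  assumes "i \<le> n"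
  shows "rk (graph n w) i j = rank_fun w i j"
proof -
  have "{x \<in> graph n w. fst x \<le> i \<and> snd x \<le> j} = (\<lambda>i. (i, w i)) ` {k \<in> {1..i}. w k \<le> j}"
    using assms by (auto simp: graph_def)
  then show ?thesis
    by (simp add: rk_def rank_fun_def card_image inj_on_def)
qed

text \<open>At rank 0 every \<open>w k\<close> with \<open>k \<le> i\<close> exceeds
  \<open>j\<close>; this yields both inequalities of the Rothe diagram.\<close>

lemma dominant_part_iff:
  assumes "w permutes {1..n}"
  shows "(i, j) \<in> dominant_part n w \<longleftrightarrow> i \<in> {1..n} \<and> j \<in> {1..n} \<and> rk (graph n w) i j = 0"
proof -
  have "w i > j \<and> inv_into UNIV w j > i" if ij: "i \<in> {1..n}" "j \<in> {1..n}" and "rk (graph n w) i j = 0"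
  proof -
    have "rk (graph n w) i j = 0 \<longleftrightarrow> \<not> (\<exists>x\<in>graph n w. fst x \<le> i \<and> snd x \<le> j)"
      using rk_pos_iff[OF pperm_finite[OF pperm_graph[OF assms]], of i j] by auto
    with that have none: "w k > j" if "k \<in> {1..n}" "k \<le> i" for k
    proof -
      have "(k, w k) \<in> graph n w" using \<open>k \<in> {1..n}\<close> by (simp add: graph_def)
      then show ?thesis
        using \<open>rk (graph n w) i j = 0 \<longleftrightarrow> _\<close> \<open>rk (graph n w) i j = 0\<close> \<open>k \<le> i\<close> by fastforce
    qed
    have "inv_into UNIV w j \<in> {1..n}" "w (inv_into UNIV w j) = j"
      using ij permutes_inverses[OF assms] permutes_in_image[OF permutes_inv[OF assms]] by auto
    then show ?thesis
      using none[of i] none[of "inv_into UNIV w j"] ij by (auto simp: not_le[symmetric])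
  qed
  then show ?thesis
    by (auto simp: dominant_part_def rothe_diagram_def rk_graph)
qed

lemma mem_minors_northwest:
  assumes "M = mat n n (\<lambda>(a, b). s (Suc a, Suc b))" "i \<le> n" "j \<le> n"
  shows "g \<in> minors k (northwest M i j) \<longleftrightarrow>
    (\<exists>A B. g = mn s A B \<and> A \<subseteq> {1..i} \<and> B \<subseteq> {1..j} \<and> card A = k \<and> card B = k)"
proof
  have nw: "northwest M i j = mat i j (\<lambda>(a, b). s (Suc a, Suc b))"
    unfolding assms(1) by (rule northwest_mat) (use assms in auto)
  show "\<exists>A B. g = mn s A B \<and> A \<subseteq> {1..i} \<and> B \<subseteq> {1..j} \<and> card A = k \<and> card B = k"
    if g: "g \<in> minors k (northwest M i j)"
  proof -
    obtain A B where "g = det (submatrix (mat i j (\<lambda>(a, b). s (Suc a, Suc b))) A B)" "A \<subseteq> {..<i}" "B \<subseteq> {..<j}"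
      "card A = k" "card B = k"
      using g unfolding minors_def nw by auto
    then have "g = mn s (Suc ` A) (Suc ` B)" "Suc ` A \<subseteq> {1..i}" "Suc ` B \<subseteq> {1..j}" "card (Suc ` A) = k" "card (Suc ` B) = k"
      by (auto simp: det_submatrix_mat card_image)
    then show ?thesis by blast
  qed
  assume "\<exists>A B. g = mn s A B \<and> A \<subseteq> {1..i} \<and> B \<subseteq> {1..j} \<and> card A = k \<and> card B = k"
  then obtain A B where AB: "g = mn s A B" "A \<subseteq> {1..i}" "B \<subseteq> {1..j}" "card A = k" "card B = k"
    by blast
  define A' B' where "A' = (\<lambda>x. x - 1) ` A" and "B' = (\<lambda>x. x - 1) ` B"
  have eq: "A = Suc ` A'" "B = Suc ` B'"
    using AB(2,3) by (force simp: A'_def B'_def image_iff)+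
  have sub: "A' \<subseteq> {..<i}" "B' \<subseteq> {..<j}"
    using AB(2,3) by (fastforce simp: A'_def B'_def)+
  have card: "card A' = k" "card B' = k"
    using AB(4,5) unfolding eq by (simp_all add: card_image)
  have "g = det (submatrix (northwest M i j) A' B')"
    unfolding AB(1) eq nw by (rule det_submatrix_mat[symmetric]) (use sub card in auto)
  then show "g \<in> minors k (northwest M i j)"
    unfolding minors_def nw using sub card by auto
qed

context diag_order
begin

theorem good_not_groebner:
  assumes w: "w permutes {1..n}"
    and gb: "groebner_basis n \<sigma> (CDG_generators n w) (schubert_ideal n w)"
    and good: "good (graph n w)"
  shows False
proof -
  interpret cring "poly_ring n" by (rule cring_poly_ring)
  define D where "D = graph n w"
  have D: "pperm n D" "finite D"
    using pperm_graph[OF w] pperm_finite by (auto simp: D_def)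
  obtain f where f: "f \<in> idl (gens D)" "f \<noteq> 0" "f \<in> pols (cells D)" "\<not> bad D (keys (lm f))"
    using good unfolding good_def D_def by blast
  have fbox: "f \<in> pols box"
    using f(3) pols_mono[OF cells_subset[OF D(1)]] by blast
  let ?G = "\<Union>(i, j)\<in>{1..n} \<times> {1..n}. minors (rank_fun w i j + 1) (northwest (generic_mat n) i j)"
  have Gpols: "?G \<subseteq> pols box"
  proof clarify
    fix g i j assume "i \<in> {1..n}" "j \<in> {1..n}" "g \<in> minors (rank_fun w i j + 1) (northwest (generic_mat n) i j)"
    then obtain A B where "g = mn var A B" "A \<subseteq> {1..i}" "B \<subseteq> {1..j}" "card A = card B"
      using mem_minors_northwest[OF generic_mat_var[of n], of i j] by auto
    moreover from this have "finite A" "finite B" using finite_subset by blast+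
    moreover from calculation have "A \<times> B \<subseteq> box"
      using \<open>i \<in> {1..n}\<close> \<open>j \<in> {1..n}\<close> by fastforce
    ultimately show "g \<in> pols box"
      using mn_in_pols[of A B var box] pols_var by blast
  qed
  have "gens D \<subseteq> ?G"
  proof
    fix g assume "g \<in> gens D"
    then obtain A B i j where g: "g = mn var A B" "A \<subseteq> fst ` D \<inter> {..i}" "B \<subseteq> snd ` D \<inter> {..j}"
      "card A = Suc (rk D i j)" "card B = Suc (rk D i j)"
      unfolding gens_def by blast
    \<comment> \<open>The boxes in \<open>gens\<close> are not bounded by \<open>n\<close>, so the
      box is cut off. Its rank stays the same because all dots lie in the \<open>n\<close> by
      \<open>n\<close> square.\<close>
    define i' j' where "i' = min i n" and "j' = min j n"
    have sub: "A \<subseteq> {1..i'}" "B \<subseteq> {1..j'}"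
      using g(2,3) D(1) by (fastforce simp: i'_def j'_def pperm_def)+
    have "A \<noteq> {}" "B \<noteq> {}" using g(4,5) by auto
    then have ij: "i' \<in> {1..n}" "j' \<in> {1..n}"
      using sub by (auto simp: i'_def j'_def)
    have "{x \<in> D. fst x \<le> i \<and> snd x \<le> j} = {x \<in> D. fst x \<le> i' \<and> snd x \<le> j'}"
      using D(1) by (auto simp: i'_def j'_def pperm_def)
    then have "rk D i j = rank_fun w i' j'"
      using rk_graph[of i' n w j'] ij by (simp add: rk_def D_def)
    then have "g \<in> minors (rank_fun w i' j' + 1) (northwest (generic_mat n) i' j')"
      using mem_minors_northwest[OF generic_mat_var[of n], of i' j'] ij g sub by auto
    then show "g \<in> ?G" using ij by blast
  qed
  then have "f \<in> idl ?G"
    using f(1) idl_subset idl_gen by blast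
  then have "f \<in> schubert_ideal n w"
    unfolding schubert_ideal_def by (rule idl_le_Idl[OF _ fbox Gpols])
  moreover have lt_carrier: "leading_term \<sigma> p \<in> carrier (poly_ring n)" if "p \<noteq> 0" "p \<in> pols box" for p
    using lm_monomials[OF that] by (auto simp: leading_term_def carrier_poly_ring monomials_iff intro: pols_single)
  have Gcar: "CDG_generators n w \<subseteq> pols box"
    using gb by (simp add: groebner_basis_def carrier_poly_ring)
  have "leading_term \<sigma> f \<in> Idl\<^bsub>poly_ring n\<^esub> (leading_term \<sigma> ` (schubert_ideal n w - {0}))"
  proof -
    have "schubert_ideal n w \<subseteq> pols box"
      unfolding schubert_ideal_def using ideal.Icarr[OF genideal_ideal, of ?G] Gpols
      by (auto simp: carrier_poly_ring)
    then have "leading_term \<sigma> ` (schubert_ideal n w - {0}) \<subseteq> carrier (poly_ring n)"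
      using lt_carrier by auto
    then show ?thesis
      using genideal_self calculation f(2) by blast
  qed
  then have "leading_term \<sigma> f \<in> Idl\<^bsub>poly_ring n\<^esub> (leading_term \<sigma> ` (CDG_generators n w - {0}))"
    using gb[unfolded groebner_basis_def, THEN conjunct2, THEN conjunct2] by simp
  moreover have "leading_term \<sigma> ` (CDG_generators n w - {0}) \<subseteq> carrier (poly_ring n)"
    using lt_carrier Gcar by auto
  moreover have "lm f \<in> keys (leading_term \<sigma> f)"
    using lm(1)[OF f(2) fbox] by (simp add: leading_term_def in_keys_iff lookup_single)
  \<comment> \<open>By the Groebner property the leading monomial of some CDG generator divides that
    of \<open>f\<close>.\<close>
  ultimately obtain s m k where s: "s \<in> leading_term \<sigma> ` (CDG_generators n w - {0})" "m \<in> keys s" "lm f = m + k"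
    using keys_Idl[of "leading_term \<sigma> ` (CDG_generators n w - {0})"] by metis
  then obtain g where g: "g \<in> CDG_generators n w" "g \<noteq> 0" "m \<in> keys (leading_term \<sigma> g)"
    by auto
  then have "m = lm g"
    by (auto simp: leading_term_def split: if_splits)
  then have sub: "keys (lm g) \<subseteq> keys (lm f)"
    using s(3) by (auto simp: in_keys_iff lookup_add)
  \<comment> \<open>The contradiction to the choice of \<open>f\<close>: the leading monomial of
    every nonzero CDG generator has a bad support.\<close>
  have "bad D (keys (lm g))"
    using g(1) unfolding CDG_generators_def
  proof (elim UnE)
    assume "g \<in> {indet i j | i j. (i, j) \<in> dominant_part n w}"
    then obtain i j where ij: "g = var (i, j)" "(i, j) \<in> dominant_part n w"
      by (auto simp: indet_var)
    have "lm g = Poly_Mapping.single (i, j) 1"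
      by (rule lm_eqI) (use ij(2) in \<open>auto simp: ij(1) var_def monomials_iff dominant_part_iff[OF w] intro!: le_refl\<close>)
    then have "(i, j) \<in> keys (lm g)" by simp
    moreover have "rk D i j = 0"
      using ij(2) by (simp add: dominant_part_iff[OF w] D_def)
    ultimately show ?thesis
      unfolding bad_def by (intro exI[of _ "{(i, j)}"] exI[of _ i] exI[of _ j]) (auto simp: chain_def)
  next
    assume "g \<in> (\<Union>(i, j)\<in>essential_set n w - dominant_part n w.
        minors (rank_fun w i j + 1) (northwest (generic_mat_dom n w) i j))"
    then obtain i j where ij: "(i, j) \<in> essential_set n w" "g \<in> minors (rank_fun w i j + 1) (northwest (generic_mat_dom n w) i j)"
      by blast
    then have ijn: "i \<in> {1..n}" "j \<in> {1..n}"
      by (auto simp: essential_set_def rothe_diagram_def)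
    then obtain A B where AB: "g = mn (zvar (dominant_part n w)) A B" "A \<subseteq> {1..i}" "B \<subseteq> {1..j}"
      "card A = rank_fun w i j + 1" "card B = rank_fun w i j + 1"
      using ij(2) mem_minors_northwest[OF generic_mat_dom_zvar[of n w], of i j] by auto
    have n: "A \<subseteq> {1..n}" "B \<subseteq> {1..n}"
      using AB(2,3) ijn by auto
    then have fin: "finite A" "finite B" using finite_subset by blast+
    obtain C where C: "C \<in> matchings A B" "lm g = mon C" "chain D C"
    proof (rule lm_minor_chain[OF D(2) n, of "dominant_part n w"])
      show "mn (zvar (dominant_part n w)) A B \<noteq> 0" using g(2) AB(1) by simp
      show "(a, b) \<in> dominant_part n w \<longleftrightarrow> rk D a b = 0" if "a \<in> A" "b \<in> B" for a b
        using that n by (auto simp: dominant_part_iff[OF w] D_def)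
    qed (use AB in auto)
    have "keys (lm g) = C"
      using C matchings_finite[OF fin(1)] by simp
    moreover have "rk D i j < card C"
      using matchings_card[OF C(1)] AB ijn rk_graph[of i n w j] by (simp add: D_def)
    moreover have "C \<subseteq> {..i} \<times> {..j}"
      using matchings_subset[OF C(1)] AB(2,3) by auto
    ultimately show ?thesis
      unfolding bad_def using C(3) matchings_finite[OF fin(1) C(1)] by blast
  qed
  with f(4) show False
    using bad_mono[OF _ sub] by blast
qed

end

subsection \<open>Homogeneous components\<close>

text \<open>Degrees matter because the Schur substitution turns a leading monomial \<open>m\<close>
  into \<open>m\<close> times the pivot to the power \<open>mdeg m\<close>. Only among monomials of
  equal degree is their order sure to be kept.\<close>

definition mdeg :: "monomial \<Rightarrow> nat" where
  "mdeg m = (\<Sum>c\<in>keys m. lookup m c)"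

lemma mdeg_superset: "finite K \<Longrightarrow> keys m \<subseteq> K \<Longrightarrow> mdeg m = (\<Sum>c\<in>K. lookup m c)"
  unfolding mdeg_def by (rule sum.mono_neutral_left) (auto simp: in_keys_iff)

lemma mdeg_add: "mdeg (a + b) = mdeg a + mdeg b"
proof -
  define K where "K = keys a \<union> keys b"
  have "finite K" "keys a \<subseteq> K" "keys b \<subseteq> K" "keys (a + b) \<subseteq> K"
    using keys_add[of a b] by (auto simp: K_def)
  then show ?thesis
    by (simp add: mdeg_superset[of K] lookup_add sum.distrib)
qed

lemma mdeg_single [simp]: "mdeg (Poly_Mapping.single c k) = k"
  by (simp add: mdeg_def)

lemma mdeg_mon: "finite C \<Longrightarrow> mdeg (mon C) = card C"
  by (simp add: mdeg_def lookup_mon)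

definition hcomp :: "nat \<Rightarrow> mpoly \<Rightarrow> mpoly" where
  "hcomp d p = (\<Sum>m\<in>{m \<in> keys p. mdeg m = d}. Poly_Mapping.single m (lookup p m))"

lemma lookup_hcomp: "lookup (hcomp d p) m = (if mdeg m = d then lookup p m else 0)"
  by (auto simp: hcomp_def lookup_sum lookup_single when_def in_keys_iff)

lemma keys_hcomp: "keys (hcomp d p) = {m \<in> keys p. mdeg m = d}"
  by (auto simp: in_keys_iff lookup_hcomp split: if_splits)

lemma hcomp_add: "hcomp d (p + q) = hcomp d p + hcomp d q"
  by (rule poly_mapping_eqI) (simp add: lookup_hcomp lookup_add)

lemma hcomp_0 [simp]: "hcomp d 0 = 0"
  by (simp add: hcomp_def)

lemma hcomp_sum: "hcomp d (sum f A) = (\<Sum>a\<in>A. hcomp d (f a))"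
  by (induction A rule: infinite_finite_induct) (simp_all add: hcomp_add)

lemma hcomp_homogeneous:
  assumes "\<And>m. m \<in> keys p \<Longrightarrow> mdeg m = k"
  shows "hcomp d p = (if k = d then p else 0)"
  by (rule poly_mapping_eqI) (use assms in \<open>force simp: lookup_hcomp in_keys_iff\<close>)

text \<open>As the generators are homogeneous, splitting each coefficient into its monomials shows
  that a component of a combination is again a combination.\<close>

lemma hcomp_idl:
  assumes "f \<in> idl G" "\<And>g. g \<in> G \<Longrightarrow> \<exists>k. \<forall>m\<in>keys g. mdeg m = k"
  shows "hcomp d f \<in> idl G"
  using assms(1)
proof induction
  case (step f g c)
  obtain k where k: "\<forall>m\<in>keys g. mdeg m = k" using assms(2) step by blast
  have "c * g = (\<Sum>m\<in>keys c. Poly_Mapping.single m (lookup c m) * g)"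
    by (subst poly_expand[of c]) (simp add: sum_distrib_right)
  moreover have "hcomp d (Poly_Mapping.single m a * g) =
      (if mdeg m + k = d then Poly_Mapping.single m a * g else 0)" for m a
  proof (rule hcomp_homogeneous)
    fix m' assume "m' \<in> keys (Poly_Mapping.single m a * g)"
    then obtain m'' where "m' = m + m''" "m'' \<in> keys g"
      using keys_mult[of "Poly_Mapping.single m a" g] by (auto split: if_splits)
    then show "mdeg m' = mdeg m + k" using k by (simp add: mdeg_add)
  qed
  ultimately have "hcomp d (c * g) = (\<Sum>m\<in>keys c. if mdeg m + k = d then Poly_Mapping.single m (lookup c m) * g else 0)"
    by (simp add: hcomp_sum)
  moreover have "\<dots> \<in> idl G"
    by (rule idl_sum) (use step in \<open>auto intro: idl_mult idl_gen idl.zero\<close>)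
  ultimately show ?case
    using step by (simp add: hcomp_add idl_add)
qed (simp add: idl.zero)

lemma gens_homogeneous: "g \<in> gens D \<Longrightarrow> \<exists>k. \<forall>m\<in>keys g. mdeg m = k"
proof -
  assume "g \<in> gens D"
  then obtain A B i j where g: "g = mn var A B" "card A = Suc (rk D i j)" "card B = Suc (rk D i j)"
    unfolding gens_def by blast
  then have fin: "finite A" "finite B" using card.infinite by fastforce+
  have "mdeg m = card A" if "m \<in> keys g" for m
    using that keys_mn_zvar[OF fin, of "{}"] matchings_card[of _ A B] matchings_finite[OF fin(1), of _ B] g
    by (auto simp: zvar_empty mdeg_mon)
  then show ?thesis by blast
qed

subsection \<open>Deleting a left-to-right minimum\<close>

lemma rk_insert:
  assumes "finite D" "(a, b) \<in> D"
  shows "rk D i j = rk (D - {(a, b)}) i j + (if a \<le> i \<and> b \<le> j then 1 else 0)"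
proof -
  define S where "S = {x \<in> D - {(a, b)}. fst x \<le> i \<and> snd x \<le> j}"
  have "finite S" "(a, b) \<notin> S" using assms by (auto simp: S_def)
  have "{x \<in> D. fst x \<le> i \<and> snd x \<le> j} = (if a \<le> i \<and> b \<le> j then insert (a, b) S else S)"
    using assms by (auto simp: S_def)
  then show ?thesis
    using \<open>finite S\<close> \<open>(a, b) \<notin> S\<close> by (simp add: rk_def S_def)
qed

text \<open>Take \<open>(a, b)\<close> out of a bad chain of \<open>D\<close>. If it was there, the
  box contains this dot, so size and rank both drop by one; otherwise the rank can only drop. Cells
  of rank 0 keep rank 0.\<close>

lemma not_bad_insert:
  assumes "finite D" "(a, b) \<in> D" "\<not> bad (D - {(a, b)}) K"
  shows "\<not> bad D (insert (a, b) K)"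
proof
  let ?D = "D - {(a, b)}"
  assume "bad D (insert (a, b) K)"
  then obtain C i j where C: "C \<subseteq> insert (a, b) K" "finite C" "C \<subseteq> {..i} \<times> {..j}" "chain D C" "rk D i j < card C"
    unfolding bad_def by blast
  define C' where "C' = C - {(a, b)}"
  have rk0: "rk D k l = 0 \<Longrightarrow> rk ?D k l = 0" for k l
    using rk_insert[OF assms(1,2), of k l] by simp
  have "chain ?D C'"
    unfolding chain_def
  proof (intro conjI ballI impI)
    show "inj_on fst C'" "inj_on snd C'"
      using C(4) inj_on_diff unfolding chain_def C'_def by metis+
    show "rk ?D (fst x) (snd y) = 0" if "x \<in> C'" "y \<in> C'" "fst x < fst y" "snd y < snd x" for x y
      by (rule rk0) (use C(4) that in \<open>simp add: chain_def C'_def\<close>)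
  qed
  moreover have "rk ?D i j < card C'"
  proof (cases "(a, b) \<in> C")
    case True
    then have "a \<le> i \<and> b \<le> j" "card C = Suc (card C')"
      using C(3) card.remove[OF C(2) True] by (auto simp: C'_def)
    then show ?thesis using C(5) rk_insert[OF assms(1,2), of i j] by simp
  next
    case False
    then show ?thesis using C(5) rk_insert[OF assms(1,2), of i j] by (simp add: C'_def split: if_splits)
  qed
  moreover have "C' \<subseteq> K" "finite C'" "C' \<subseteq> {..i} \<times> {..j}"
    using C by (auto simp: C'_def)
  ultimately show False
    using assms(3) unfolding bad_def by blast
qed

lemma gensI:
  "A \<subseteq> fst ` D \<inter> {..i} \<Longrightarrow> B \<subseteq> snd ` D \<inter> {..j} \<Longrightarrow> card A = Suc (rk D i j) \<Longrightarrow>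
   card B = Suc (rk D i j) \<Longrightarrow> mn var A B \<in> gens D"
  unfolding gens_def by blast

lemma idl_prod_cong:
  assumes "\<And>x. x \<in> C \<Longrightarrow> s x - t x \<in> idl G"
  shows "(\<Prod>x\<in>C. s x) - (\<Prod>x\<in>C. t x) \<in> idl G"
  using assms
proof (induction C rule: infinite_finite_induct)
  case (insert x F)
  have "prod s (insert x F) - prod t (insert x F) = prod s F * (s x - t x) + t x * (prod s F - prod t F)"
    using insert by (simp add: algebra_simps)
  then show ?case
    using insert by (auto intro!: idl_add idl_mult)
qed (auto intro: idl.zero)

lemma idl_mn_cong:
  assumes "finite A" "finite B" "card A = card B" "\<And>x. x \<in> A \<times> B \<Longrightarrow> s x - t x \<in> idl G"
  shows "mn s A B - mn t A B \<in> idl G"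
  unfolding mn_expand[OF assms(1-3)] sum_subtractf[symmetric] right_diff_distrib[symmetric]
  by (intro idl_sum idl_mult idl_prod_cong assms(4)) (use matchings_subset in blast)

lemma mn_scale:
  assumes "finite A" "finite B" "card A = card B"
  shows "mn (\<lambda>x. c * s x) A B = c ^ card A * mn s A B"
  unfolding mn_expand[OF assms] sum_distrib_left
  by (rule sum.cong) (simp_all add: prod.distrib matchings_card mult.left_commute)

lemma var_in_gens:
  assumes "(k, l) \<in> cells D" "rk D k l = 0"
  shows "var (k, l) \<in> gens D"
proof -
  have "var (k, l) = mn var {k} {l} \<and> {k} \<subseteq> fst ` D \<inter> {..k} \<and> {l} \<subseteq> snd ` D \<inter> {..l} \<and>
     card {k} = Suc (rk D k l) \<and> card {l} = Suc (rk D k l)"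
    using assms by (simp add: mn_single)
  then show ?thesis unfolding gens_def by blast
qed

text \<open>Localized at the entry of a left-to-right minimum \<open>(a, b)\<close>, the ideal of \<open>D\<close> becomes that of
  \<open>D - {(a, b)}\<close> in the entries of the Schur complement. Only the entries to the south-east of
  \<open>(a, b)\<close> need be changed, because \<open>D\<close> has rank 0 above and to the left of \<open>(a, b)\<close>.\<close>

definition schur :: "cell \<Rightarrow> cell \<Rightarrow> mpoly" where
  "schur d x = (if fst d < fst x \<and> snd d < snd x
     then var d * var x - var (fst x, snd d) * var (fst d, snd x) else var d * var x)"

text \<open>A minor whose box does not contain \<open>(a, b)\<close> is merely scaled, and the rank
  of its box is unchanged. Otherwise the minor is bordered by row \<open>a\<close> and column
  \<open>b\<close>; the rank of the box rises by one as well, and \<open>chio\<close> applies. The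
  factor in front is the one that \<open>chio\<close> leaves beside the condensed
  determinant.\<close>

lemma schur_gens:
  assumes D: "pperm n D" and ab: "(a, b) \<in> D" and min: "\<And>x. x \<in> D \<Longrightarrow> \<not> (fst x < a \<and> snd x < b)"
    and g: "g \<in> gens (D - {(a, b)})"
  shows "var (a, b) * subst (schur (a, b)) g \<in> idl (gens D)"
proof -
  let ?D = "D - {(a, b)}" and ?z = "var (a, b)"
  have fD: "finite D" using D by (rule pperm_finite)
  have inj: "inj_on fst D" "inj_on snd D" using D by (auto simp: pperm_def)
  have rows: "fst ` ?D = fst ` D - {a}" "snd ` ?D = snd ` D - {b}"
    using inj_on_image_set_diff[OF inj(1), of D "{(a, b)}"] inj_on_image_set_diff[OF inj(2), of D "{(a, b)}"] ab
    by simp_all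
  obtain A B i j where AB: "g = mn var A B" "A \<subseteq> fst ` ?D \<inter> {..i}" "B \<subseteq> snd ` ?D \<inter> {..j}"
      "card A = Suc (rk ?D i j)" "card B = Suc (rk ?D i j)"
    using g unfolding gens_def by blast
  then have fin: "finite A" "finite B" using card.infinite by fastforce+
  have cAB: "card A = card B" using AB by simp
  have sub: "subst (schur (a, b)) g = mn (schur (a, b)) A B"
    using subst.ev_mn[OF fin cAB, of "schur (a, b)" var] by (simp add: AB(1))
  show ?thesis
  proof (cases "a \<le> i \<and> b \<le> j")
    case False
    have "subst (schur (a, b)) g = mn (\<lambda>x. ?z * var x) A B"
      unfolding sub by (rule mn_cong[OF _ cAB]) (use False AB(2,3) in \<open>auto simp: schur_def\<close>)
    then have "subst (schur (a, b)) g = ?z ^ card A * g"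
      by (simp add: mn_scale[OF fin cAB] AB(1))
    moreover have "rk D i j = rk ?D i j"
      using rk_insert[OF fD ab, of i j] False by auto
    moreover have "A \<subseteq> fst ` D \<inter> {..i}" "B \<subseteq> snd ` D \<inter> {..j}"
      using AB(2,3) by auto
    ultimately have "subst (schur (a, b)) g = ?z ^ card A * g" "g \<in> gens D"
      using gensI[of A D i B j] AB(1,4,5) by simp_all
    then show ?thesis by (simp add: idl_mult idl_gen)
  next
    case True
    \<comment> \<open>\<open>t\<close> is the full Schur complement. Where \<open>schur\<close>
      omits the subtracted product, one factor of this product is a variable at a cell of rank 0,
      hence itself a generator.\<close>
    define t where "t x = ?z * var x - var (fst x, b) * var (a, snd x)" for x
    define u where "u r = (case r of 0 \<Rightarrow> a | Suc r \<Rightarrow> pick A r)" for r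
    define v where "v r = (case r of 0 \<Rightarrow> b | Suc r \<Rightarrow> pick B r)" for r
    let ?k = "card A"
    have bij: "bij_betw (case_nat c (pick E)) {..<Suc (card E)} (insert c E)" if "finite E" "c \<notin> E" for c E
    proof -
      have "bij_betw (case_nat c (pick E) \<circ> Suc) {..<card E} E"
        using pick_bij[OF that(1)] by (simp add: comp_def)
      then have "bij_betw (case_nat c (pick E)) (Suc ` {..<card E}) E"
        by (subst bij_betw_comp_iff[of Suc "{..<card E}"]) (auto simp: bij_betw_def)
      then have "bij_betw (case_nat c (pick E)) (insert 0 (Suc ` {..<card E})) (insert c E)"
        using that by (intro bij_betw_combine[of _ "{0}" "{c}", simplified]) (auto simp: bij_betw_def)
      then show ?thesis
        by (simp add: lessThan_Suc_eq_insert_0)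
    qed
    have ne: "a \<notin> A" "b \<notin> B" using AB(2,3) rows by auto
    have "bij_betw u {..<Suc ?k} (insert a A)" "bij_betw v {..<Suc ?k} (insert b B)"
      using bij[OF fin(1) ne(1)] bij[OF fin(2) ne(2)] cAB by (simp_all add: u_def[abs_def] v_def[abs_def])
    then have "dm var u v (Suc ?k) = mn var (insert a A) (insert b B) \<or> dm var u v (Suc ?k) = - mn var (insert a A) (insert b B :: nat set)"
      by (rule dm_eq_mn)
    moreover have "mn var (insert a A) (insert b B) \<in> gens D"
    proof -
      have "insert a A \<subseteq> fst ` D \<inter> {..i}" "insert b B \<subseteq> snd ` D \<inter> {..j}"
        using AB(2,3) True imageI[OF ab, of fst] imageI[OF ab, of snd] by auto
      moreover have "card (insert a A) = Suc (rk D i j)" "card (insert b B) = Suc (rk D i j)"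
        using ne fin AB(4,5) rk_insert[OF fD ab, of i j] True by simp_all
      ultimately show ?thesis by (rule gensI)
    qed
    ultimately have dm: "dm var u v (Suc ?k) \<in> idl (gens D)"
      using idl_gen idl_uminus by metis
    have "?z ^ ?k * dm var u v (Suc ?k) = ?z * mn t A B"
      using chio[of var u v ?k] by (simp add: u_def v_def t_def mn_def dm_def case_prod_unfold)
    then have 1: "?z * mn t A B \<in> idl (gens D)"
      using idl_mult[OF dm] by metis
    have "schur (a, b) x - t x \<in> idl (gens D)" if x: "x \<in> A \<times> B" for x
    proof -
      obtain k l where x_eq: "x = (k, l)" by (cases x)
      have "k \<in> fst ` D - {a}" "l \<in> snd ` D - {b}"
        using x AB(2,3) unfolding rows x_eq by auto
      then have kl: "x = (k, l)" "k \<in> fst ` D" "l \<in> snd ` D" "k \<noteq> a" "l \<noteq> b"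
        using x_eq by simp_all
      consider "a < k \<and> b < l" | "k < a" | "l < b"
        using kl by linarith
      then show ?thesis
      proof cases
        case 1
        then show ?thesis by (simp add: kl schur_def t_def idl.zero)
      next
        case 2
        have "rk D k b = 0"
        proof (rule ccontr)
          assume "rk D k b \<noteq> 0"
          then obtain y where "y \<in> D" "fst y \<le> k" "snd y \<le> b"
            using rk_pos_iff[OF fD, of k b] by auto
          with 2 min[of y] have "snd y = b" by auto
          then have "y = (a, b)" using inj(2) \<open>y \<in> D\<close> ab by (auto simp: inj_on_def)
          with 2 \<open>fst y \<le> k\<close> show False by simp
        qed
        then have "var (k, b) \<in> idl (gens D)"
          using kl ab by (intro idl_gen var_in_gens) force+
        then show ?thesis
          using 2 idl_mult[of "var (k, b)" "gens D" "var (a, l)"] by (simp add: kl schur_def t_def mult.commute)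
      next
        case 3
        have "rk D a l = 0"
        proof (rule ccontr)
          assume "rk D a l \<noteq> 0"
          then obtain y where "y \<in> D" "fst y \<le> a" "snd y \<le> l"
            using rk_pos_iff[OF fD, of a l] by auto
          with 3 min[of y] have "fst y = a" by auto
          then have "y = (a, b)" using inj(1) \<open>y \<in> D\<close> ab by (auto simp: inj_on_def)
          with 3 \<open>snd y \<le> l\<close> show False by simp
        qed
        then have "var (a, l) \<in> idl (gens D)"
          using kl ab by (intro idl_gen var_in_gens) force+
        then show ?thesis
          using 3 idl_mult[of "var (a, l)" "gens D" "var (k, b)"] by (simp add: kl schur_def t_def)
      qed
    qed
    then have "?z * (mn (schur (a, b)) A B - mn t A B) \<in> idl (gens D)"
      by (intro idl_mult idl_mn_cong fin cAB)
    from idl_add[OF this 1] show ?thesis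
      by (simp add: sub algebra_simps)
  qed
qed

section \<open>Leading monomials under the Schur substitution\<close>

context diag_order
begin

definition below :: "monomial \<Rightarrow> mpoly set" where
  "below m = {p. \<forall>m'\<in>keys p. m' \<in> monomials n \<and> (m', m) \<in> \<sigma> \<and> m' \<noteq> m}"

lemma below_0: "0 \<in> below m"
  by (simp add: below_def)

lemma below_add: "p \<in> below m \<Longrightarrow> q \<in> below m \<Longrightarrow> p + q \<in> below m"
  unfolding below_def using keys_add[of p q] by blast

lemma below_sum: "(\<And>i. i \<in> I \<Longrightarrow> f i \<in> below m) \<Longrightarrow> sum f I \<in> below m"
  by (induction I rule: infinite_finite_induct) (auto intro: below_add below_0)

lemma below_mult:
  assumes "p \<in> below m" "m \<in> monomials n" "k \<in> monomials n"
    and "\<And>k'. k' \<in> keys q \<Longrightarrow> k' \<in> monomials n \<and> (k', k) \<in> \<sigma>"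
  shows "p * q \<in> below (m + k)"
  unfolding below_def mem_Collect_eq
proof
  fix x assume "x \<in> keys (p * q)"
  then obtain m' k' where x: "x = m' + k'" "m' \<in> keys p" "k' \<in> keys q"
    using keys_mult[of p q] by blast
  have m': "m' \<in> monomials n" "(m', m) \<in> \<sigma>" "m' \<noteq> m"
    using assms(1) x by (auto simp: below_def)
  have k': "k' \<in> monomials n" "(k', k) \<in> \<sigma>"
    using assms(4) x by auto
  have 1: "(m' + k', m + k') \<in> \<sigma>" and 2: "(m + k', m + k) \<in> \<sigma>"
    using le_add[OF m'(1) assms(2) k'(1) m'(2)] le_add[OF k'(1) assms(3,2) k'(2)] by (simp_all add: add.commute)
  have "m' + k' \<noteq> m + k"
  proof
    assume "m' + k' = m + k"
    with 1 2 have "m' + k' = m + k'" using le_antisym by metis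
    with m'(3) show False by simp
  qed
  then show "x \<in> monomials n \<and> (x, m + k) \<in> \<sigma> \<and> x \<noteq> m + k"
    using le_trans[OF 1 2] monomials_add[OF m'(1) k'(1)] x(1) by simp
qed

text \<open>Leading monomial with coefficient 1, expressed through the error term so that products
  are immediate from \<open>below_mult\<close>.\<close>

definition leads :: "mpoly \<Rightarrow> monomial \<Rightarrow> bool" where
  "leads p m \<longleftrightarrow> m \<in> monomials n \<and> p - Poly_Mapping.single m 1 \<in> below m"

lemma leads_keys:
  assumes "leads p m" "k \<in> keys p"
  shows "k \<in> monomials n \<and> (k, m) \<in> \<sigma>"
proof (cases "k = m")
  case True
  then show ?thesis using assms le_refl by (auto simp: leads_def)
next
  case False
  then have "k \<in> keys (p - Poly_Mapping.single m 1)"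
    using assms(2) by (simp add: in_keys_iff lookup_minus lookup_single when_def)
  then show ?thesis using assms(1) by (auto simp: leads_def below_def)
qed

lemma leads_mult:
  assumes "leads p m" "leads q k"
  shows "leads (p * q) (m + k)"
proof -
  define p0 where "p0 = p - Poly_Mapping.single m 1"
  define q0 where "q0 = q - Poly_Mapping.single k 1"
  have p: "p0 \<in> below m" "m \<in> monomials n" and q: "q0 \<in> below k" "k \<in> monomials n"
    using assms by (auto simp: leads_def p0_def q0_def)
  have "p0 * q \<in> below (m + k)"
    using below_mult[OF p q(2)] leads_keys[OF assms(2)] by blast
  moreover have "q0 * Poly_Mapping.single m 1 \<in> below (k + m)"
    by (rule below_mult[OF q p(2)]) (use p(2) le_refl in \<open>auto split: if_splits\<close>)
  moreover have "p * q - Poly_Mapping.single (m + k) 1 = p0 * q + q0 * Poly_Mapping.single m 1"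
    by (simp add: p0_def q0_def algebra_simps mult_single)
  ultimately show ?thesis
    using monomials_add[OF p(2) q(2)] by (simp add: leads_def add.commute below_add)
qed

text \<open>In the south-east case the subtracted product is the antidiagonal of the 2-minor through
  \<open>d\<close> and \<open>x\<close>, hence smaller by \<open>swap_le\<close>.\<close>

lemma leads_schur:
  assumes "d \<in> box" "x \<in> box"
  shows "leads (schur d x) (Poly_Mapping.single d 1 + Poly_Mapping.single x 1)"
proof -
  have d: "Poly_Mapping.single d 1 \<in> monomials n" "Poly_Mapping.single x 1 \<in> monomials n"
    using assms by (auto simp: monomials_iff split: if_splits)
  have z: "var d * var x = Poly_Mapping.single (Poly_Mapping.single d 1 + Poly_Mapping.single x 1) 1"
    by (simp add: var_def mult_single)
  show ?thesis
  proof (cases "fst d < fst x \<and> snd d < snd x")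
    case False
    then show ?thesis
      using monomials_add[OF d] by (simp add: leads_def schur_def z below_0 if_not_P)
  next
    case True
    obtain a b k l where [simp]: "d = (a, b)" "x = (k, l)" by (cases d, cases x)
    have kl: "a < k" "b < l" using True by auto
    have eq: "mon {(a, l), (k, b)} = Poly_Mapping.single (a, l) 1 + Poly_Mapping.single (k, b) 1"
      "mon {(a, b), (k, l)} = Poly_Mapping.single d 1 + Poly_Mapping.single x 1"
      using kl by (simp_all add: mon_def)
    have "(mon {(a, l), (k, b)}, mon {(a, b), (k, l)}) \<in> \<sigma>"
      by (rule swap_le) (use kl assms in auto)
    moreover have "mon {(a, l), (k, b)} \<noteq> mon {(a, b), (k, l)}"
      using mon_inj[of "{(a, l), (k, b)}" "{(a, b), (k, l)}"] kl by (auto simp: doubleton_eq_iff)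
    moreover have "mon {(a, l), (k, b)} \<in> monomials n"
      using assms by (simp add: monomials_iff)
    moreover have "schur d x - Poly_Mapping.single (Poly_Mapping.single d 1 + Poly_Mapping.single x 1) 1 =
        - Poly_Mapping.single (mon {(a, l), (k, b)}) 1"
      using True by (simp add: schur_def z[symmetric] eq(1)) (simp add: var_def mult_single add.commute)
    ultimately show ?thesis
      using monomials_add[OF d] by (simp add: leads_def below_def eq(2))
  qed
qed

lemma leads_subst_schur:
  assumes "d \<in> box" "keys m \<subseteq> box"
  shows "leads (subst (schur d) (Poly_Mapping.single m 1)) (Poly_Mapping.single d (mdeg m) + m)"
  using assms(2)
proof (induction "mdeg m" arbitrary: m)
  case 0
  then have "m = 0"
    by (intro poly_mapping_eqI) (auto simp: mdeg_def in_keys_iff)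
  then show ?case
    by (simp add: leads_def below_0 monomials_iff mdeg_def)
next
  case (Suc k)
  then have "keys m \<noteq> {}"
    unfolding mdeg_def by (metis sum.empty nat.distinct(1))
  then obtain x where x: "x \<in> keys m"
    by blast
  define m' where "m' = m - Poly_Mapping.single x 1"
  have m: "m = Poly_Mapping.single x 1 + m'"
    by (intro poly_mapping_eqI) (use x in \<open>auto simp: m'_def lookup_add lookup_minus lookup_single when_def in_keys_iff\<close>)
  have "k = mdeg m'" "keys m' \<subseteq> box"
  proof -
    have "keys m' \<subseteq> keys m"
      by (auto simp: in_keys_iff m'_def lookup_minus)
    with Suc(3) show "keys m' \<subseteq> box" by blast
    show "k = mdeg m'" using Suc(2) by (simp add: m mdeg_add)
  qed
  then have IH: "leads (subst (schur d) (Poly_Mapping.single m' 1)) (Poly_Mapping.single d (mdeg m') + m')"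
    using Suc(1) by blast
  have "Poly_Mapping.single m 1 = var x * Poly_Mapping.single m' 1"
    by (simp add: m var_def mult_single)
  then have "subst (schur d) (Poly_Mapping.single m 1) = schur d x * subst (schur d) (Poly_Mapping.single m' 1)"
    by (simp only: subst.ev_mult subst.ev_var)
  moreover have "Poly_Mapping.single d 1 + Poly_Mapping.single x 1 + (Poly_Mapping.single d (mdeg m') + m') =
      Poly_Mapping.single d (mdeg m) + m"
    by (simp add: m mdeg_add single_add algebra_simps flip: One_nat_def)
  ultimately show ?case
    using leads_mult[OF leads_schur[OF assms(1), of x] IH] x Suc(3) by auto
qed

lemma lm_of_below:
  assumes "F - Poly_Mapping.single M c \<in> below M" "c \<noteq> 0" "M \<in> monomials n"
  shows "F \<noteq> 0" "lm F = M"
proof -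
  have "lookup (F - Poly_Mapping.single M c) M = 0"
    using assms(1) by (auto simp: below_def in_keys_iff)
  then have M: "M \<in> keys F"
    using assms(2) by (simp add: in_keys_iff lookup_minus)
  then show "F \<noteq> 0" by auto
  show "lm F = M"
  proof (rule lm_eqI[OF M])
    fix m assume m: "m \<in> keys F"
    show "(m, M) \<in> \<sigma>"
    proof (cases "m = M")
      case False
      then have "m \<in> keys (F - Poly_Mapping.single M c)"
        using m by (simp add: in_keys_iff lookup_minus lookup_single when_def)
      then show ?thesis using assms(1) by (auto simp: below_def)
    qed (use assms(3) le_refl in auto)
  qed
qed

theorem good_delete_min:
  assumes D: "pperm n D" and ab: "(a, b) \<in> D" and min: "\<And>x. x \<in> D \<Longrightarrow> \<not> (fst x < a \<and> snd x < b)"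
    and good: "good (D - {(a, b)})"
  shows "good D"
proof -
  let ?D = "D - {(a, b)}" and ?z = "var (a, b)"
  have fD: "finite D" using D by (rule pperm_finite)
  have D': "pperm n ?D" using D pperm_subset by blast
  obtain f0 where f0: "f0 \<in> idl (gens ?D)" "f0 \<noteq> 0" "f0 \<in> pols (cells ?D)" "\<not> bad ?D (keys (lm f0))"
    using good unfolding good_def by blast
  have box: "cells ?D \<subseteq> box" "cells D \<subseteq> box" "(a, b) \<in> box"
    using cells_subset[OF D'] cells_subset[OF D] D ab by (auto simp: pperm_def)
  have f0b: "f0 \<in> pols box" using f0(3) pols_mono[OF box(1)] by blast
  define d where "d = mdeg (lm f0)"
  \<comment> \<open>The homogeneous component of \<open>f0\<close> that contains its leading
    monomial.\<close>
  define f where "f = hcomp d f0"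
  define m0 where "m0 = lm f0"
  have keys: "keys f = {m \<in> keys f0. mdeg m = d}"
    by (simp add: f_def keys_hcomp)
  have m0: "m0 \<in> keys f" "\<And>m. m \<in> keys f \<Longrightarrow> (m, m0) \<in> \<sigma>"
    using lm[OF f0(2) f0b] by (auto simp: keys d_def m0_def)
  have mb: "m \<in> monomials n" "keys m \<subseteq> cells ?D" "mdeg m = d" if "m \<in> keys f" for m
    using that f0(3) f0b by (auto simp: keys pols_def monomials_iff)
  have fI: "f \<in> idl (gens ?D)"
    unfolding f_def by (rule hcomp_idl[OF f0(1) gens_homogeneous])
  define F where "F = ?z * subst (schur (a, b)) f"
  have FI: "F \<in> idl (gens D)"
    unfolding F_def by (rule idl_subst[OF fI schur_gens[OF D ab min]])
  have Fp: "F \<in> pols (cells D)"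
  proof -
    have "f \<in> pols (cells ?D)" using mb by (auto simp: pols_def)
    then have "subst (schur (a, b)) f \<in> pols (cells D)"
    proof (rule subst_in_pols)
      fix x assume "x \<in> cells ?D"
      then show "schur (a, b) x \<in> pols (cells D)"
        using ab unfolding schur_def by (cases x) (auto intro!: pols_diff pols_mult; force)
    qed
    then show ?thesis
      unfolding F_def using ab by (intro pols_mult) force+
  qed
  define z where "z = Poly_Mapping.single (a, b) (1::nat)"
  \<comment> \<open>\<open>h m\<close> is the leading monomial of the image of \<open>m\<close>. On
    the support of \<open>f\<close>, all of degree \<open>d\<close>, it is multiplication by a fixed
    monomial and so keeps the order.\<close>
  define h where "h m = z + (Poly_Mapping.single (a, b) d + m)" for m
  have zm: "z \<in> monomials n" "Poly_Mapping.single (a, b) d \<in> monomials n"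
    using box(3) by (auto simp: z_def monomials_iff split: if_splits)
  have "leads ?z z"
    using zm by (simp add: leads_def var_def z_def below_0)
  then have leads: "leads (?z * subst (schur (a, b)) (Poly_Mapping.single m 1)) (h m)" if "m \<in> keys f" for m
    unfolding h_def using leads_mult leads_subst_schur[OF box(3), of m] mb[OF that] by (metis monomials_iff)
  have hm: "h m0 \<in> monomials n"
    using leads[OF m0(1)] by (simp add: leads_def)
  have hlt: "(h m, h m0) \<in> \<sigma> \<and> h m \<noteq> h m0" if "m \<in> keys f" "m \<noteq> m0" for m
  proof -
    have "(m + (z + Poly_Mapping.single (a, b) d), m0 + (z + Poly_Mapping.single (a, b) d)) \<in> \<sigma>"
      by (intro le_add mb m0 that monomials_add zm)
    with that show ?thesis by (simp add: h_def algebra_simps)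
  qed
  define c where "c = lookup f m0"
  have c: "c \<noteq> 0" using m0(1) by (simp add: c_def in_keys_iff)
  define P where "P m = ?z * subst (schur (a, b)) (Poly_Mapping.single m 1)" for m
  have cst_below: "cst e * p \<in> below m" if "p \<in> below m" for e p m
    using that keys_mult[of "cst e" p] by (fastforce simp: below_def split: if_splits)
  have "F = (\<Sum>m\<in>keys f. cst (lookup f m) * P m)"
    unfolding F_def P_def
    by (subst poly_expand[of f]) (simp add: sum_distrib_left mult.left_commute del: subst.ev_single, subst single_expand,
      simp add: mult.left_commute del: subst.ev_single mult_single)
  also have "\<dots> = cst c * P m0 + (\<Sum>m\<in>keys f - {m0}. cst (lookup f m) * P m)"
    using m0(1) by (simp add: sum.remove c_def)
  finally have "F - Poly_Mapping.single (h m0) c = cst c * (P m0 - Poly_Mapping.single (h m0) 1) +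
      (\<Sum>m\<in>keys f - {m0}. cst (lookup f m) * P m)"
    by (simp add: algebra_simps mult_single)
  also have "\<dots> \<in> below (h m0)"
  proof (intro below_add cst_below below_sum)
    show "P m0 - Poly_Mapping.single (h m0) 1 \<in> below (h m0)"
      using leads[OF m0(1)] by (simp add: leads_def P_def)
    fix m assume m: "m \<in> keys f - {m0}"
    have "k \<in> monomials n \<and> (k, h m0) \<in> \<sigma> \<and> k \<noteq> h m0" if "k \<in> keys (P m)" for k
      using leads_keys[OF leads, of m k] that m hlt[of m] le_trans le_antisym unfolding P_def by blast
    then show "P m \<in> below (h m0)" by (simp add: below_def)
  qed
  finally have F: "F \<noteq> 0" "lm F = h m0"
    using lm_of_below[OF _ c hm] by blast+
  \<comment> \<open>Only the pivot can be new in the support of the leading monomial, which is the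
    situation of \<open>not_bad_insert\<close>.\<close>
  have "keys (lm F) \<subseteq> insert (a, b) (keys (lm f0))"
    unfolding F(2) h_def z_def m0_def by (auto simp: in_keys_iff lookup_add lookup_single when_def split: if_splits)
  then have "\<not> bad D (keys (lm F))"
    using not_bad_insert[OF fD ab f0(4)] bad_mono by blast
  then show ?thesis
    unfolding good_def using FI F(1) Fp by blast
qed

end

subsection \<open>Minors of 0-1 matrices\<close>

definition ind :: "cell set \<Rightarrow> cell \<Rightarrow> complex" where
  "ind E x = (if x \<in> E then 1 else 0)"

lemma mn_ind:
  assumes "finite A" "finite B" "card A = card B"
  shows "mn (ind E) A B = (\<Sum>C\<in>{C \<in> matchings A B. C \<subseteq> E}. of_int (msign A B C))"
proof -
  have "(\<Prod>c\<in>C. ind E c) = (if C \<subseteq> E then 1 else 0)" if "C \<in> matchings A B" for C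
    using matchings_finite[OF assms(1) that] by (auto simp: ind_def intro!: prod.neutral prod_zero)
  then have "mn (ind E) A B = (\<Sum>C\<in>matchings A B. if C \<subseteq> E then of_int (msign A B C) else 0)"
    by (auto simp: mn_expand[OF assms] intro!: sum.cong)
  then show ?thesis
    by (simp add: sum.inter_filter[OF finite_matchings[OF assms(1,2)]])
qed

lemma mn_ind_zero:
  assumes "finite A" "finite B" "card A = card B" "\<And>C. C \<in> matchings A B \<Longrightarrow> \<not> C \<subseteq> E"
  shows "mn (ind E) A B = 0"
  using assms(4) by (subst mn_ind[OF assms(1-3)]) (auto intro!: sum.neutral)

lemma mn_ind_nonzero:
  assumes "finite A" "finite B" "card A = card B" "C0 \<in> matchings A B" "C0 \<subseteq> E"
    and "\<And>C. C \<in> matchings A B \<Longrightarrow> C \<subseteq> E \<Longrightarrow> C = C0"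
  shows "mn (ind E) A B \<noteq> 0"
proof -
  have "{C \<in> matchings A B. C \<subseteq> E} = {C0}" using assms by blast
  then show ?thesis
    using msign_cases[of A B C0] by (auto simp: mn_ind[OF assms(1-3)])
qed

subsection \<open>The pattern 13254\<close>

text \<open>An increasing matching sends the row of \<open>A\<close> with \<open>k\<close> smaller
  rows to the column of \<open>B\<close> with \<open>k\<close> smaller columns.\<close>

lemma increasing_matching_unique:
  assumes "finite A" "C \<in> matchings A B" "C' \<in> matchings A B"
    and "\<And>x y. x \<in> C \<Longrightarrow> y \<in> C \<Longrightarrow> \<not> (fst x < fst y \<and> snd y < snd x)"
    and "\<And>x y. x \<in> C' \<Longrightarrow> y \<in> C' \<Longrightarrow> \<not> (fst x < fst y \<and> snd y < snd x)"
  shows "C = C'"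
proof -
  have snd: "snd x = pick B (card {a \<in> A. a < fst x})"
    if C: "C \<in> matchings A B" "\<And>x y. x \<in> C \<Longrightarrow> y \<in> C \<Longrightarrow> \<not> (fst x < fst y \<and> snd y < snd x)" and x: "x \<in> C"
    for C x
  proof -
    have inj: "inj_on fst C" "inj_on snd C" and im: "fst ` C = A" "snd ` C = B"
      using C(1) by (auto simp: matchings_def bij_betw_def)
    have iff: "fst y < fst x \<longleftrightarrow> snd y < snd x" if "y \<in> C" for y
      using C(2)[OF x that] C(2)[OF that x] inj x that
      by (metis inj_onD linorder_neqE_nat order.asym)
    have "{a \<in> A. a < fst x} = fst ` {y \<in> C. fst y < fst x}" "{b \<in> B. b < snd x} = snd ` {y \<in> C. fst y < fst x}"
      using im iff by auto
    moreover have "inj_on fst {y \<in> C. fst y < fst x}" "inj_on snd {y \<in> C. fst y < fst x}"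
      using inj by (auto intro: inj_on_subset)
    ultimately have "card {a \<in> A. a < fst x} = card {b \<in> B. b < snd x}"
      by (simp add: card_image)
    moreover have "snd x \<in> B" using im x by blast
    ultimately show ?thesis using pick_card_in_set by metis
  qed
  have eq: "C = (\<lambda>a. (a, pick B (card {a' \<in> A. a' < a}))) ` A"
    if C: "C \<in> matchings A B" "\<And>x y. x \<in> C \<Longrightarrow> y \<in> C \<Longrightarrow> \<not> (fst x < fst y \<and> snd y < snd x)" for C
  proof -
    have "fst ` C = A" using C(1) by (auto simp: matchings_def bij_betw_def)
    moreover have "(fst x, pick B (card {a' \<in> A. a' < fst x})) = x" if "x \<in> C" for x
      using snd[OF C that] by (simp add: prod_eq_iff)
    then have "(\<lambda>x. (fst x, pick B (card {a' \<in> A. a' < fst x}))) ` C = (\<lambda>x. x) ` C"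
      by (rule image_cong[OF refl])
    then have "(\<lambda>a. (a, pick B (card {a' \<in> A. a' < a}))) ` (fst ` C) = C"
      by (simp add: image_image)
    ultimately show ?thesis by simp
  qed
  show ?thesis using eq[OF assms(2,4)] eq[OF assms(3,5)] by simp
qed

lemma chain_subset: "chain D C \<Longrightarrow> C' \<subseteq> C \<Longrightarrow> chain D C'"
  unfolding chain_def by (meson inj_on_subset subset_iff)

lemma matchings_sub:
  assumes "C \<in> matchings A B" "C' \<subseteq> C"
  shows "C' \<in> matchings (fst ` C') (snd ` C')"
  using assms unfolding matchings_def bij_betw_def by (auto intro: inj_on_subset)

lemma matchings_replace:
  assumes "C \<in> matchings A B" "C' \<subseteq> C" "C'' \<in> matchings (fst ` C') (snd ` C')"
  shows "(C - C') \<union> C'' \<in> matchings A B" "(C - C') \<inter> C'' = {}"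
proof -
  have C: "inj_on fst C" "inj_on snd C" "fst ` C = A" "snd ` C = B"
    using assms(1) by (auto simp: matchings_def bij_betw_def)
  have C'': "inj_on fst C''" "inj_on snd C''" "fst ` C'' = fst ` C'" "snd ` C'' = snd ` C'"
    using assms(3) by (auto simp: matchings_def bij_betw_def)
  have d: "fst ` (C - C') \<inter> fst ` C'' = {}" "snd ` (C - C') \<inter> snd ` C'' = {}"
    using inj_on_image_set_diff[OF C(1) _ assms(2)] inj_on_image_set_diff[OF C(2) _ assms(2)] C''(3,4) by auto
  then show "(C - C') \<inter> C'' = {}" by blast
  have "inj_on fst ((C - C') \<union> C'')" "inj_on snd ((C - C') \<union> C'')"
    using C(1,2) C''(1,2) d by (auto simp: inj_on_Un intro: inj_on_diff)
  moreover have eq: "(C - C') \<union> C' = C" using assms(2) by blast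
  have "fst ` ((C - C') \<union> C'') = A" "snd ` ((C - C') \<union> C'') = B"
    by (simp_all only: image_Un C''(3,4)) (simp_all only: image_Un[symmetric] eq C)
  ultimately show "(C - C') \<union> C'' \<in> matchings A B"
    by (simp add: matchings_def bij_betw_def)
qed

lemma lookup_single_mult: "lookup (Poly_Mapping.single k a * (g :: mpoly)) (k + m) = a * lookup g m"
proof -
  have "Poly_Mapping.single k a * g = (\<Sum>m'\<in>keys g. Poly_Mapping.single (k + m') (a * lookup g m'))"
    by (subst poly_expand[of g]) (simp add: sum_distrib_left mult_single)
  then have "lookup (Poly_Mapping.single k a * g) (k + m) = (\<Sum>m'\<in>keys g. if m' = m then a * lookup g m' else 0)"
    by (simp add: lookup_sum lookup_single when_def)
  then show ?thesis
    by (simp add: in_keys_iff)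
qed

context diag_order
begin

lemma finite_min:
  assumes "finite K" "K \<noteq> {}" "K \<subseteq> monomials n"
  shows "\<exists>m\<in>K. \<forall>m'\<in>K. (m, m') \<in> \<sigma>"
  using assms
proof (induction K rule: finite_ne_induct)
  case (singleton x)
  then show ?case using le_refl by auto
next
  case (insert x F)
  then obtain m where m: "m \<in> F" "\<forall>m'\<in>F. (m, m') \<in> \<sigma>" by auto
  show ?case
  proof (cases "(m, x) \<in> \<sigma>")
    case True
    with m show ?thesis by blast
  next
    case False
    then have "(x, m) \<in> \<sigma>"
      using le_total[of x m] m insert by blast
    then have "\<forall>m'\<in>insert x F. (x, m') \<in> \<sigma>"
      using m le_refl[of x] insert.prems le_trans by blast
    then show ?thesis by blast
  qed
qed

text \<open>Among the elements of the ideal that are multilinear in the rows \<open>A\<close> and columns \<open>B\<close> and do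
  not vanish at the 0-1 matrix \<open>U\<close>, one with minimal leading monomial is good: a bad chain
  in it could be cancelled by a minor that vanishes at \<open>U\<close>.\<close>

theorem good_13254:
  assumes D: "pperm n D"
    and dots: "(p1, v1) \<in> D" "(p2, v3) \<in> D" "(p3, v2) \<in> D" "(p4, v5) \<in> D" "(p5, v4) \<in> D"
    and p: "p1 < p2" "p2 < p3" "p3 < p4" "p4 < p5" and v: "v1 < v2" "v2 < v3" "v3 < v4" "v4 < v5"
    and min: "\<And>x. x \<in> D \<Longrightarrow> p1 \<le> fst x \<and> v1 \<le> snd x"
  shows "good D"
proof -
  have fD: "finite D" using D by (rule pperm_finite)
  have inj: "inj_on fst D" "inj_on snd D" and Dbox: "D \<subseteq> box" using D by (auto simp: pperm_def)
  have inj1: "x = y" if "x \<in> D" "y \<in> D" "fst x = fst y" for x y using inj(1) that by (auto dest: inj_onD)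
  have inj2: "x = y" if "x \<in> D" "y \<in> D" "snd x = snd y" for x y using inj(2) that by (auto dest: inj_onD)
  \<comment> \<open>With all dots south-east of \<open>(p1, v1)\<close>, no cell of
    \<open>cells D\<close> has rank 0, so chains there are increasing.\<close>
  have rk_pos: "rk D i j > 0" if "i \<in> fst ` D" "j \<in> snd ` D" for i j
    using that dots(1) min by (auto simp: rk_pos_iff[OF fD] intro!: bexI[of _ "(p1, v1)"])
  \<comment> \<open>\<open>(p4, v4)\<close> is the corner cut out by the inversion 54.
    \<open>U\<close> consists of the dots to its north-west and of the corner itself. As a 0-1
    matrix, \<open>U\<close> can exceed the ranks of \<open>D\<close> only in boxes that contain the
    corner (\<open>rkU\<close>).\<close>
  define K where "K = {x \<in> D. fst x < p4 \<and> snd x < v4}"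
  define U where "U = insert (p4, v4) K"
  define A B where "A = insert p4 (fst ` K)" and "B = insert v4 (snd ` K)"
  have K: "K \<subseteq> D" "finite K" "p4 \<notin> fst ` K" "v4 \<notin> snd ` K" "(p4, v4) \<notin> K"
    using fD by (auto simp: K_def)
  have injK: "inj_on fst K" "inj_on snd K" using inj K(1) by (auto intro: inj_on_subset)
  have fin: "finite A" "finite B" and card: "card A = Suc (card K)" "card B = Suc (card K)" "card U = Suc (card K)"
    using K injK by (auto simp: A_def B_def U_def card_image)
  have cAB: "card A = card B" using card by simp
  have AD: "A \<subseteq> fst ` D" "B \<subseteq> snd ` D"
    using K(1) dots(4,5) by (force simp: A_def B_def)+
  have AB: "A \<subseteq> {1..n}" "B \<subseteq> {1..n}" "A \<times> B \<subseteq> cells D" "A \<times> B \<subseteq> box"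
    using AD Dbox by fastforce+
  have U: "U \<in> matchings A B"
    using injK K by (auto simp: U_def A_def B_def matchings_def bij_betw_def)
  have rkU: "card (U \<inter> {x. fst x \<le> i \<and> snd x \<le> j}) \<le> rk D i j" if "\<not> (p4 \<le> i \<and> v4 \<le> j)" for i j
    unfolding rk_def by (rule card_mono) (use that fD K(1) in \<open>auto simp: U_def\<close>)
  define M where "M = mn var A B"
  have rkK: "rk D p4 v4 = card K"
  proof -
    have "fst x < p4 \<and> snd x < v4" if "x \<in> D" "fst x \<le> p4" "snd x \<le> v4" for x
    proof -
      have "fst x \<noteq> p4"
      proof
        assume "fst x = p4"
        then have "x = (p4, v5)" using inj1[OF that(1) dots(4)] by simp
        then show False using that(3) v by simp
      qed
      moreover have "snd x \<noteq> v4"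
      proof
        assume "snd x = v4"
        then have "x = (p5, v4)" using inj2[OF that(1) dots(5)] by simp
        then show False using that(2) p by simp
      qed
      ultimately show ?thesis using that by simp
    qed
    then have "{x \<in> D. fst x \<le> p4 \<and> snd x \<le> v4} = K" by (auto simp: K_def)
    then show ?thesis by (simp add: rk_def)
  qed
  have Mgens: "M \<in> gens D"
    unfolding M_def by (rule gensI[where i = p4 and j = v4]) (use AD card rkK in \<open>auto simp: A_def B_def K_def\<close>)
  have atM: "at_pt (ind U) M \<noteq> 0"
  proof -
    have "C = U" if "C \<in> matchings A B" "C \<subseteq> U" for C
      using that matchings_card[OF that(1)] card K(2) by (intro card_subset_eq) (auto simp: U_def)
    then have "mn (ind U) A B \<noteq> 0"
      by (intro mn_ind_nonzero[OF fin cAB U]) auto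
    then show ?thesis
      by (simp add: M_def at_pt.ev_mn[OF fin cAB])
  qed
  \<comment> \<open>\<open>M\<close> belongs to \<open>Q\<close>, since \<open>U\<close> is the only
    matching inside \<open>U\<close>. The leading monomials of the candidates lie in a finite set,
    so a least one exists although no well-ordering is at hand.\<close>
  define Q where "Q = {p \<in> idl (gens D). keys p \<subseteq> mon ` matchings A B \<and> at_pt (ind U) p \<noteq> 0}"
  have MQ: "M \<in> Q"
    using Mgens atM keys_mn_zvar[OF fin cAB, of "{}"] by (auto simp: Q_def M_def zvar_empty intro: idl_gen)
  have mon_mon: "mon ` matchings A B \<subseteq> monomials n"
    using matchings_finite[OF fin(1)] matchings_subset AB(4) by (fastforce simp: monomials_iff)
  have mon_cells: "keys m \<subseteq> cells D" if "m \<in> mon ` matchings A B" for m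
    using that matchings_finite[OF fin(1)] matchings_subset[of _ A B] AB(3) by fastforce
  have Qlm: "p \<noteq> 0" "p \<in> pols box" "lm p \<in> mon ` matchings A B" if "p \<in> Q" for p
  proof -
    show p0: "p \<noteq> 0" using that by (auto simp: Q_def)
    show pb: "p \<in> pols box" 
      using that mon_mon unfolding Q_def pols_def monomials_def by blast
    show "lm p \<in> mon ` matchings A B" using lm(1)[OF p0 pb] that by (auto simp: Q_def)
  qed
  have "finite (lm ` Q)" "lm ` Q \<noteq> {}" "lm ` Q \<subseteq> monomials n"
    using Qlm(3) MQ mon_mon finite_matchings[OF fin] by (auto intro: finite_subset[of _ "mon ` matchings A B"])
  then obtain q where q: "q \<in> Q" "\<And>p. p \<in> Q \<Longrightarrow> (lm q, lm p) \<in> \<sigma>"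
    using finite_min[of "lm ` Q"] by blast
  obtain C0 where C0: "C0 \<in> matchings A B" "lm q = mon C0"
    using Qlm(3)[OF q(1)] by blast
  have finC0: "finite C0" and C0AB: "C0 \<subseteq> A \<times> B"
    using matchings_finite[OF fin(1) C0(1)] matchings_subset[OF C0(1)] by auto
  have incr: "\<not> (fst x < fst y \<and> snd y < snd x)" if "chain D C" "C \<subseteq> cells D" "x \<in> C" "y \<in> C" for C x y
  proof
    assume xy: "fst x < fst y \<and> snd y < snd x"
    have "fst x \<in> fst ` D" "snd y \<in> snd ` D"
      using subsetD[OF that(2,3)] subsetD[OF that(2,4)] by (simp_all add: mem_Times_iff)
    then have "rk D (fst x) (snd y) > 0" by (rule rk_pos)
    moreover have "rk D (fst x) (snd y) = 0" using that(1,3,4) xy by (simp add: chain_def)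
    ultimately show False by simp
  qed
  have "\<not> bad D (keys (lm q))"
  proof
    assume "bad D (keys (lm q))"
    then obtain C' i' j' where C': "C' \<subseteq> C0" "C' \<subseteq> {..i'} \<times> {..j'}" "chain D C'" "rk D i' j' < card C'" "finite C'"
      unfolding bad_def C0(2) keys_mon[OF finC0] by blast
    \<comment> \<open>A generator has exactly one row more than the rank, so the chain is trimmed to
      this size.\<close>
    obtain C2 where C2: "C2 \<subseteq> C'" "card C2 = Suc (rk D i' j')"
      using obtain_subset_with_card_n[of "Suc (rk D i' j')" C'] C'(4) by auto
    have vanish: "mn (ind U) (fst ` C) (snd ` C) = 0"
      if C: "C \<subseteq> C0" "C \<subseteq> {..i} \<times> {..j}" "card C = Suc (rk D i j)" "\<not> (p4 \<le> i \<and> v4 \<le> j)" for C i j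
    proof (rule mn_ind_zero)
      note mC = matchings_sub[OF C0(1) C(1)]
      show "finite (fst ` C)" "finite (snd ` C)" using C(1) finC0 finite_subset by blast+
      show "card (fst ` C) = card (snd ` C)"
        using mC by (auto simp: matchings_def bij_betw_def card_image)
      fix E assume E: "E \<in> matchings (fst ` C) (snd ` C)"
      show "\<not> E \<subseteq> U"
      proof
        assume "E \<subseteq> U"
        moreover have "E \<subseteq> fst ` C \<times> snd ` C" using matchings_subset[OF E] .
        ultimately have "E \<subseteq> U \<inter> {x. fst x \<le> i \<and> snd x \<le> j}" using C(2) by fastforce
        then have "card E \<le> rk D i j"
          using rkU[OF C(4)] K(2) card_mono[of "U \<inter> {x. fst x \<le> i \<and> snd x \<le> j}" E] by (auto simp: U_def)
        moreover have "card E = card C"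
          using matchings_card[OF E] matchings_card[OF mC] by simp
        ultimately show False using C(3) by simp
      qed
    qed
    obtain C1 i j where C1: "C1 \<subseteq> C0" "C1 \<subseteq> {..i} \<times> {..j}" "chain D C1" "card C1 = Suc (rk D i j)"
      "mn (ind U) (fst ` C1) (snd ` C1) = 0"
    proof (cases "p4 \<le> i' \<and> v4 \<le> j'")
      case False
      show ?thesis
        by (rule that[of C2 i' j']) (use C' C2 vanish[of C2 i' j'] chain_subset False in auto)
    next
      case True
      then have "card K \<le> rk D i' j'"
        unfolding rk_def by (intro card_mono) (use fD in \<open>auto simp: K_def\<close>)
      then have "card C0 \<le> card C'"
        using C'(4) matchings_card[OF C0(1)] card by simp
      then have "C' = C0" using C'(1) finC0 by (simp add: card_seteq)
      then have ch: "chain D C0" using C'(3) by simp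
      \<comment> \<open>In a box with the corner a minor need not vanish at \<open>U\<close>, but
        the chain is then all of \<open>C0\<close>. The inversion 32 supplies another box,
        \<open>(p2, v2)\<close>, without the corner. \<open>C0\<close> meets the rows of all dots in
        this box and row \<open>p2\<close>, and likewise their columns and column \<open>v2\<close>;
        so \<open>S\<close> and \<open>T\<close> have more than \<open>rk D p2 v2\<close> cells
        each. As \<open>C0\<close> is increasing, one of the two contains the other.\<close>
      define S where "S = {x \<in> C0. fst x \<le> p2}"
      define T where "T = {x \<in> C0. snd x \<le> v2}"
      have "S \<subseteq> T \<or> T \<subseteq> S"
      proof (rule ccontr)
        assume "\<not> (S \<subseteq> T \<or> T \<subseteq> S)"
        then obtain x y where xy: "x \<in> S" "x \<notin> T" "y \<in> T" "y \<notin> S" by blast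
        then have "fst x < fst y \<and> snd y < snd x" "x \<in> C0" "y \<in> C0" by (auto simp: S_def T_def)
        moreover have "C0 \<subseteq> cells D" using C0AB AB(3) by blast
        ultimately show False using incr[OF ch] by blast
      qed
      then have ST: "S \<inter> T = S \<or> S \<inter> T = T" by blast
      have C0fs: "fst ` C0 = A" "snd ` C0 = B" "inj_on fst C0" "inj_on snd C0"
        using C0(1) by (auto simp: matchings_def bij_betw_def)
      define R where "R = {x \<in> D. fst x \<le> p2 \<and> snd x \<le> v2}"
      have R: "R \<subseteq> K" "finite R" "card R = rk D p2 v2"
        using p v fD by (auto simp: R_def K_def rk_def)
      have "insert p2 (fst ` R) \<subseteq> fst ` S"
      proof -
        have "p2 \<in> A" using dots(2) p v by (force simp: A_def K_def)
        moreover have "fst ` R \<subseteq> A" using R(1) by (auto simp: A_def)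
        ultimately have "insert p2 (fst ` R) \<subseteq> {a \<in> fst ` C0. a \<le> p2}" by (auto simp: C0fs R_def)
        also have "\<dots> = fst ` S" by (auto simp: S_def)
        finally show ?thesis .
      qed
      moreover have "p2 \<notin> fst ` R"
        using inj1[OF _ dots(2)] v by (fastforce simp: R_def)
      moreover have "card (fst ` S) = card S"
        by (rule card_image, rule inj_on_subset[OF C0fs(3)]) (auto simp: S_def)
      moreover have "card (fst ` R) = card R"
        by (rule card_image[OF inj_on_subset[OF injK(1) R(1)]])
      moreover have "finite (fst ` S)" using finC0 by (simp add: S_def)
      ultimately have cardS: "Suc (rk D p2 v2) \<le> card S"
        using card_mono[of "fst ` S" "insert p2 (fst ` R)"] R(2,3) by simp
      have "insert v2 (snd ` R) \<subseteq> snd ` T"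
      proof -
        have "v2 \<in> B" using dots(3) p v by (force simp: B_def K_def)
        moreover have "snd ` R \<subseteq> B" using R(1) by (auto simp: B_def)
        ultimately have "insert v2 (snd ` R) \<subseteq> {a \<in> snd ` C0. a \<le> v2}" by (auto simp: C0fs R_def)
        also have "\<dots> = snd ` T" by (auto simp: T_def)
        finally show ?thesis .
      qed
      moreover have "v2 \<notin> snd ` R"
        using inj2[OF _ dots(3)] p by (fastforce simp: R_def)
      moreover have "card (snd ` T) = card T"
        by (rule card_image, rule inj_on_subset[OF C0fs(4)]) (auto simp: T_def)
      moreover have "card (snd ` R) = card R"
        by (rule card_image[OF inj_on_subset[OF injK(2) R(1)]])
      moreover have "finite (snd ` T)" using finC0 by (simp add: T_def)
      ultimately have "Suc (rk D p2 v2) \<le> card T"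
        using card_mono[of "snd ` T" "insert v2 (snd ` R)"] R(2,3) by simp
      then have "Suc (rk D p2 v2) \<le> card (S \<inter> T)" using ST cardS by auto
      then obtain C1 where "C1 \<subseteq> S \<inter> T" "card C1 = Suc (rk D p2 v2)"
        using obtain_subset_with_card_n by metis
      moreover from this have "C1 \<subseteq> C0" "C1 \<subseteq> {..p2} \<times> {..v2}" by (auto simp: S_def T_def)
      ultimately show ?thesis
        using that[of C1 p2 v2] vanish[of C1 p2 v2] chain_subset[OF ch] p by simp
    qed
    define g where "g = mn var (fst ` C1) (snd ` C1)"
    note mC1 = matchings_sub[OF C0(1) C1(1)]
    have fin1: "finite (fst ` C1)" "finite (snd ` C1)" "finite C1"
      using finC0 C1(1) finite_subset by blast+
    have card1: "card (fst ` C1) = card C1" "card (snd ` C1) = card C1" "card (fst ` C1) = card (snd ` C1)"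
      using mC1 by (auto simp: matchings_def bij_betw_def card_image)
    have sub1: "fst ` C1 \<subseteq> A" "snd ` C1 \<subseteq> B"
      using C1(1) C0AB by auto
    have gI: "g \<in> gens D"
      unfolding g_def by (rule gensI[where i = i and j = j]) (use C1(2,4) sub1 AD card1 in auto)
    have keysg: "keys g = mon ` matchings (fst ` C1) (snd ` C1)"
      using keys_mn_zvar[OF fin1(1,2) card1(3), of "{}"] by (simp add: g_def zvar_empty)
    then have g0: "g \<noteq> 0" and gk: "mon C1 \<in> keys g" using mC1 by auto
    have gb: "g \<in> pols box"
      unfolding g_def by (rule mn_in_pols[OF fin1(1,2) card1(3)]) (use sub1 AB(4) in auto)
    have lmg: "lm g = mon C1"
    proof -
      obtain E where E: "E \<in> matchings (fst ` C1) (snd ` C1)" "lm g = mon E" "chain D E"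
      proof (rule lm_minor_chain[OF fD _ _ card1(3), of "{}"])
        show "fst ` C1 \<subseteq> {1..n}" "snd ` C1 \<subseteq> {1..n}" using sub1 AB by auto
        show "mn (zvar {}) (fst ` C1) (snd ` C1) \<noteq> 0" using g0 by (simp add: g_def zvar_empty)
        show "(a, b) \<in> {} \<longleftrightarrow> rk D a b = 0" if "a \<in> fst ` C1" "b \<in> snd ` C1" for a b
          using rk_pos[OF subsetD[OF AD(1) subsetD[OF sub1(1) that(1)]] subsetD[OF AD(2) subsetD[OF sub1(2) that(2)]]]
          by simp
      qed (simp add: g_def zvar_empty)
      have sub: "C1 \<subseteq> cells D" "E \<subseteq> cells D"
        using matchings_subset[OF E(1)] matchings_subset[OF mC1] sub1 AD by blast+
      \<comment> \<open>Both are increasing matchings of the same rows and columns, as no cell here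
        has rank 0.\<close>
      have "E = C1"
        by (rule increasing_matching_unique[OF fin1(1) E(1) mC1])
          (use incr[OF E(3) sub(2)] incr[OF C1(3) sub(1)] in blast)+
      then show ?thesis using E(2) by simp
    qed
    have atg: "at_pt (ind U) g = 0"
      using C1(5) by (simp add: g_def at_pt.ev_mn[OF fin1(1,2) card1(3)])
    \<comment> \<open>The leading monomial of \<open>q\<close> is cancelled by a multiple of
      \<open>g\<close>. As \<open>g\<close> vanishes at \<open>U\<close>, the difference
      \<open>r\<close> keeps the value of \<open>q\<close> there and stays in \<open>Q\<close>,
      against the minimality of \<open>lm q\<close>.\<close>
    define k where "k = mon (C0 - C1)"
    have km: "k + mon C1 = mon C0"
      using mon_Un[of "C0 - C1" C1] finC0 fin1(3) C1(1) by (simp add: k_def Un_absorb2 Int_commute Diff_disjoint)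
    define h where "h = Poly_Mapping.single k (lookup q (mon C0) / lookup g (mon C1)) * g"
    define r where "r = q - h"
    have "keys h \<subseteq> (\<lambda>m. k + m) ` keys g"
      unfolding h_def using keys_mult[of "Poly_Mapping.single k (lookup q (mon C0) / lookup g (mon C1))" g]
      by (auto split: if_splits)
    then have keysh: "\<exists>E\<in>matchings (fst ` C1) (snd ` C1). m = k + mon E" if "m \<in> keys h" for m
      using that keysg by auto
    have h1: "keys h \<subseteq> mon ` matchings A B"
    proof
      fix m assume "m \<in> keys h"
      then obtain E where E: "E \<in> matchings (fst ` C1) (snd ` C1)" "m = k + mon E" using keysh by blast
      then have "m = mon (C0 - C1 \<union> E)"
        using matchings_replace(2)[OF C0(1) C1(1) E(1)] finC0 matchings_finite[OF fin1(1) E(1)]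
        by (simp add: k_def mon_Un)
      then show "m \<in> mon ` matchings A B"
        using matchings_replace(1)[OF C0(1) C1(1) E(1)] by blast
    qed
    have kmon: "k \<in> monomials n" "mon C1 \<in> monomials n"
      using C0AB C1(1) AB(4) finC0 fin1(3) by (auto simp: k_def monomials_iff simp del: atLeastAtMost_iff)
    have h2: "(m, mon C0) \<in> \<sigma>" if "m \<in> keys h" for m
    proof -
      obtain E where E: "E \<in> matchings (fst ` C1) (snd ` C1)" "m = k + mon E" using keysh \<open>m \<in> keys h\<close> by blast
      then have "mon E \<in> keys g" by (simp add: keysg)
      then have "(mon E, mon C1) \<in> \<sigma>" "mon E \<in> monomials n"
        using lm(2)[OF g0 gb, of "mon E"] gb by (auto simp: lmg pols_def monomials_iff)
      then show ?thesis
        using le_add[of "mon E" "mon C1" k] kmon km E(2) by (simp add: add.commute)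
    qed
    have "r \<in> idl (gens D)"
      using q(1) idl_diff[OF _ idl_mult[OF idl_gen[OF gI]]] by (simp add: r_def h_def Q_def)
    moreover have "keys r \<subseteq> mon ` matchings A B"
      using h1 q(1) keys_diff[of q h] by (auto simp: r_def Q_def)
    moreover have "at_pt (ind U) r = at_pt (ind U) q"
      by (simp add: r_def h_def atg)
    ultimately have rQ: "r \<in> Q" using q(1) by (simp add: Q_def)
    have "lookup r (mon C0) = 0"
      using lookup_single_mult[of k _ g "mon C1"] gk by (simp add: r_def h_def lookup_minus km in_keys_iff)
    moreover have lr: "lm r \<in> keys r" using lm(1)[OF Qlm(1)[OF rQ] Qlm(2)[OF rQ]] .
    ultimately have "lm r \<noteq> mon C0" by (auto simp: in_keys_iff)
    moreover have "(lm r, mon C0) \<in> \<sigma>"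
    proof -
      have "lm r \<in> keys q \<or> lm r \<in> keys h"
        using lr keys_diff[of q h] by (auto simp: r_def)
      then show ?thesis
        using lm(2)[OF Qlm(1)[OF q(1)] Qlm(2)[OF q(1)], of "lm r"] h2 C0(2) by auto
    qed
    moreover have "(mon C0, lm r) \<in> \<sigma>" using q(2)[OF rQ] C0(2) by simp
    ultimately show False using le_antisym by blast
  qed
  moreover have "q \<in> pols (cells D)"
    using q(1) mon_cells unfolding Q_def pols_def by blast
  ultimately show ?thesis
    unfolding good_def using Qlm(1)[OF q(1)] q(1) by (auto simp: Q_def)
qed

end

subsection \<open>Elimination\<close>

text \<open>If a set \<open>T\<close> of variables contains no bad chain, any nonzero element of the ideal in these
  variables is good, whatever its leading term is.\<close>

definition elim_good :: "cell set \<Rightarrow> bool" where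
  "elim_good D \<longleftrightarrow> (\<exists>f T. f \<in> idl (gens D) \<and> f \<noteq> 0 \<and> f \<in> pols T \<and> T \<subseteq> cells D \<and> \<not> bad D T)"

lemma (in diag_order) elim_good_imp_good:
  assumes "pperm n D" "elim_good D"
  shows "good D"
proof -
  obtain f T where f: "f \<in> idl (gens D)" "f \<noteq> 0" "f \<in> pols T" "T \<subseteq> cells D" "\<not> bad D T"
    using assms(2) unfolding elim_good_def by blast
  have "f \<in> pols (cells D)" "f \<in> pols box"
    using f(3) pols_mono[OF f(4)] pols_mono[OF cells_subset[OF assms(1)]] by blast+
  moreover from this have "keys (lm f) \<subseteq> T"
    using lm(1)[OF f(2)] f(3) by (auto simp: pols_def)
  ultimately show ?thesis
    unfolding good_def using f bad_mono by blast
qed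

lemma at_pt_upd:
  assumes "p \<in> pols (V - {v})"
  shows "at_pt (X(v := t)) p = at_pt X p"
  using assms by (induction rule: pols_induct) auto

lemma linear_split:
  assumes "p \<in> pols V" "\<And>m. m \<in> keys p \<Longrightarrow> lookup m v \<le> 1"
  obtains \<alpha> \<beta> where "\<alpha> \<in> pols (V - {v})" "\<beta> \<in> pols (V - {v})" "p = \<alpha> * var v + \<beta>"
proof -
  define K0 K1 where "K0 = {m \<in> keys p. lookup m v = 0}" and "K1 = {m \<in> keys p. lookup m v = 1}"
  define \<alpha> where "\<alpha> = (\<Sum>m\<in>K1. Poly_Mapping.single (m - Poly_Mapping.single v 1) (lookup p m))"
  define \<beta> where "\<beta> = (\<Sum>m\<in>K0. Poly_Mapping.single m (lookup p m))"
  have K: "keys m \<subseteq> V" if "m \<in> keys p" for m using that assms(1) by (auto simp: pols_def)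
  have beta: "\<beta> \<in> pols (V - {v})"
    unfolding \<beta>_def using K by (intro pols_sum pols_single) (auto simp: K0_def in_keys_iff)
  have alpha: "\<alpha> \<in> pols (V - {v})"
    unfolding \<alpha>_def
  proof (intro pols_sum pols_single subsetI)
    fix m c assume "m \<in> K1" "c \<in> keys (m - Poly_Mapping.single v 1)"
    then have "c \<in> keys m" "c \<noteq> v" "m \<in> keys p"
      by (auto simp: K1_def in_keys_iff lookup_minus lookup_single when_def split: if_splits)
    then show "c \<in> V - {v}" using K by blast
  qed
  have *: "Poly_Mapping.single (m - Poly_Mapping.single v 1) a * var v = Poly_Mapping.single m a" if "m \<in> K1" for m a
  proof -
    have "m - Poly_Mapping.single v 1 + Poly_Mapping.single v 1 = m"
      by (rule poly_mapping_eqI) (use that in \<open>auto simp: K1_def lookup_add lookup_minus lookup_single when_def\<close>)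
    then show ?thesis by (simp add: var_def mult_single)
  qed
  have "\<alpha> * var v = (\<Sum>m\<in>K1. Poly_Mapping.single m (lookup p m))"
    unfolding \<alpha>_def sum_distrib_right by (rule sum.cong[OF refl]) (rule *)
  moreover have "keys p = K1 \<union> K0"
    using assms(2) by (force simp: K0_def K1_def le_Suc_eq)
  moreover have "K1 \<inter> K0 = {}" "finite K0" "finite K1"
    by (auto simp: K0_def K1_def)
  ultimately have "p = \<alpha> * var v + \<beta>"
    by (subst poly_expand[of p]) (simp add: sum.union_disjoint \<beta>_def)
  with alpha beta show thesis by (rule that)
qed

text \<open>Modulo the divisor, \<open>\<alpha> * var v\<close> may be replaced by
  \<open>- \<beta>\<close>; the power of \<open>\<alpha>\<close> clears the denominators.\<close>

lemma pseudo_division: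
  assumes "p \<in> pols V" "\<alpha> \<in> pols (V - {v})" "\<beta> \<in> pols (V - {v})"
  shows "\<exists>N. \<exists>p'\<in>pols (V - {v}). \<exists>q. \<alpha> ^ N * p = p' + q * (\<alpha> * var v + \<beta>)"
  using assms(1)
proof (induction rule: pols_induct)
  case (cst a)
  then show ?case by (intro exI[of _ 0] bexI[of _ "cst a"]) (auto intro!: exI[of _ 0])
next
  case (var c)
  show ?case
  proof (cases "c = v")
    case True
    then show ?thesis
      by (intro exI[of _ 1] bexI[of _ "- \<beta>"]) (auto intro!: exI[of _ 1] pols_uminus assms(3))
  next
    case False
    then show ?thesis
      using var by (intro exI[of _ 0] bexI[of _ "var c"]) (auto intro!: exI[of _ 0])
  qed
next
  case (add p q)
  then obtain N p' r N' q' r' where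
    "p' \<in> pols (V - {v})" "\<alpha> ^ N * p = p' + r * (\<alpha> * var v + \<beta>)"
    "q' \<in> pols (V - {v})" "\<alpha> ^ N' * q = q' + r' * (\<alpha> * var v + \<beta>)" by blast
  moreover have "\<alpha> ^ (N + N') * (p + q) = \<alpha> ^ N' * (\<alpha> ^ N * p) + \<alpha> ^ N * (\<alpha> ^ N' * q)"
    by (simp add: power_add algebra_simps)
  ultimately show ?case
    by (intro exI[of _ "N + N'"] bexI[of _ "\<alpha> ^ N' * p' + \<alpha> ^ N * q'"] exI[of _ "\<alpha> ^ N' * r + \<alpha> ^ N * r'"])
      (auto intro!: pols_add pols_mult pols_power assms simp: algebra_simps)
next
  case (mult p q)
  then obtain N p' r N' q' r' where
    "p' \<in> pols (V - {v})" "\<alpha> ^ N * p = p' + r * (\<alpha> * var v + \<beta>)"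
    "q' \<in> pols (V - {v})" "\<alpha> ^ N' * q = q' + r' * (\<alpha> * var v + \<beta>)" by blast
  moreover have "\<alpha> ^ (N + N') * (p * q) = (\<alpha> ^ N * p) * (\<alpha> ^ N' * q)"
    by (simp add: power_add algebra_simps)
  ultimately show ?case
    by (intro exI[of _ "N + N'"] bexI[of _ "p' * q'"] exI[of _ "p' * r' + r * (q' + r' * (\<alpha> * var v + \<beta>))"])
      (auto intro!: pols_mult simp: algebra_simps)
qed

text \<open>The point \<open>X\<close> certifies that the result of the elimination is not zero.\<close>

lemma eliminate:
  assumes p: "p \<in> pols V" "p \<in> idl G" "at_pt X p \<noteq> 0"
    and h: "h \<in> pols V" "h \<in> idl G" "\<And>m. m \<in> keys h \<Longrightarrow> lookup m v \<le> 1"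
    and X: "at_pt X h = 0" "at_pt (X(v := t)) h \<noteq> 0"
  obtains p' where "p' \<in> pols (V - {v})" "p' \<in> idl G" "at_pt X p' \<noteq> 0"
proof -
  obtain \<alpha> \<beta> where ab: "\<alpha> \<in> pols (V - {v})" "\<beta> \<in> pols (V - {v})" "h = \<alpha> * var v + \<beta>"
    using linear_split[OF h(1,3)] by metis
  obtain N p' q where p': "p' \<in> pols (V - {v})" "\<alpha> ^ N * p = p' + q * h"
    using pseudo_division[OF p(1) ab(1,2)] unfolding ab(3) by blast
  \<comment> \<open>If the coefficient of \<open>v\<close> vanished at \<open>X\<close>, changing
    the value of \<open>v\<close> could not change that of \<open>h\<close>.\<close>
  have "at_pt X \<alpha> \<noteq> 0"
  proof
    assume "at_pt X \<alpha> = 0"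
    then have "at_pt (X(v := t)) h = at_pt X h"
      by (simp add: ab(3) at_pt_upd[OF ab(1)] at_pt_upd[OF ab(2)])
    with X show False by simp
  qed
  moreover have p'_eq: "p' = \<alpha> ^ N * p - q * h"
    using p'(2) by simp
  ultimately have "at_pt X p' \<noteq> 0"
    using p(3) X(1) by simp
  moreover have "p' \<in> idl G"
    unfolding p'_eq by (intro idl_diff idl_mult p h)
  ultimately show ?thesis using p'(1) that by blast
qed

definition minor_index :: "cell set \<Rightarrow> nat set \<Rightarrow> nat set \<Rightarrow> bool" where
  "minor_index D A B \<longleftrightarrow> (\<exists>i j. A \<subseteq> fst ` D \<inter> {..i} \<and> B \<subseteq> snd ` D \<inter> {..j} \<and>
     card A = Suc (rk D i j) \<and> card B = Suc (rk D i j))"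

lemma minor_index_finite:
  assumes "minor_index D A B"
  shows "finite A" "finite B" "card A = card B"
  using assms unfolding minor_index_def by (metis card.infinite nat.distinct(1))+

lemma minor_index_subset: "minor_index D A B \<Longrightarrow> A \<times> B \<subseteq> cells D"
  unfolding minor_index_def by blast

definition zero_cells :: "cell set \<Rightarrow> cell set" where
  "zero_cells D = {x. rk D (fst x) (snd x) = 0}"

text \<open>The variables set to 0 are themselves generators, being 1-minors in boxes of rank 0, so
  the minor changes only by an element of the ideal.\<close>

lemma zero_minor_in_idl:
  assumes "minor_index D A B"
  shows "mn (zvar (zero_cells D)) A B \<in> idl (gens D)"
proof -
  note fin = minor_index_finite[OF assms]
  have "mn var A B \<in> gens D"
    using assms unfolding minor_index_def gens_def by blast
  moreover have "mn var A B - mn (zvar (zero_cells D)) A B \<in> idl (gens D)"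
  proof (rule idl_mn_cong[OF fin])
    fix x assume "x \<in> A \<times> B"
    then have "x \<in> cells D" using minor_index_subset[OF assms] by blast
    then show "var x - zvar (zero_cells D) x \<in> idl (gens D)"
      using var_in_gens[of "fst x" "snd x" D] by (auto simp: zvar_def zero_cells_def idl.zero intro: idl_gen)
  qed
  ultimately have "mn var A B - (mn var A B - mn (zvar (zero_cells D)) A B) \<in> idl (gens D)"
    using idl_diff idl_gen by blast
  then show ?thesis by simp
qed

lemma zero_minor_props:
  fixes N :: "cell set"
  assumes "finite A" "finite B" "card A = card B"
  defines "M \<equiv> mn (zvar N) A B"
  shows "M \<in> pols (A \<times> B - N)" "m \<in> keys M \<Longrightarrow> lookup m v \<le> 1"
    and "E \<inter> N = {} \<Longrightarrow> at_pt (ind E) M = mn (ind E) A B"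
proof -
  show "M \<in> pols (A \<times> B - N)"
    unfolding M_def by (rule mn_in_pols[OF assms(1-3)]) (auto simp: zvar_def)
  show "lookup m v \<le> 1" if "m \<in> keys M"
    using that keys_mn_zvar[OF assms(1-3), of N] matchings_finite[OF assms(1)] by (auto simp: M_def lookup_mon)
  show "at_pt (ind E) M = mn (ind E) A B" if "E \<inter> N = {}"
  proof -
    have "at_pt (ind E) M = mn (\<lambda>x. at_pt (ind E) (zvar N x)) A B"
      unfolding M_def by (rule at_pt.ev_mn[OF assms(1-3)])
    also have "(\<lambda>x. at_pt (ind E) (zvar N x)) = ind E"
    proof
      fix x show "at_pt (ind E) (zvar N x) = ind E x"
        using that by (cases "x \<in> N") (auto simp: zvar_def ind_def)
    qed
    finally show ?thesis .
  qed
qed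

lemma ind_upd: "v \<notin> E \<Longrightarrow> (ind E)(v := 1) = ind (insert v E)"
  by (auto simp: ind_def)

text \<open>The second minor, linear in \<open>a\<close>, eliminates \<open>a\<close> from the
  first. The conditions at the 0-1 point \<open>E\<close> ensure that its coefficient of
  \<open>a\<close> does not vanish there, so the result does not vanish either.\<close>

lemma elim_good1:
  assumes idx: "minor_index D A1 B1" "minor_index D A2 B2"
    and E: "E \<inter> zero_cells D = {}" "a \<notin> zero_cells D" "a \<notin> E"
    and M: "mn (ind E) A1 B1 \<noteq> 0" "mn (ind E) A2 B2 = 0" "mn (ind (insert a E)) A2 B2 \<noteq> 0"
    and T: "\<not> bad D ((A1 \<times> B1 \<union> A2 \<times> B2) - zero_cells D - {a})"
  shows "elim_good D"
proof -
  let ?N = "zero_cells D"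
  let ?V = "(A1 \<times> B1 \<union> A2 \<times> B2) - ?N"
  let ?M1 = "mn (zvar ?N) A1 B1" and ?M2 = "mn (zvar ?N) A2 B2"
  note f1 = minor_index_finite[OF idx(1)] and f2 = minor_index_finite[OF idx(2)]
  have V: "?M1 \<in> pols ?V" "?M2 \<in> pols ?V"
    using zero_minor_props(1)[OF f1, of ?N] zero_minor_props(1)[OF f2, of ?N]
      pols_mono[of "A1 \<times> B1 - ?N" ?V] pols_mono[of "A2 \<times> B2 - ?N" ?V] by blast+
  have at: "at_pt (ind E) ?M1 \<noteq> 0" "at_pt (ind E) ?M2 = 0" "at_pt ((ind E)(a := 1)) ?M2 \<noteq> 0"
    using M E zero_minor_props(3)[OF f1 E(1)] zero_minor_props(3)[OF f2 E(1)]
      zero_minor_props(3)[OF f2, of "insert a E" ?N] by (simp_all add: ind_upd)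
  obtain p where "p \<in> pols (?V - {a})" "p \<in> idl (gens D)" "at_pt (ind E) p \<noteq> 0"
    using eliminate[OF V(1) zero_minor_in_idl[OF idx(1)] at(1) V(2) zero_minor_in_idl[OF idx(2)]
        zero_minor_props(2)[OF f2] at(2,3)] by metis
  moreover from this have "p \<noteq> 0" by auto
  moreover have "?V - {a} \<subseteq> cells D"
    using minor_index_subset idx by blast
  ultimately show ?thesis
    unfolding elim_good_def using T by blast
qed

text \<open>The third minor is free of \<open>a\<close>, so eliminating \<open>c\<close> with it
  does not bring \<open>a\<close> back.\<close>

lemma elim_good2:
  assumes idx: "minor_index D A1 B1" "minor_index D A2 B2" "minor_index D A3 B3"
    and E: "E \<inter> zero_cells D = {}" "a \<notin> zero_cells D" "a \<notin> E" "c \<notin> zero_cells D" "c \<notin> E"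
    and ac: "a \<notin> A3 \<times> B3"
    and M: "mn (ind E) A1 B1 \<noteq> 0" "mn (ind E) A2 B2 = 0" "mn (ind (insert a E)) A2 B2 \<noteq> 0"
      "mn (ind E) A3 B3 = 0" "mn (ind (insert c E)) A3 B3 \<noteq> 0"
    and T: "\<not> bad D ((A1 \<times> B1 \<union> A2 \<times> B2 \<union> A3 \<times> B3) - zero_cells D - {a, c})"
  shows "elim_good D"
proof -
  let ?N = "zero_cells D"
  let ?V = "(A1 \<times> B1 \<union> A2 \<times> B2 \<union> A3 \<times> B3) - ?N"
  let ?M1 = "mn (zvar ?N) A1 B1" and ?M2 = "mn (zvar ?N) A2 B2" and ?M3 = "mn (zvar ?N) A3 B3"
  note f1 = minor_index_finite[OF idx(1)] and f2 = minor_index_finite[OF idx(2)] and f3 = minor_index_finite[OF idx(3)]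
  have V: "?M1 \<in> pols ?V" "?M2 \<in> pols ?V" "?M3 \<in> pols (?V - {a})"
    using zero_minor_props(1)[OF f1, of ?N] zero_minor_props(1)[OF f2, of ?N] zero_minor_props(1)[OF f3, of ?N]
      pols_mono[of "A1 \<times> B1 - ?N" ?V] pols_mono[of "A2 \<times> B2 - ?N" ?V] pols_mono[of "A3 \<times> B3 - ?N" "?V - {a}"] ac
    by blast+
  have at: "at_pt (ind E) ?M1 \<noteq> 0" "at_pt (ind E) ?M2 = 0" "at_pt ((ind E)(a := 1)) ?M2 \<noteq> 0"
    "at_pt (ind E) ?M3 = 0" "at_pt ((ind E)(c := 1)) ?M3 \<noteq> 0"
    using M E zero_minor_props(3)[OF f1 E(1)] zero_minor_props(3)[OF f2 E(1)] zero_minor_props(3)[OF f3 E(1)]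
      zero_minor_props(3)[OF f2, of "insert a E" ?N] zero_minor_props(3)[OF f3, of "insert c E" ?N]
    by (simp_all add: ind_upd)
  obtain p where p: "p \<in> pols (?V - {a})" "p \<in> idl (gens D)" "at_pt (ind E) p \<noteq> 0"
    using eliminate[OF V(1) zero_minor_in_idl[OF idx(1)] at(1) V(2) zero_minor_in_idl[OF idx(2)]
        zero_minor_props(2)[OF f2] at(2,3)] by metis
  obtain q where q: "q \<in> pols (?V - {a} - {c})" "q \<in> idl (gens D)" "at_pt (ind E) q \<noteq> 0"
    using eliminate[OF p V(3) zero_minor_in_idl[OF idx(3)] zero_minor_props(2)[OF f3] at(4,5)] by metis
  moreover from this have "q \<noteq> 0" by auto
  moreover have "?V - {a} - {c} \<subseteq> cells D"
    using minor_index_subset idx by blast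
  moreover have "?V - {a} - {c} = ?V - {a, c}" by blast
  ultimately show ?thesis
    unfolding elim_good_def using T by metis
qed

subsection \<open>Transposition\<close>

abbreviation tr :: "cell set \<Rightarrow> cell set" where
  "tr D \<equiv> prod.swap ` D"

lemma mem_tr [simp]: "(i, j) \<in> tr D \<longleftrightarrow> (j, i) \<in> D"
  by force

lemma tr_tr [simp]: "tr (tr D) = D"
  by (simp add: image_image)

lemma fst_tr [simp]: "fst ` tr D = snd ` D" and snd_tr [simp]: "snd ` tr D = fst ` D"
  by (simp_all add: image_image)

lemma rk_tr: "rk (tr D) j i = rk D i j"
proof -
  have "{x \<in> tr D. fst x \<le> j \<and> snd x \<le> i} = tr {x \<in> D. fst x \<le> i \<and> snd x \<le> j}" by auto
  then show ?thesis by (simp add: rk_def card_image)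
qed

lemma pperm_tr: "pperm n D \<Longrightarrow> pperm n (tr D)"
  unfolding pperm_def by (auto simp: inj_on_def)

lemma bad_tr:
  assumes "bad (tr D) (tr U)"
  shows "bad D U"
proof -
  obtain C i j where C: "C \<subseteq> tr U" "finite C" "C \<subseteq> {..i} \<times> {..j}" "chain (tr D) C" "rk (tr D) i j < card C"
    using assms unfolding bad_def by blast
  have "chain D (tr C)"
    unfolding chain_def
  proof (intro conjI ballI impI)
    have inj: "inj_on fst C" "inj_on snd C" using C(4) by (auto simp: chain_def)
    then show "inj_on fst (tr C)" "inj_on snd (tr C)" by (auto simp: inj_on_def)
    fix x y assume "x \<in> tr C" "y \<in> tr C" "fst x < fst y" "snd y < snd x"
    then have "prod.swap y \<in> C" "prod.swap x \<in> C" "fst (prod.swap y) < fst (prod.swap x)" "snd (prod.swap x) < snd (prod.swap y)"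
      by auto
    then have "rk (tr D) (fst (prod.swap y)) (snd (prod.swap x)) = 0"
      using C(4) unfolding chain_def by blast
    then show "rk D (fst x) (snd y) = 0" by (simp add: rk_tr)
  qed
  moreover have "tr C \<subseteq> U" "finite (tr C)" "tr C \<subseteq> {..j} \<times> {..i}" "rk D j i < card (tr C)"
    using C rk_tr[of D i j] by (auto simp: card_image)
  ultimately show ?thesis unfolding bad_def by blast
qed

text \<open>\<open>elim_good\<close> mentions no term order, so exchanging rows and columns carries
  it over directly.\<close>

lemma elim_good_tr:
  assumes "elim_good (tr D)"
  shows "elim_good D"
proof -
  obtain f T where f: "f \<in> idl (gens (tr D))" "f \<noteq> 0" "f \<in> pols T" "T \<subseteq> cells (tr D)" "\<not> bad (tr D) T"
    using assms unfolding elim_good_def by blast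
  define s where "s x = var (prod.swap x)" for x
  define h where "h = subst s f"
  have "1 * subst s f \<in> idl (gens D)"
  proof (rule idl_subst[OF f(1)])
    fix g assume "g \<in> gens (tr D)"
    then obtain A B i j where g: "g = mn var A B" "A \<subseteq> snd ` D \<inter> {..i}" "B \<subseteq> fst ` D \<inter> {..j}"
      "card A = Suc (rk D j i)" "card B = Suc (rk D j i)"
      unfolding gens_def fst_tr snd_tr rk_tr by blast
    then have fin: "finite A" "finite B" "card A = card B" using card.infinite by fastforce+
    have "subst s g = mn (var \<circ> prod.swap) A B"
      unfolding g(1) by (simp add: subst.ev_mn[OF fin] s_def comp_def)
    also have "\<dots> = mn var B A"
      by (rule mn_transpose) (use fin in simp)
    finally show "1 * subst s g \<in> idl (gens D)"
      using gensI[OF g(3,2,5,4)] by (simp add: idl_gen)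
  qed
  moreover have "h \<in> pols (tr T)"
    unfolding h_def by (rule subst_in_pols[OF f(3)]) (auto simp: s_def)
  moreover have "h \<noteq> 0"
  proof
    assume "h = 0"
    then have "subst s h = 0" by simp
    moreover have "subst s h = f"
      unfolding h_def subst_subst by (rule subst_id[OF f(3)]) (simp add: s_def)
    ultimately show False using f(2) by simp
  qed
  moreover have "tr T \<subseteq> cells D" using f(4) by auto
  moreover have "\<not> bad D (tr T)"
    using f(5) bad_tr[of "tr D" T] by auto
  ultimately show ?thesis unfolding elim_good_def h_def by auto
qed

subsection \<open>Dot sets with two left-to-right minima\<close>

text \<open>The dots \<open>(r, g2)\<close> and \<open>(al, g1)\<close> are the initial 2 and 1 of
  the patterns. Every dot lies south-east of one of them, which makes the region of rank 0 an
  explicit staircase (\<open>rk0_iff\<close>).\<close>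

locale two_min =
  fixes n :: nat and D :: "cell set" and r g2 al g1 :: nat
  assumes D: "pperm n D"
    and two: "(r, g2) \<in> D" and one: "(al, g1) \<in> D"
    and r_al: "r < al" and g12: "g1 < g2"
    and se: "\<And>z. z \<in> D \<Longrightarrow> (r \<le> fst z \<and> g2 \<le> snd z) \<or> (al \<le> fst z \<and> g1 \<le> snd z)"
begin

lemma fD: "finite D"
  using D by (rule pperm_finite)

lemma row_unique: "x \<in> D \<Longrightarrow> y \<in> D \<Longrightarrow> fst x = fst y \<Longrightarrow> x = y"
  using D unfolding pperm_def by (auto dest: inj_onD)

lemma col_unique: "x \<in> D \<Longrightarrow> y \<in> D \<Longrightarrow> snd x = snd y \<Longrightarrow> x = y"
  using D unfolding pperm_def by (auto dest: inj_onD)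

lemma rk0_iff: "rk D k l = 0 \<longleftrightarrow> \<not> (r \<le> k \<and> g2 \<le> l) \<and> \<not> (al \<le> k \<and> g1 \<le> l)"
proof -
  have "rk D k l > 0 \<longleftrightarrow> (r \<le> k \<and> g2 \<le> l) \<or> (al \<le> k \<and> g1 \<le> l)"
    unfolding rk_pos_iff[OF fD]
  proof
    assume "\<exists>x\<in>D. fst x \<le> k \<and> snd x \<le> l"
    then show "(r \<le> k \<and> g2 \<le> l) \<or> (al \<le> k \<and> g1 \<le> l)"
      using se le_trans by blast
  next
    assume "(r \<le> k \<and> g2 \<le> l) \<or> (al \<le> k \<and> g1 \<le> l)"
    then show "\<exists>x\<in>D. fst x \<le> k \<and> snd x \<le> l"
      using two one by (metis fst_conv snd_conv)
  qed
  then show ?thesis by auto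
qed

lemma chain_inversion:
  assumes "chain D C" "(k, l) \<in> C" "(k', l') \<in> C" "k < k'" "l' < l"
  shows "\<not> (r \<le> k \<and> g2 \<le> l')" "\<not> (al \<le> k \<and> g1 \<le> l')"
proof -
  have "rk D (fst (k, l)) (snd (k', l')) = 0"
    using assms unfolding chain_def by (metis fst_conv snd_conv)
  then show "\<not> (r \<le> k \<and> g2 \<le> l')" "\<not> (al \<le> k \<and> g1 \<le> l')"
    by (auto simp: rk0_iff)
qed

lemma chain_rows: "chain D C \<Longrightarrow> (k, l) \<in> C \<Longrightarrow> (k, l') \<in> C \<Longrightarrow> l = l'"
  unfolding chain_def inj_on_def by fastforce

lemma chain_cols: "chain D C \<Longrightarrow> (k, l) \<in> C \<Longrightarrow> (k', l) \<in> C \<Longrightarrow> k = k'"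
  unfolding chain_def inj_on_def by fastforce

text \<open>The dots \<open>(r, g2)\<close>, \<open>(al, g1)\<close> and \<open>Q\<close> bound the rank from below, so a bad chain has to use
  all available columns or all available rows.\<close>

lemma bad_cases:
  assumes Q: "Q \<subseteq> D" "\<And>z. z \<in> Q \<Longrightarrow> fst z \<noteq> al \<and> r < fst z \<and> g2 < snd z \<and> fst z < p \<and> snd z < y \<and> snd z \<noteq> q"
    and Qc: "\<And>z z'. z \<in> Q \<Longrightarrow> z' \<in> Q \<Longrightarrow> fst z < fst z' \<Longrightarrow> snd z < snd z'"
    and pq: "g2 < q" "q < y" "al < p"
    and T: "\<And>k l. (k, l) \<in> T \<Longrightarrow> (k \<in> {r, al} \<union> fst ` Q \<or> p \<le> k) \<and> l \<in> {g1, g2, q, y} \<union> snd ` Q \<and>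
      (g2 \<le> l \<or> al \<le> k)"
    and C: "C \<subseteq> T" "finite C" "C \<subseteq> {..i} \<times> {..j}" "chain D C" "rk D i j < card C"
  shows "({g1, g2, q} \<union> snd ` {z \<in> Q. snd z < q} \<subseteq> snd ` C) \<or> (i < al \<and> {g2, q} \<subseteq> snd ` C) \<or>
    (p \<le> i \<and> y \<le> j \<and> card Q + 3 \<le> card C)"
proof -
  have finQ: "finite Q" using Q(1) fD finite_subset by blast
  have inj: "inj_on fst C" "inj_on snd C" using C(4) by (auto simp: chain_def)
  have Ccard: "card (fst ` C) = card C" "card (snd ` C) = card C"
    using inj by (simp_all add: card_image)
  define S where "S = {z \<in> Q. fst z \<le> i}"
  define S' where "S' = {z \<in> Q. snd z \<le> j}"
  have finS: "finite S" "finite S'" using finQ by (auto simp: S_def S'_def)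
  define e2 where "e2 = (if g2 \<le> j then {(r, g2)} else {})"
  define e1 where "e1 = (if al \<le> i then {(al, g1)} else {})"
  have "C \<noteq> {}" using C(5) by auto
  then obtain k0 l0 where "(k0, l0) \<in> C" by auto
  then have k0: "r \<le> k0" "g1 \<le> l0" "k0 \<le> i" "l0 \<le> j"
    using T[of k0 l0] C(1,3) Q(2) r_al g12 pq by (fastforce simp: image_iff)+
  then have ij: "r \<le> i" "g1 \<le> j" by auto
  have rkge: "card e2 + card e1 + card (S \<inter> S') \<le> rk D i j"
  proof -
    have sub: "e2 \<union> e1 \<union> (S \<inter> S') \<subseteq> {z \<in> D. fst z \<le> i \<and> snd z \<le> j}"
      using two one Q(1) ij by (auto simp: e2_def e1_def S_def S'_def)
    have "(r, g2) \<notin> S" "(al, g1) \<notin> S" using Q(2)[of "(r, g2)"] Q(2)[of "(al, g1)"] by (auto simp: S_def)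
    then have "card (e2 \<union> e1 \<union> (S \<inter> S')) = card e2 + card e1 + card (S \<inter> S')"
      using finS r_al by (subst card_Un_disjoint) (auto simp: e2_def e1_def)
    then show ?thesis
      using card_mono[OF _ sub] fD by (simp add: rk_def)
  qed
  \<comment> \<open>\<open>Q\<close> is increasing, so its dots in the first \<open>i\<close> rows
    and those in the first \<open>j\<close> columns are nested.\<close>
  have cases: "S \<subseteq> S' \<or> S' \<subseteq> S"
  proof (rule ccontr)
    assume "\<not> (S \<subseteq> S' \<or> S' \<subseteq> S)"
    then obtain z z' where z: "z \<in> S" "z \<notin> S'" "z' \<in> S'" "z' \<notin> S" by blast
    then have "fst z < fst z'" "z \<in> Q" "z' \<in> Q" "snd z' < snd z" by (auto simp: S_def S'_def)
    then show False using Qc[of z z'] by simp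
  qed
  have Ccell: "k \<le> i \<and> l \<le> j \<and> (k \<in> {r, al} \<union> fst ` Q \<or> p \<le> k) \<and> l \<in> {g1, g2, q, y} \<union> snd ` Q \<and> (g2 \<le> l \<or> al \<le> k)"
    if "(k, l) \<in> C" for k l
    using T[of k l] C(1,3) that by auto
  have colQ: "l > g2" if "l \<in> snd ` Q" for l using that Q(2) by auto
  show ?thesis
  proof (cases "S \<subseteq> S' \<and> i < p")
    case True
    then have SS: "S \<inter> S' = S" by blast
    \<comment> \<open>Here rows are scarce: only \<open>r\<close>, possibly \<open>al\<close>, and
      the rows of \<open>S\<close>. To exceed the rank, the box must have \<open>j < g2\<close>;
      then only column \<open>g1\<close> is left, giving at most one cell against a rank of at least
      1.\<close>
    have "fst ` C \<subseteq> {r} \<union> fst ` e1 \<union> fst ` S"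
    proof
      fix k assume "k \<in> fst ` C"
      then obtain l where "(k, l) \<in> C" by auto
      from Ccell[OF this] True show "k \<in> {r} \<union> fst ` e1 \<union> fst ` S"
        by (auto simp: e1_def S_def)
    qed
    then have "card C \<le> card ({r} \<union> fst ` e1 \<union> fst ` S)"
      using finS by (subst Ccard(1)[symmetric]) (intro card_mono, auto simp: e1_def)
    also have "\<dots> \<le> 1 + card e1 + card S"
      by (intro order.trans[OF card_Un_le] add_mono card_image_le) (auto simp: finS e1_def)
    finally have "card e2 = 0" using rkge C(5) SS by simp
    then have j: "j < g2" by (simp add: e2_def split: if_splits)
    have "S' = {}" using Q(2) j by (force simp: S'_def)
    then have "S = {}" using True by simp
    have "snd ` C \<subseteq> {g1}"
      using Ccell j pq colQ by fastforce
    then have "card C \<le> 1"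
      using card_mono[of "{g1}" "snd ` C"] Ccard(2) by simp
    moreover have "al \<le> i" using Ccell[OF \<open>(k0, l0) \<in> C\<close>] j by auto
    then have "card e1 = 1" by (simp add: e1_def)
    ultimately have False using rkge C(5) by simp
    then show ?thesis ..
  next
    case False
    have "S' \<subseteq> S"
    proof (cases "i < p")
      case False
      then have "S = Q" using Q(2) by (force simp: S_def)
      then show ?thesis by (auto simp: S'_def)
    qed (use cases \<open>\<not> (S \<subseteq> S' \<and> i < p)\<close> in blast)
    then have SS: "S \<inter> S' = S'" by blast
    have g2j: "card e2 = (if g2 \<le> j then 1 else 0)" by (simp add: e2_def)
    show ?thesis
    proof (cases "y \<le> j")
      case True
      then have "S' = Q" using Q(2) by (force simp: S'_def)
      then have "S = Q" using \<open>S' \<subseteq> S\<close> by (auto simp: S_def)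
      then have "p \<le> i" using False \<open>S' = Q\<close> by auto
      then have "card e1 = 1" "card e2 = 1" using pq True by (auto simp: e1_def e2_def)
      then have "card Q + 3 \<le> card C" using rkge C(5) SS \<open>S' = Q\<close> by simp
      then show ?thesis using True \<open>p \<le> i\<close> by blast
    next
      case False
      \<comment> \<open>Left of column \<open>y\<close> it is columns that are scarce: at most
        \<open>g1\<close> and \<open>W\<close>, one more than the known part of the rank. So all of
        them are used, \<open>q\<close> included. Above row \<open>al\<close> both column
        \<open>g1\<close> and the dot \<open>(al, g1)\<close> drop out, which gives the second
        alternative.\<close>
      define W where "W = snd ` e2 \<union> snd ` S' \<union> (if q \<le> j then {q} else {})"
      have finW: "finite W" using finS by (simp add: W_def e2_def)
      have cols: "l = g1 \<or> l \<in> W" if "(k, l) \<in> C" for k l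
        using Ccell[OF that] False by (auto simp: W_def e2_def S'_def)
      have cardW: "card W \<le> card e2 + card S' + (if q \<le> j then 1 else 0)"
        unfolding W_def by (intro order.trans[OF card_Un_le] add_mono card_image_le) (auto simp: finS e2_def)
      have full: "{g2, q} \<union> snd ` {z \<in> Q. snd z < q} \<subseteq> W" if "q \<le> j"
        using that pq by (auto simp: W_def e2_def S'_def)
      show ?thesis
      proof (cases "al \<le> i")
        case True
        then have "card e1 = 1" by (simp add: e1_def)
        then have big: "card e2 + 2 + card S' \<le> card C" using rkge C(5) SS by simp
        have sub: "snd ` C \<subseteq> insert g1 W" using cols by fastforce
        have "card (insert g1 W) \<le> card C"
          using big cardW card_insert_le_m1[of "Suc (card W)" W g1] finW by (auto simp: card_insert_if split: if_splits)
        then have eq: "snd ` C = insert g1 W"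
          using card_seteq[OF _ sub] finW Ccard(2) by simp
        have "q \<le> j"
        proof (rule ccontr)
          assume "\<not> q \<le> j"
          then have "card (insert g1 W) \<le> 1 + card e2 + card S'"
            using cardW finW by (simp add: card_insert_if)
          then show False using big eq Ccard(2) by simp
        qed
        then show ?thesis using full eq by auto
      next
        case False
        then have e1: "e1 = {}" and i: "i < al" by (simp_all add: e1_def)
        then have big: "card e2 + 1 + card S' \<le> card C" using rkge C(5) SS by simp
        have sub: "snd ` C \<subseteq> W"
        proof
          fix l assume "l \<in> snd ` C"
          then obtain k where k: "(k, l) \<in> C" by auto
          have "l \<noteq> g1" using Ccell[OF k] i g12 by auto
          then show "l \<in> W" using cols[OF k] by simp
        qed
        have "card W \<le> card C" using big cardW by (auto split: if_splits)
        then have eq: "snd ` C = W"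
          using card_seteq[OF finW sub] Ccard(2) by simp
        have "q \<le> j"
        proof (rule ccontr)
          assume "\<not> q \<le> j"
          then show False using big cardW eq Ccard(2) by simp
        qed
        then show ?thesis using full eq i by auto
      qed
    qed
  qed
qed

end

section \<open>Forced matchings and the choice of minors\<close>

lemma matchings_rowE:
  assumes "C \<in> matchings A B" "k \<in> A"
  obtains l where "(k, l) \<in> C" "l \<in> B"
proof -
  have "k \<in> fst ` C" using assms by (simp add: matchings_def bij_betw_def)
  then obtain l where "(k, l) \<in> C" by auto
  moreover from this have "l \<in> B" using matchings_subset[OF assms(1)] by blast
  ultimately show thesis by (rule that)
qed

lemma matchings_col_unique: "C \<in> matchings A B \<Longrightarrow> (k, l) \<in> C \<Longrightarrow> (k', l) \<in> C \<Longrightarrow> k = k'"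
  using inj_onD[of snd C "(k, l)" "(k', l)"] by (simp add: matchings_def bij_betw_def)

lemma card_le_2: "card {a, b} \<le> 2" and card_le_3: "card {a, b, c} \<le> 3" and card_le_4: "card {a, b, c, d} \<le> 4"
  by (simp_all add: card_insert_if)

lemma matchingsI:
  assumes "finite C" "fst ` C = A" "snd ` C = B" "card C \<le> card A" "card A = card B"
  shows "C \<in> matchings A B"
proof -
  have "card (fst ` C) = card C" "card (snd ` C) = card C"
    using card_image_le[OF assms(1), of fst] card_image_le[OF assms(1), of snd] assms by simp_all
  then have "inj_on fst C" "inj_on snd C"
    using eq_card_imp_inj_on[OF assms(1)] by blast+
  then show ?thesis using assms(2,3) by (simp add: matchings_def bij_betw_def)
qed

lemma minor_indexI:
  assumes "A \<subseteq> fst ` D" "B \<subseteq> snd ` D" "A \<subseteq> {..i}" "B \<subseteq> {..j}"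
    and "card A = Suc (rk D i j)" "card B = Suc (rk D i j)"
  shows "minor_index D A B"
  unfolding minor_index_def by (rule exI[of _ i], rule exI[of _ j]) (use assms in simp)

text \<open>Matchings of the same rows have the same size, so one that contains \<open>C0\<close>
  equals it. In the applications the cells of \<open>C0\<close> are forced row by row.\<close>

lemma mn_ind_nonzero_forced:
  assumes "finite A" "card A = card B" "C0 \<in> matchings A B" "C0 \<subseteq> E"
    and "\<And>C. C \<in> matchings A B \<Longrightarrow> C \<subseteq> E \<Longrightarrow> C0 \<subseteq> C"
  shows "mn (ind E) A B \<noteq> 0"
proof (rule mn_ind_nonzero[OF assms(1) _ assms(2-4)])
  show "finite B"
    using assms(1,3) bij_betw_finite[of snd C0 B] matchings_finite[OF assms(1,3)] by (auto simp: matchings_def)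
  fix C assume C: "C \<in> matchings A B" "C \<subseteq> E"
  show "C = C0"
    using card_seteq[OF matchings_finite[OF assms(1) C(1)] assms(5)[OF C]] matchings_card[OF C(1)] matchings_card[OF assms(3)]
    by simp
qed

lemma mn_ind_zero_row:
  assumes "finite A" "finite B" "card A = card B" "k \<in> A" "\<And>l. l \<in> B \<Longrightarrow> (k, l) \<notin> E"
  shows "mn (ind E) A B = 0"
  by (rule mn_ind_zero[OF assms(1-3)]) (use assms(4,5) in \<open>blast elim: matchings_rowE\<close>)

text \<open>The corner \<open>(p, q)\<close> of the diagram has a diagram cell \<open>(p, y)\<close> to its right and, because of
  the dot \<open>(x, e)\<close>, one above it.\<close>

definition conf_up :: "cell set \<Rightarrow> bool" where
  "conf_up D \<longleftrightarrow> (\<exists>r g2 al g1 x e p pe r3 q r5 y.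
     {(r, g2), (al, g1), (x, e), (p, pe), (r3, q), (r5, y)} \<subseteq> D \<and>
     r < al \<and> al < p \<and> r < x \<and> x < p \<and> p < r3 \<and> p < r5 \<and>
     g1 < g2 \<and> g2 < q \<and> q < e \<and> e < y \<and> y < pe)"

definition conf_13254 :: "cell set \<Rightarrow> bool" where
  "conf_13254 D \<longleftrightarrow> (\<exists>p1 p2 p3 p4 p5 v1 v2 v3 v4 v5.
     {(p1, v1), (p2, v3), (p3, v2), (p4, v5), (p5, v4)} \<subseteq> D \<and>
     p1 < p2 \<and> p2 < p3 \<and> p3 < p4 \<and> p4 < p5 \<and> v1 < v2 \<and> v2 < v3 \<and> v3 < v4 \<and> v4 < v5)"

lemma conf_13254I:
  assumes "(p1, v1) \<in> D" "(p2, v3) \<in> D" "(p3, v2) \<in> D" "(p4, v5) \<in> D" "(p5, v4) \<in> D"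
     "p1 < p2" "p2 < p3" "p3 < p4" "p4 < p5" "v1 < v2" "v2 < v3" "v3 < v4" "v4 < v5"
  shows "conf_13254 D"
  unfolding conf_13254_def
  by (rule exI[of _ p1], rule exI[of _ p2], rule exI[of _ p3], rule exI[of _ p4], rule exI[of _ p5],
      rule exI[of _ v1], rule exI[of _ v2], rule exI[of _ v3], rule exI[of _ v4], rule exI[of _ v5])
    (use assms in simp)

lemma conf_upI:
  assumes "(r, g2) \<in> D" "(al, g1) \<in> D" "(x, e) \<in> D" "(p, pe) \<in> D" "(r3, q) \<in> D" "(r5, y) \<in> D"
     "r < al" "al < p" "r < x" "x < p" "p < r3" "p < r5" "g1 < g2" "g2 < q" "q < e" "e < y" "y < pe"
  shows "conf_up D"
  unfolding conf_up_def
  by (rule exI[of _ r], rule exI[of _ g2], rule exI[of _ al], rule exI[of _ g1], rule exI[of _ x], rule exI[of _ e],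
      rule exI[of _ p], rule exI[of _ pe], rule exI[of _ r3], rule exI[of _ q], rule exI[of _ r5], rule exI[of _ y])
    (use assms in simp)

context two_min
begin

lemma row_snd: "x \<in> D \<Longrightarrow> y \<in> D \<Longrightarrow> fst x = fst y \<Longrightarrow> snd x = snd y"
  using row_unique by metis

lemma col_fst: "x \<in> D \<Longrightarrow> y \<in> D \<Longrightarrow> snd x = snd y \<Longrightarrow> fst x = fst y"
  using col_unique by metis

context
  fixes C :: "cell set"
  assumes C: "chain D C"
    and cells: "\<forall>(k, l)\<in>C.
      r \<le> k \<and> (l = g1 \<or> g2 \<le> l) \<and> (g2 \<le> l \<or> al \<le> k) \<and> (k, l) \<noteq> (r, g2) \<and> (k, l) \<noteq> (al, g1)"
begin

lemma cell: "(k, l) \<in> C \<Longrightarrow>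
    r \<le> k \<and> (l = g1 \<or> g2 \<le> l) \<and> (g2 \<le> l \<or> al \<le> k) \<and> (k, l) \<noteq> (r, g2) \<and> (k, l) \<noteq> (al, g1)"
  by (drule bspec[OF cells]) simp

text \<open>The north-west corner of an inversion has rank 0. As no row lies above \<open>r\<close>
  and only column \<open>g1\<close> lies left of \<open>g2\<close>, the lower cell must be in column
  \<open>g1\<close> and the upper one above row \<open>al\<close>.\<close>

lemma chain_inv:
  assumes "(k, l) \<in> C" "(k', l') \<in> C" "k < k'" "l' < l"
  shows "l' = g1 \<and> k < al"
  using chain_inversion[OF C assms] cell[OF assms(1)] cell[OF assms(2)] g12 by auto

lemma chain_g1row: "(k, g1) \<in> C \<Longrightarrow> al < k"
  using cell[of k g1] g12 by auto

lemma chain_g2row: "(k, g2) \<in> C \<Longrightarrow> r < k"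
  using cell[of k g2] g12 by auto

text \<open>With \<open>(al, g1)\<close> itself excluded, a cell in column \<open>g1\<close> lies
  below row \<open>al\<close> and would form a forbidden inversion with any cell of that row.
  \<open>chain_no_r\<close> is the counterpart for \<open>(r, g2)\<close>. This is why the variables
  at the two minima have to go.\<close>

lemma chain_no_al:
  assumes "(k1, g1) \<in> C"
  shows "(al, l) \<notin> C"
proof
  assume al: "(al, l) \<in> C"
  then have "g1 < l" using cell[OF al] g12 by auto
  then show False using chain_inv[OF al assms chain_g1row[OF assms]] by simp
qed

lemma chain_no_r:
  assumes "(k2, g2) \<in> C"
  shows "(r, l) \<notin> C"
proof
  assume rl: "(r, l) \<in> C"
  then have "g2 < l" using cell[OF rl] g12 r_al by auto
  then show False using chain_inv[OF rl assms chain_g2row[OF assms]] g12 by simp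
qed

end

text \<open>Both minima are eliminated from the minor \<open>A\<close>, \<open>B\<close> at the
  corner \<open>(p, y)\<close>. The two eliminating minors live at the corner \<open>(x2, q)\<close>
  and share the columns \<open>Bq\<close>; one of them omits row \<open>al\<close>, the other row
  \<open>r\<close>.\<close>

lemma elim_good_up:
  assumes dots: "(x, e) \<in> D" "(p, pe) \<in> D" "(r3, q) \<in> D" "(r5, y) \<in> D"
    and ineq: "al < p" "r < x" "x < p" "p < r3" "p < r5" "g2 < q" "q < e" "e < y" "y < pe"
    and no: "\<not> conf_13254 D"
    and irr2: "\<not> conf_up (D - {(r, g2)})" and irr1: "\<not> conf_up (D - {(al, g1)})"
  shows "elim_good D"
proof -
  \<comment> \<open>Apart from the minima, the dots north-west of \<open>(p, y)\<close> split into
    \<open>U\<close> to the left of column \<open>q\<close> and \<open>Ds\<close> to its right. A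
    decreasing pair in their union \<open>Q\<close> would complete a 13254 (\<open>UDs\<close>,
    \<open>Qc\<close>).\<close>
  define K where "K = {z \<in> D. fst z < p \<and> snd z < y}"
  define U where "U = {z \<in> K. snd z < q} - {(r, g2), (al, g1)}"
  define Ds where "Ds = {z \<in> K. q < snd z}"
  define Q where "Q = U \<union> Ds"
  have fin: "finite K" "finite U" "finite Ds" "finite Q"
    using fD by (auto simp: K_def U_def Ds_def Q_def)
  have KD: "K \<subseteq> D" "U \<subseteq> D" "Ds \<subseteq> D" "Q \<subseteq> D" by (auto simp: K_def U_def Ds_def Q_def)
  have no_q: "snd z \<noteq> q" if "z \<in> K" for z
  proof
    assume "snd z = q"
    then have "z = (r3, q)" using col_unique[of z "(r3, q)"] that dots(3) by (auto simp: K_def)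
    then show False using that ineq by (auto simp: K_def)
  qed
  have K_eq: "K = {(r, g2), (al, g1)} \<union> Q"
  proof
    show "K \<subseteq> {(r, g2), (al, g1)} \<union> Q"
    proof
      fix z assume z: "z \<in> K"
      then have "snd z < q \<or> q < snd z" using no_q by (metis linorder_neqE_nat)
      with z show "z \<in> {(r, g2), (al, g1)} \<union> Q" by (auto simp: Q_def U_def Ds_def)
    qed
    have "(r, g2) \<in> K" "(al, g1) \<in> K" using two one ineq r_al g12 by (simp_all add: K_def)
    then show "{(r, g2), (al, g1)} \<union> Q \<subseteq> K" by (auto simp: Q_def U_def Ds_def)
  qed
  have Ds_r: "r < fst z" if "z \<in> Ds" for z
  proof -
    have z: "z \<in> D" "q < snd z" using that by (auto simp: Ds_def K_def)
    from se[OF z(1)] show ?thesis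
    proof
      assume "r \<le> fst z \<and> g2 \<le> snd z"
      moreover have "fst z \<noteq> r" using row_snd[OF z(1) two] z(2) ineq by auto
      ultimately show ?thesis by simp
    qed (use r_al in simp)
  qed
  \<comment> \<open>A dot of \<open>U\<close> that is not south-east of both minima could replace
    one of them, against irreducibility, or form a 13254 together with
    \<open>(x, e)\<close>.\<close>
  have U_se: "al < fst u \<and> g2 < snd u" if "u \<in> U" for u
  proof -
    have u: "u \<in> D" "fst u < p" "snd u < q" "u \<noteq> (r, g2)" "u \<noteq> (al, g1)" using that by (auto simp: U_def K_def)
    obtain a b where ab: "u = (a, b)" by (cases u)
    have neq: "a \<noteq> r" "a \<noteq> al" "b \<noteq> g2" "b \<noteq> g1"
      using u(4,5) row_unique[OF u(1) two] row_unique[OF u(1) one] col_unique[OF u(1) two] col_unique[OF u(1) one]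
      unfolding ab by (metis fst_conv snd_conv)+
    show ?thesis
    proof (rule ccontr)
      assume not: "\<not> (al < fst u \<and> g2 < snd u)"
      from se[OF u(1)] show False
      proof
        assume "r \<le> fst u \<and> g2 \<le> snd u"
        then have a: "r < a" "a < al" "g2 < b" using neq not by (auto simp: ab)
        show False
        proof (cases "a < x")
          case True
          have "conf_up (D - {(r, g2)})"
            by (rule conf_upI[of a b _ al g1 x e p pe r3 q r5 y]) (use dots one u ab a ineq True r_al g12 in auto)
          then show False using irr2 by simp
        next
          case False
          have "x \<noteq> a" using row_unique[OF dots(1) u(1)] u ineq by (auto simp: ab)
          then have "conf_13254 D"
            using False by (intro conf_13254I[of r g2 D x e a b p pe r5 y]) (use dots two u ab a ineq in auto)
          then show False using no by simp
        qed
      next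
        assume "al \<le> fst u \<and> g1 \<le> snd u"
        then have a: "al < a" "g1 < b" "b < g2" using neq not by (auto simp: ab)
        have "conf_up (D - {(al, g1)})"
          by (rule conf_upI[of r g2 _ a b x e p pe r3 q r5 y]) (use dots two u ab a ineq r_al g12 in auto)
        then show False using irr1 by simp
      qed
    qed
  qed
  have UDs: "fst u < fst d" if "u \<in> U" "d \<in> Ds" for u d
  proof (rule ccontr)
    assume "\<not> fst u < fst d"
    moreover have "u \<in> D" "d \<in> D" "snd u < q" "q < snd d"
      using that by (auto simp: U_def Ds_def K_def)
    then have "fst u \<noteq> fst d" using row_snd[of u d] by auto
    ultimately have lt: "fst d < fst u" by simp
    have "conf_13254 D"
      by (rule conf_13254I[of r g2 D "fst d" "snd d" "fst u" "snd u" p pe r5 y])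
        (use that two dots ineq KD lt Ds_r[OF that(2)] U_se[OF that(1)] in \<open>auto simp: U_def Ds_def K_def\<close>)
    then show False using no by simp
  qed
  have Qc: "snd z < snd z'" if "z \<in> Q" "z' \<in> Q" "fst z < fst z'" for z z'
  proof (rule ccontr)
    assume "\<not> snd z < snd z'"
    moreover have "snd z \<noteq> snd z'"
      using col_fst[of z z'] that KD(4) by auto
    ultimately have lt: "snd z' < snd z" by simp
    have "conf_13254 D"
    proof (cases "z' \<in> Ds")
      case True
      then have "z \<in> Ds" using that lt by (auto simp: Q_def U_def Ds_def)
      show ?thesis
        by (rule conf_13254I[of r g2 D "fst z" "snd z" "fst z'" "snd z'" p pe r5 y])
          (use True \<open>z \<in> Ds\<close> that two dots ineq KD lt Ds_r[OF \<open>z \<in> Ds\<close>] in \<open>auto simp: Ds_def K_def\<close>)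
    next
      case False
      then have z': "z' \<in> U" using that by (auto simp: Q_def)
      then have z: "z \<in> U" using UDs[OF z', of z] that by (auto simp: Q_def)
      show ?thesis
        by (rule conf_13254I[of al g1 D "fst z" "snd z" "fst z'" "snd z'" p pe r3 q])
          (use z z' that one dots ineq KD lt U_se[OF z] U_se[OF z'] g12 in \<open>auto simp: U_def K_def\<close>)
    qed
    then show False using no by simp
  qed
  have Qprops: "fst z \<noteq> al \<and> r < fst z \<and> g2 < snd z \<and> fst z < p \<and> snd z < y \<and> snd z \<noteq> q" if "z \<in> Q" for z
  proof -
    have "z \<in> K" using that by (auto simp: Q_def U_def Ds_def)
    moreover have "r < fst z \<and> g2 < snd z"
      using that Ds_r U_se r_al ineq by (fastforce simp: Q_def Ds_def)
    moreover have "fst z \<noteq> al"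
    proof
      assume "fst z = al"
      then have "z = (al, g1)" using row_unique[of z "(al, g1)"] one that KD(4) by auto
      with calculation(2) g12 show False by simp
    qed
    ultimately show ?thesis using no_q by (auto simp: K_def)
  qed
  have xDs: "(x, e) \<in> Ds" using dots ineq by (auto simp: Ds_def K_def)
  \<comment> \<open>\<open>x1\<close> is the top row of \<open>Ds\<close>, and \<open>x2\<close> the
    next row of \<open>Ds\<close>, or \<open>p\<close> at the latest. \<open>x2\<close> is taken
    below \<open>al\<close> as well, so that the box at \<open>(x2, q)\<close> holds both
    minima.\<close>
  define x1 where "x1 = Min (fst ` Ds)"
  have "x1 \<in> fst ` Ds" and x1_le: "\<And>z. z \<in> Ds \<Longrightarrow> x1 \<le> fst z"
    unfolding x1_def using fin(3) xDs by (auto intro: Min_in Min_le)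
  then obtain e1 where e1: "(x1, e1) \<in> Ds" by auto
  define X2 where "X2 = {k \<in> insert p (fst ` Ds). x1 < k \<and> al < k}"
  define x2 where "x2 = Min X2"
  have x1p: "x1 < p" using e1 by (auto simp: Ds_def K_def)
  have X2: "finite X2" "p \<in> X2" using fin ineq x1p by (auto simp: X2_def)
  then have "x2 \<in> X2" and x2_le: "\<And>k. k \<in> X2 \<Longrightarrow> x2 \<le> k"
    unfolding x2_def by (auto intro: Min_in Min_le)
  then have x2: "x2 = p \<or> x2 \<in> fst ` Ds" "x1 < x2" "al < x2" "x2 \<le> p"
    using X2 by (auto simp: X2_def)
  have rx1: "r < x1" using Ds_r[OF e1] by simp
  have e1q: "q < e1" "e1 < y" and e1D: "(x1, e1) \<in> D" using e1 by (auto simp: Ds_def K_def)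
  have x1al: "x1 \<noteq> al" using Qprops[of "(x1, e1)"] e1 by (auto simp: Q_def)
  have Ux1: "fst u < x1" if "u \<in> U" for u using UDs[OF that e1] by simp
  have Ux2: "fst u < x2" if "u \<in> U" for u using Ux1[OF that] x2 by simp
  have U_empty: "U = {}" if "x1 < al"
    using Ux1 U_se that by fastforce
  define RU CU where "RU = fst ` U" and "CU = snd ` U"
  define RQ CQ where "RQ = fst ` Q" and "CQ = snd ` Q"
  have injQ: "inj_on fst Q" "inj_on snd Q"
    using row_unique col_unique KD(4) by (meson inj_onI subsetD)+
  then have injU: "inj_on fst U" "inj_on snd U" by (auto simp: Q_def intro: inj_on_subset)
  have cardU: "card RU = card U" "card CU = card U" and cardQ: "card RQ = card Q" "card CQ = card Q"
    using injU injQ by (simp_all add: RU_def CU_def RQ_def CQ_def card_image)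
  have finR: "finite RU" "finite CU" "finite RQ" "finite CQ"
    using fin by (simp_all add: RU_def CU_def RQ_def CQ_def)
  have RU: "al < k \<and> k < x1 \<and> k < x2 \<and> r < k \<and> k < p" if "k \<in> RU" for k
    using that U_se Ux1 Ux2 r_al x1p by (fastforce simp: RU_def)
  have CU: "g2 < l \<and> g1 < l \<and> l < q" if "l \<in> CU" for l
    using that U_se g12 by (fastforce simp: CU_def U_def)
  have RQ: "k \<noteq> al \<and> r < k \<and> k < p" if "k \<in> RQ" for k using that Qprops by (auto simp: RQ_def)
  have CQ: "g2 < l \<and> l < y \<and> l \<noteq> q \<and> g1 < l" if "l \<in> CQ" for l using that Qprops g12 by (fastforce simp: CQ_def)
  have subU: "RU \<subseteq> RQ" "CU \<subseteq> CQ" by (auto simp: RU_def RQ_def CU_def CQ_def Q_def)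
  define A B where "A = {r, al, p} \<union> RQ" and "B = {g1, g2, y} \<union> CQ"
  define A2 A3 Bq where "A2 = {r, x1, x2} \<union> RU" and "A3 = {al, x1, x2} \<union> RU" and "Bq = {g1, g2, q} \<union> CU"
  have finA: "finite A" "finite B" "finite A2" "finite A3" "finite Bq"
    using finR by (simp_all add: A_def B_def A2_def A3_def Bq_def)
  have cardA: "card A = card Q + 3" "card B = card Q + 3" "card A2 = card U + 3" "card A3 = card U + 3" "card Bq = card U + 3"
  proof -
    have "r \<notin> RQ" "al \<notin> RQ" "p \<notin> RQ" "g1 \<notin> CQ" "g2 \<notin> CQ" "y \<notin> CQ" using RQ CQ by blast+
    then show "card A = card Q + 3" "card B = card Q + 3"
      using finR cardQ r_al ineq g12 by (simp_all add: A_def B_def)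
    have "r \<notin> RU" "al \<notin> RU" "x1 \<notin> RU" "x2 \<notin> RU" "g1 \<notin> CU" "g2 \<notin> CU" "q \<notin> CU" using RU CU by blast+
    then show "card A2 = card U + 3" "card A3 = card U + 3" "card Bq = card U + 3"
      using finR cardU r_al ineq g12 x2 rx1 x1al by (simp_all add: A2_def A3_def Bq_def)
  qed
  have x1RQ: "x1 \<in> RQ" using e1 by (force simp: RQ_def Q_def)
  have x2A: "x2 \<in> A" using x2(1) by (auto simp: A_def RQ_def Q_def)
  have A23: "A2 \<subseteq> A" "A3 \<subseteq> A" "Bq \<subseteq> insert q B"
    using x1RQ x2A subU by (auto simp: A_def A2_def A3_def B_def Bq_def)
  have AD: "A \<subseteq> fst ` D" "insert q B \<subseteq> snd ` D"
    using imageI[OF two, of fst] imageI[OF one, of fst] imageI[OF dots(2), of fst] imageI[OF two, of snd]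
      imageI[OF one, of snd] imageI[OF dots(3), of snd] imageI[OF dots(4), of snd]
      image_mono[OF KD(4), of fst] image_mono[OF KD(4), of snd]
    by (simp_all add: A_def B_def RQ_def CQ_def)
  have rkp: "rk D p y = card Q + 2"
  proof -
    have "z \<in> K" if "z \<in> D" "fst z \<le> p" "snd z \<le> y" for z
    proof -
      have "fst z \<noteq> p" using row_snd[OF that(1) dots(2)] that ineq by auto
      moreover have "snd z \<noteq> y" using col_fst[OF that(1) dots(4)] that ineq by auto
      ultimately show ?thesis using that by (auto simp: K_def)
    qed
    then have "{z \<in> D. fst z \<le> p \<and> snd z \<le> y} = K" by (auto simp: K_def)
    moreover have "(r, g2) \<notin> Q" "(al, g1) \<notin> Q" using Qprops[of "(r, g2)"] Qprops[of "(al, g1)"] by auto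
    then have "card K = card Q + 2" using fin r_al by (simp add: K_eq)
    ultimately show ?thesis by (simp add: rk_def)
  qed
  have rkx2: "rk D x2 q = card U + 2"
  proof -
    have "z \<in> {(r, g2), (al, g1)} \<union> U" if "z \<in> D" "fst z \<le> x2" "snd z \<le> q" for z
    proof -
      have "fst z \<noteq> p" using row_snd[OF that(1) dots(2)] that ineq by auto
      moreover have "snd z \<noteq> q" using col_fst[OF that(1) dots(3)] that ineq x2 by auto
      ultimately show ?thesis using that x2 ineq by (auto simp: K_def U_def)
    qed
    moreover have "z \<in> D \<and> fst z \<le> x2 \<and> snd z \<le> q" if "z \<in> {(r, g2), (al, g1)} \<union> U" for z
      using that
    proof (elim UnE insertE emptyE)
      assume z: "z \<in> U"
      then show ?thesis using Ux2[OF z] KD(2) by (auto simp: U_def)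
    qed (use two one x2 r_al g12 ineq in simp_all)
    ultimately have "{z \<in> D. fst z \<le> x2 \<and> snd z \<le> q} = {(r, g2), (al, g1)} \<union> U" by blast
    moreover have "(r, g2) \<notin> U" "(al, g1) \<notin> U" by (auto simp: U_def)
    then have "card ({(r, g2), (al, g1)} \<union> U) = card U + 2" using fin r_al by simp
    ultimately show ?thesis by (simp add: rk_def)
  qed
  have Ale: "A \<subseteq> {..p}" "B \<subseteq> {..y}" "A2 \<subseteq> {..x2}" "A3 \<subseteq> {..x2}" "Bq \<subseteq> {..q}"
    using r_al g12 ineq x2 rx1
    by (auto simp: A_def B_def A2_def A3_def Bq_def dest: RQ CQ RU CU)
  have AD': "B \<subseteq> snd ` D" "A2 \<subseteq> fst ` D" "A3 \<subseteq> fst ` D" "Bq \<subseteq> snd ` D"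
    using AD A23 by blast+
  have idx: "minor_index D A B" "minor_index D A2 Bq" "minor_index D A3 Bq"
    using minor_indexI[OF AD(1) AD'(1) Ale(1,2)] minor_indexI[OF AD'(2,4) Ale(3,5)]
      minor_indexI[OF AD'(3,4) Ale(4,5)] cardA rkp rkx2 by simp_all
  \<comment> \<open>The point is made to force matchings. Row \<open>r\<close> offers only
    \<open>y\<close> and row \<open>al\<close> only \<open>e1\<close>, both outside
    \<open>Bq\<close>, so the eliminating minors vanish until \<open>(r, g2)\<close> or
    \<open>(al, g1)\<close> is added. The double entries in rows \<open>x1\<close> and
    \<open>x2\<close> then serve one of them each way. In the first minor column \<open>q\<close> is
    missing and row \<open>p\<close> takes \<open>g1\<close>, so again a single matching
    remains.\<close>
  define E where "E = {(r, y), (al, e1), (x1, g2), (x1, q), (x2, g1), (p, g1), (x2, q)} \<union> (Q - {(x1, e1)})"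
  have Erow: "l = y" if "(r, l) \<in> E" for l
    using that r_al rx1 x2 ineq Qprops[of "(r, l)"] by (auto simp: E_def)
  have Eal: "l = e1" if "(al, l) \<in> E" for l
    using that r_al x1al x2 ineq Qprops[of "(al, l)"] by (auto simp: E_def)
  have Ex1: "l = g2 \<or> l = q" if "(x1, l) \<in> E" for l
  proof -
    have "l = e1" if "(x1, l) \<in> Q" using row_unique[of "(x1, l)" "(x1, e1)"] that e1D KD by auto
    then show ?thesis using that rx1 x1al x2 x1p by (auto simp: E_def)
  qed
  have Ep: "l = g1 \<or> l = q" if "(p, l) \<in> E" for l
    using that r_al x1p rx1 x2 ineq Qprops[of "(p, l)"] by (auto simp: E_def)
  have EQ: "l = snd z \<or> fst z = x2 \<and> (l = g1 \<or> l = q)" if "(fst z, l) \<in> E" "z \<in> Q" "fst z \<noteq> x1" for l z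
  proof -
    have "l = snd z" if "(fst z, l) \<in> Q"
      using row_snd[of "(fst z, l)" z] that \<open>z \<in> Q\<close> KD by auto
    then show ?thesis using that Qprops[OF \<open>z \<in> Q\<close>] by (auto simp: E_def)
  qed
  have Ex2: "l = g1 \<or> l = q \<or> q < l" if "(x2, l) \<in> E" for l
    using x2(1)
  proof
    assume "x2 = p" then show ?thesis using Ep that by auto
  next
    assume "x2 \<in> fst ` Ds"
    then obtain z where "z \<in> Ds" "x2 = fst z" by auto
    then show ?thesis using EQ[of z l] that x2 by (auto simp: Q_def Ds_def)
  qed
  have EU: "l = snd u" if "(fst u, l) \<in> E" "u \<in> U" for l u
    using EQ[of u l] that Ux1[OF that(2)] Ux2[OF that(2)] by (auto simp: Q_def)
  have zero: "E \<inter> zero_cells D = {}"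
  proof -
    have "rk D (fst z) (snd z) \<noteq> 0" if "z \<in> E" for z
      using that unfolding rk0_iff E_def
    proof (elim UnE insertE emptyE DiffE)
      assume "z \<in> Q"
      then show "\<not> (\<not> (r \<le> fst z \<and> g2 \<le> snd z) \<and> \<not> (al \<le> fst z \<and> g1 \<le> snd z))"
        using Qprops[of z] by auto
    qed (use r_al g12 ineq rx1 x2 e1q in simp_all)
    then show ?thesis unfolding zero_cells_def by blast
  qed
  have aE: "(r, g2) \<notin> E" using Erow[of g2] ineq by auto
  have cE: "(al, g1) \<notin> E" using Eal[of g1] e1q ineq g12 by auto
  have acN: "(r, g2) \<notin> zero_cells D" "(al, g1) \<notin> zero_cells D"
    by (auto simp: zero_cells_def rk0_iff)
  have aA3: "(r, g2) \<notin> A3 \<times> Bq"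
    using r_al rx1 x2 RU by (auto simp: A3_def)
  have qB: "q \<notin> B" using CQ ineq g12 by (auto simp: B_def)
  have yBq: "y \<notin> Bq" "e1 \<notin> Bq" "l \<in> Bq \<Longrightarrow> l \<le> q" for l
    using ineq g12 e1q by (auto simp: Bq_def dest: CU)
  have M1: "mn (ind E) A B \<noteq> 0"
  proof (rule mn_ind_nonzero_forced[OF finA(1)])
    let ?C = "{(r, y), (al, e1), (x1, g2), (p, g1)} \<union> (Q - {(x1, e1)})"
    have Qm: "(x1, e1) \<in> Q" using e1 by (auto simp: Q_def)
    have img: "fst ` (Q - {(x1, e1)}) = RQ - {x1}" "snd ` (Q - {(x1, e1)}) = CQ - {e1}"
      using inj_on_image_set_diff[OF injQ(1), of Q "{(x1, e1)}"] inj_on_image_set_diff[OF injQ(2), of Q "{(x1, e1)}"] Qm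
      by (simp_all add: RQ_def CQ_def)
    have "e1 \<in> CQ" using Qm by (force simp: CQ_def)
    moreover have "fst ` ?C = {r, al, x1, p} \<union> (RQ - {x1})" "snd ` ?C = {y, e1, g2, g1} \<union> (CQ - {e1})"
      unfolding image_Un img by simp_all
    ultimately have f: "fst ` ?C = A" "snd ` ?C = B"
      using x1RQ by (auto simp: A_def B_def)
    have "card ?C \<le> 4 + card (Q - {(x1, e1)})"
      by (intro order.trans[OF card_Un_le] add_mono card_le_4 order.refl)
    also have "\<dots> = card A" using card.remove[OF fin(4) Qm] cardA by simp
    finally show "?C \<in> matchings A B"
      using cardA fin by (intro matchingsI f) simp_all
    show "?C \<subseteq> E" by (auto simp: E_def)
    show "card A = card B" using cardA by simp
    fix C assume C: "C \<in> matchings A B" "C \<subseteq> E"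
    have 1: "(r, y) \<in> C"
      using matchings_rowE[OF C(1), of r] Erow C(2) by (auto simp: A_def)
    have 2: "(al, e1) \<in> C"
      using matchings_rowE[OF C(1), of al] Eal C(2) by (metis A_def insertCI subsetD UnI1)
    have 3: "(x1, g2) \<in> C"
      using matchings_rowE[OF C(1), of x1] Ex1 C(2) qB x1RQ by (metis A_def UnI2 subsetD)
    have 4: "(p, g1) \<in> C"
      using matchings_rowE[OF C(1), of p] Ep C(2) qB by (metis A_def insertCI subsetD UnI1)
    have 5: "z \<in> C" if "z \<in> Q - {(x1, e1)}" for z
    proof -
      have z: "z \<in> Q" "fst z \<noteq> x1"
        using that row_unique[of z "(x1, e1)"] e1D KD by auto
      then obtain l where l: "(fst z, l) \<in> C" "l \<in> B"
        using matchings_rowE[OF C(1), of "fst z"] by (auto simp: A_def RQ_def)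
      have "l \<noteq> g1"
        using matchings_col_unique[OF C(1) 4, of "fst z"] l Qprops[OF z(1)] by auto
      moreover have "l \<noteq> q" using l qB by auto
      ultimately have "l = snd z" using EQ[of z l] z l C(2) by auto
      then show ?thesis using l by simp
    qed
    show "?C \<subseteq> C" using 1 2 3 4 5 by auto
  qed
  have cards: "card A2 = card Bq" "card A3 = card Bq" using cardA by simp_all
  have M2: "mn (ind E) A2 Bq = 0"
    by (rule mn_ind_zero_row[OF finA(3,5) cards(1), of r]) (use Erow yBq in \<open>auto simp: A2_def\<close>)
  have M3: "mn (ind E) A3 Bq = 0"
    by (rule mn_ind_zero_row[OF finA(4,5) cards(2), of al]) (use Eal yBq in \<open>auto simp: A3_def\<close>)
  have match: "{(k1, l1), (k2, l2), (k3, l3)} \<union> U \<in> matchings ({k1, k2, k3} \<union> RU) Bq"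
    if "{l1, l2, l3} = {g1, g2, q}" "card ({k1, k2, k3} \<union> RU) = card Bq" for k1 l1 k2 l2 k3 l3
  proof -
    let ?C = "{(k1, l1), (k2, l2), (k3, l3)} \<union> U"
    have f: "fst ` ?C = {k1, k2, k3} \<union> RU" by (simp add: RU_def)
    have "snd ` ?C = {l1, l2, l3} \<union> CU" by (simp add: CU_def)
    then have g: "snd ` ?C = Bq" unfolding that(1) Bq_def by simp
    have "card ?C \<le> 3 + card U"
      by (intro order.trans[OF card_Un_le] add_mono card_le_3 order.refl)
    also have "\<dots> = card Bq" using cardA by simp
    finally show ?thesis
      using that(2) fin by (intro matchingsI f g) simp_all
  qed
  have forcedU: "U \<subseteq> C" if CS: "C \<in> matchings S Bq" "C \<subseteq> insert (k, l) E" "RU \<subseteq> S" "k \<notin> RU" for C S k l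
  proof
    fix u assume u: "u \<in> U"
    then have "fst u \<in> RU" by (auto simp: RU_def)
    then obtain l' where "(fst u, l') \<in> C" using matchings_rowE[OF CS(1), of "fst u"] CS(3) by blast
    moreover have "(fst u, l') \<noteq> (k, l)" using \<open>fst u \<in> RU\<close> CS(4) by auto
    ultimately have "(fst u, l') \<in> C \<and> l' = snd u" using EU[OF _ u] CS(2) by blast
    then show "u \<in> C" by (metis prod.collapse)
  qed
  have M2': "mn (ind (insert (r, g2) E)) A2 Bq \<noteq> 0"
  proof (rule mn_ind_nonzero_forced[OF finA(3) cards(1)])
    show "{(r, g2), (x1, q), (x2, g1)} \<union> U \<in> matchings A2 Bq"
      unfolding A2_def by (rule match) (use cards in \<open>auto simp: A2_def\<close>)
    show "{(r, g2), (x1, q), (x2, g1)} \<union> U \<subseteq> insert (r, g2) E"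
      using Ux1 by (fastforce simp: E_def Q_def)
    fix C assume C: "C \<in> matchings A2 Bq" "C \<subseteq> insert (r, g2) E"
    have 1: "(r, g2) \<in> C"
      using matchings_rowE[OF C(1), of r] Erow C(2) yBq by (auto simp: A2_def)
    obtain l where l: "(x1, l) \<in> C" using matchings_rowE[OF C(1), of x1] by (auto simp: A2_def)
    then have "l \<noteq> g2" using matchings_col_unique[OF C(1) 1, of x1] rx1 by auto
    then have 2: "(x1, q) \<in> C" using l Ex1[of l] C(2) by auto
    obtain l where l: "(x2, l) \<in> C" "l \<in> Bq" using matchings_rowE[OF C(1), of x2] by (auto simp: A2_def)
    then have "l \<noteq> q" using matchings_col_unique[OF C(1) 2, of x2] x2 by auto
    then have 3: "(x2, g1) \<in> C" using l Ex2[of l] C(2) rx1 x2 yBq(3)[OF l(2)] by auto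
    show "{(r, g2), (x1, q), (x2, g1)} \<union> U \<subseteq> C"
      using 1 2 3 forcedU[OF C] RU by (auto simp: A2_def)
  qed
  have M3': "mn (ind (insert (al, g1) E)) A3 Bq \<noteq> 0"
  proof (rule mn_ind_nonzero_forced[OF finA(4) cards(2)])
    show "{(al, g1), (x1, g2), (x2, q)} \<union> U \<in> matchings A3 Bq"
      unfolding A3_def by (rule match) (use cards in \<open>auto simp: A3_def\<close>)
    show "{(al, g1), (x1, g2), (x2, q)} \<union> U \<subseteq> insert (al, g1) E"
      using Ux1 by (fastforce simp: E_def Q_def)
    fix C assume C: "C \<in> matchings A3 Bq" "C \<subseteq> insert (al, g1) E"
    have 1: "(al, g1) \<in> C"
      using matchings_rowE[OF C(1), of al] Eal C(2) yBq by (auto simp: A3_def)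
    obtain l where l: "(x2, l) \<in> C" "l \<in> Bq" using matchings_rowE[OF C(1), of x2] by (auto simp: A3_def)
    then have "l \<noteq> g1" using matchings_col_unique[OF C(1) 1, of x2] x2 by auto
    then have 2: "(x2, q) \<in> C" using l Ex2[of l] C(2) x2 yBq(3)[OF l(2)] by auto
    obtain l where l: "(x1, l) \<in> C" using matchings_rowE[OF C(1), of x1] by (auto simp: A3_def)
    then have "l \<noteq> q" using matchings_col_unique[OF C(1) 2, of x1] x2 by auto
    then have 3: "(x1, g2) \<in> C" using l Ex1[of l] C(2) x1al by auto
    show "{(al, g1), (x1, g2), (x2, q)} \<union> U \<subseteq> C"
      using 1 2 3 forcedU[OF C] RU by (auto simp: A3_def)
  qed
  let ?T = "(A \<times> B \<union> A2 \<times> Bq \<union> A3 \<times> Bq) - zero_cells D - {(r, g2), (al, g1)}"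
  have T: "k \<in> A" "l \<in> insert q B" "g2 \<le> l \<or> al \<le> k" "(k, l) \<noteq> (r, g2)" "(k, l) \<noteq> (al, g1)"
    "l = q \<Longrightarrow> k \<in> {r, al, x1, x2} \<union> RU" if "(k, l) \<in> ?T" for k l
    using that A23 qB by (auto simp: zero_cells_def rk0_iff A2_def A3_def)
  have "\<not> bad D ?T"
  proof
    assume "bad D ?T"
    then obtain C i j where C: "C \<subseteq> ?T" "finite C" "C \<subseteq> {..i} \<times> {..j}" "chain D C" "rk D i j < card C"
      unfolding bad_def by blast
    have CT: "k \<in> A" "l \<in> insert q B" "g2 \<le> l \<or> al \<le> k" "(k, l) \<noteq> (r, g2)" "(k, l) \<noteq> (al, g1)"
      "l = q \<Longrightarrow> k \<in> {r, al, x1, x2} \<union> RU" "k \<le> i" if "(k, l) \<in> C" for k l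
    proof -
      have kl: "(k, l) \<in> ?T" using C(1) that by (rule subsetD)
      show "k \<in> A" "l \<in> insert q B" "g2 \<le> l \<or> al \<le> k" "(k, l) \<noteq> (r, g2)" "(k, l) \<noteq> (al, g1)"
        using T(1-5)[OF kl] .
      show "k \<in> {r, al, x1, x2} \<union> RU" if "l = q" using T(6)[OF kl that] .
      show "k \<le> i" using subsetD[OF C(3) that] by simp
    qed
    have Arow: "k = r \<or> k = al \<or> r < k" "k \<noteq> r \<Longrightarrow> r < k" "k < al \<Longrightarrow> k = r \<or> k \<in> RQ" if "k \<in> A" for k
      using that r_al ineq by (auto simp: A_def dest: RQ)
    have Bcol: "l = g1 \<or> g2 \<le> l" "l \<noteq> g1 \<Longrightarrow> g1 < l" if "l \<in> insert q B" for l
      using that g12 ineq by (auto simp: B_def dest: CQ)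
    have Cfacts: "r \<le> k \<and> (l = g1 \<or> g2 \<le> l) \<and> (g2 \<le> l \<or> al \<le> k) \<and> (k, l) \<noteq> (r, g2) \<and> (k, l) \<noteq> (al, g1)"
      if "(k, l) \<in> C" for k l
      using Arow(1)[OF CT(1)[OF that]] Bcol(1)[OF CT(2)[OF that]] CT(3,4,5)[OF that] r_al by auto
    have Cball: "\<forall>(k, l)\<in>C. r \<le> k \<and> (l = g1 \<or> g2 \<le> l) \<and> (g2 \<le> l \<or> al \<le> k) \<and> (k, l) \<noteq> (r, g2) \<and> (k, l) \<noteq> (al, g1)"
      by (intro ballI; simp only: split_paired_all split_conv; rule Cfacts)
    note inv = chain_inv[OF C(4) Cball] and g1row = chain_g1row[OF C(4) Cball] and g2row = chain_g2row[OF C(4) Cball]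
      and no_al = chain_no_al[OF C(4) Cball] and no_r = chain_no_r[OF C(4) Cball]
    have before: "k < kq" if "(k, l) \<in> C" "(kq, q) \<in> C" "l < q" "l \<noteq> g1" for k l kq
      using inv[OF that(2,1) _ that(3)] chain_rows[OF C(4) that(1), of q] that by (metis linorder_neqE_nat nat_neq_iff)
    have AU: "k \<in> RU \<or> x1 \<le> k" if "k \<in> A" "r < k" "k \<noteq> al" for k
      using that x1_le x1p by (auto simp: A_def RQ_def RU_def Q_def)
    have "({g1, g2, q} \<union> snd ` {z \<in> Q. snd z < q} \<subseteq> snd ` C) \<or> (i < al \<and> {g2, q} \<subseteq> snd ` C) \<or>
      (p \<le> i \<and> y \<le> j \<and> card Q + 3 \<le> card C)"
    proof (rule bad_cases[OF KD(4) Qprops Qc _ _ _ _ C])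
      show "(k \<in> {r, al} \<union> fst ` Q \<or> p \<le> k) \<and> l \<in> {g1, g2, q, y} \<union> snd ` Q \<and> (g2 \<le> l \<or> al \<le> k)"
        if "(k, l) \<in> ?T" for k l
        using T(1-3)[OF that] by (auto simp: A_def B_def RQ_def CQ_def)
    qed (use ineq in auto)
    then consider (cols) "{g1, g2, q} \<union> CU \<subseteq> snd ` C" | (top) "i < al" "{g2, q} \<subseteq> snd ` C" | (rows) "card A \<le> card C"
    proof (elim disjE)
      assume a: "{g1, g2, q} \<union> snd ` {z \<in> Q. snd z < q} \<subseteq> snd ` C"
      have "CU \<subseteq> snd ` {z \<in> Q. snd z < q}" by (auto simp: CU_def Q_def U_def)
      with a that(1) show thesis by blast
    qed (use that cardA in auto)
    then show False
    proof cases
      case rows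
      have "fst ` C \<subseteq> A" using CT(1) by auto
      moreover have "card (fst ` C) = card C" "card (snd ` C) = card C"
        using C(4) by (simp_all add: chain_def card_image)
      ultimately have fC: "fst ` C = A" using rows finA(1) by (metis card_seteq)
      \<comment> \<open>All rows of \<open>A\<close> are used, \<open>r\<close> and
        \<open>al\<close> among them. This excludes columns \<open>g1\<close> and \<open>g2\<close>,
        and the remaining columns are too few.\<close>
      have "g1 \<notin> snd ` C"
      proof
        assume "g1 \<in> snd ` C"
        then obtain k1 where "(k1, g1) \<in> C" by auto
        moreover have "al \<in> fst ` C" by (simp add: fC A_def)
        ultimately show False using no_al by fastforce
      qed
      moreover have "g2 \<notin> snd ` C"
      proof
        assume "g2 \<in> snd ` C"
        then obtain k2 where "(k2, g2) \<in> C" by auto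
        moreover have "r \<in> fst ` C" by (simp add: fC A_def)
        ultimately show False using no_r by fastforce
      qed
      moreover have "snd ` C \<subseteq> insert q B" using CT(2) by fastforce
      ultimately have "snd ` C \<subseteq> {q, y} \<union> CQ" by (auto simp: B_def)
      then have "card C \<le> card ({q, y} \<union> CQ)"
        using card_mono[of "{q, y} \<union> CQ" "snd ` C"] finR \<open>card (snd ` C) = card C\<close> by simp
      also have "\<dots> \<le> 2 + card CQ"
        by (intro order.trans[OF card_Un_le] add_mono card_le_2 order.refl)
      finally show False using rows cardA cardQ by simp
    next
      case top
      then obtain k2 kq where k: "(k2, g2) \<in> C" "(kq, q) \<in> C" by auto
      have k2q: "k2 < kq" using before[OF k] ineq g12 by simp
      have "kq < al" "r < k2" using CT(7)[OF k(2)] top g2row[OF k(1)] by auto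
      \<comment> \<open>Column \<open>q\<close> is available only in rows \<open>r\<close>,
        \<open>al\<close>, \<open>x1\<close>, \<open>x2\<close> and those of \<open>U\<close>; above
        \<open>al\<close> and below \<open>k2\<close> only \<open>x1\<close> remains. But no row of
        \<open>A\<close> above \<open>al\<close> lies strictly between \<open>r\<close> and
        \<open>x1\<close>, which leaves no place for \<open>k2\<close>.\<close>
      then have "kq = x1" using CT(6)[OF k(2)] k2q RU x2 by fastforce
      then show False
        using AU[OF CT(1)[OF k(1)] \<open>r < k2\<close>] k2q \<open>kq < al\<close> RU by fastforce
    next
      case cols
      then obtain k1 k2 kq where k: "(k1, g1) \<in> C" "(k2, g2) \<in> C" "(kq, q) \<in> C" by auto
      have k2q: "k2 < kq" using before[OF k(2,3)] ineq g12 by simp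
      have gt: "al < k1" "r < k2" using g1row[OF k(1)] g2row[OF k(2)] .
      have kq: "kq \<in> {x1, x2} \<union> RU" using CT(6)[OF k(3)] no_al[OF k(1), of q] no_r[OF k(2), of q] k(3) by auto
      then have kqx2: "kq \<le> x2" using RU x2 by fastforce
      have k1q: "k1 < kq \<or> kq < al"
        using inv[OF k(3,1)] chain_rows[OF C(4) k(1), of q] k(3) ineq g12 by (metis linorder_neqE_nat order.strict_trans nat_neq_iff)
      show False
      proof (cases "x1 < al")
        case True
        \<comment> \<open>With \<open>x1\<close> above \<open>al\<close>, column \<open>q\<close> is
          used in row \<open>x2\<close>, and column \<open>g1\<close> in a row of \<open>X2\<close>
          above \<open>x2\<close>, against the minimality of \<open>x2\<close>.\<close>
        then have "RU = {}" using U_empty by (simp add: RU_def)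
        moreover have "k2 \<noteq> al" using no_al[OF k(1), of g2] k(2) by auto
        ultimately have "x1 \<le> k2" using AU[OF CT(1)[OF k(2)] gt(2)] by simp
        then have "kq = x2" using kq k2q \<open>RU = {}\<close> by auto
        then have "k1 < x2" using k1q x2 by auto
        moreover have "k1 \<in> X2"
          using CT(1)[OF k(1)] gt(1) True \<open>RU = {}\<close> r_al by (auto simp: X2_def A_def RQ_def RU_def Q_def)
        ultimately show False using x2_le[of k1] by simp
      next
        case False
        then have alx1: "al < x1" using x1al by simp
        have row: "al < k \<and> k \<le> kq" if "(k, l) \<in> C" "l \<in> {g1, g2, q} \<union> CU" for k l
        proof -
          have "kq \<noteq> r" using k2q gt by simp
          then have "al \<le> kq" using kq alx1 x2 RU by fastforce
          show ?thesis
          proof (cases "l = g1")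
            case True
            then have "k = k1" using chain_cols[OF C(4) that(1), of k1] k(1) by simp
            then show ?thesis using gt k1q \<open>al \<le> kq\<close> by auto
          next
            case l: False
            have "k \<le> kq"
            proof (cases "l = q")
              case True
              then show ?thesis using chain_cols[OF C(4) that(1), of kq] k(3) by simp
            next
              case False
              then have "l < q" using that(2) l ineq CU by auto
              then show ?thesis using before[OF that(1) k(3)] l by simp
            qed
            moreover have "k \<noteq> r" "k \<noteq> al" using no_r[OF k(2)] no_al[OF k(1)] that(1) by auto
            then have "al < k"
              using AU[OF CT(1)[OF that(1)]] Arow(2)[OF CT(1)[OF that(1)]] RU alx1 by fastforce
            ultimately show ?thesis by simp
          qed
        qed
        \<comment> \<open>Pigeonhole: columns \<open>g1\<close>, \<open>g2\<close>, \<open>q\<close>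
          and those of \<open>U\<close> are all used, but only within rows \<open>x1\<close>,
          \<open>x2\<close> and those of \<open>U\<close>.\<close>
        define C' where "C' = {z \<in> C. snd z \<in> {g1, g2, q} \<union> CU}"
        have "snd ` C' = {g1, g2, q} \<union> CU" using cols by (auto simp: C'_def)
        moreover have "card (snd ` C') = card C'" "card (fst ` C') = card C'"
          using C(4) by (auto simp: chain_def C'_def intro!: card_image intro: inj_on_subset)
        ultimately have "card (fst ` C') = card Bq" by (simp add: Bq_def)
        moreover have "fst ` C' \<subseteq> {x1, x2} \<union> RU"
        proof
          fix k assume "k \<in> fst ` C'"
          then obtain l where kl: "(k, l) \<in> C" "l \<in> {g1, g2, q} \<union> CU" by (auto simp: C'_def)
          have k': "al < k" "k \<le> x2" using row[OF kl] kqx2 by auto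
          have "k \<in> RU \<or> k = x1 \<or> k \<in> X2"
          proof -
            have "k = p \<or> k \<in> RU \<or> k \<in> fst ` Ds"
              using CT(1)[OF kl(1)] k' r_al by (auto simp: A_def RQ_def RU_def Q_def)
            moreover have "x1 \<le> k" if "k \<in> fst ` Ds" using that x1_le by auto
            ultimately show ?thesis
              using k' x1p ineq by (auto simp: X2_def order.order_iff_strict)
          qed
          then show "k \<in> {x1, x2} \<union> RU" using x2_le[of k] k'(2) by auto
        qed
        then have "card (fst ` C') \<le> card ({x1, x2} \<union> RU)"
          using finR by (intro card_mono) auto
        moreover have "card ({x1, x2} \<union> RU) \<le> 2 + card RU"
          by (intro order.trans[OF card_Un_le] add_mono card_le_2 order.refl)
        ultimately show False using cardA cardU by simp
      qed
    qed
  qed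
  then show ?thesis
    by (rule elim_good2[OF idx zero acN(1) aE acN(2) cE aA3 M1 M2 M2' M3 M3'])
qed

end

text \<open>The corner \<open>(p, q)\<close> of the diagram has a diagram cell \<open>(p, y)\<close> to its right and a diagram
  cell \<open>(p4, q)\<close> below it.\<close>

definition conf_hook :: "cell set \<Rightarrow> bool" where
  "conf_hook D \<longleftrightarrow> (\<exists>r g2 al g1 p pe p4 pe4 r3 q r5 y.
     {(r, g2), (al, g1), (p, pe), (p4, pe4), (r3, q), (r5, y)} \<subseteq> D \<and>
     r < al \<and> al < p \<and> p < p4 \<and> p4 < r3 \<and> p < r5 \<and>
     g1 < g2 \<and> g2 < q \<and> q < y \<and> y < pe \<and> q < pe4)"

lemma conf_hookI:
  assumes "(r, g2) \<in> D" "(al, g1) \<in> D" "(p, pe) \<in> D" "(p4, pe4) \<in> D" "(r3, q) \<in> D" "(r5, y) \<in> D"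
     "r < al" "al < p" "p < p4" "p4 < r3" "p < r5" "g1 < g2" "g2 < q" "q < y" "y < pe" "q < pe4"
  shows "conf_hook D"
  unfolding conf_hook_def
  by (rule exI[of _ r], rule exI[of _ g2], rule exI[of _ al], rule exI[of _ g1], rule exI[of _ p], rule exI[of _ pe],
      rule exI[of _ p4], rule exI[of _ pe4], rule exI[of _ r3], rule exI[of _ q], rule exI[of _ r5], rule exI[of _ y])
    (use assms in simp)

context two_min
begin

text \<open>By \<open>no_right\<close> and \<open>no_down\<close> the corners \<open>(p, y)\<close>
  and \<open>(p4, q)\<close> have the same rank. The first block omits column \<open>g1\<close> and
  the second row \<open>al\<close>, so \<open>(al, g1)\<close> is absent from the start and only
  \<open>(r, g2)\<close> is eliminated.\<close>

lemma elim_good_hook: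
  assumes dots: "(p, pe) \<in> D" "(p4, pe4) \<in> D" "(r3, q) \<in> D" "(r5, y) \<in> D"
    and ineq: "al < p" "p < p4" "p4 < r3" "p < r5" "g2 < q" "q < y" "y < pe" "q < pe4"
    and no: "\<not> conf_13254 D"
    and irr2: "\<not> conf_hook (D - {(r, g2)})" and irr1: "\<not> conf_hook (D - {(al, g1)})"
    and no_right: "\<And>z. z \<in> D \<Longrightarrow> fst z < p \<Longrightarrow> snd z < y \<Longrightarrow> snd z < q"
    and no_down: "\<And>z. z \<in> D \<Longrightarrow> fst z < p4 \<Longrightarrow> snd z < q \<Longrightarrow> fst z < p"
  shows "elim_good D"
proof -
  define K where "K = {z \<in> D. fst z < p \<and> snd z < q}"
  define U where "U = K - {(r, g2), (al, g1)}"
  have fin: "finite K" "finite U" using fD by (auto simp: K_def U_def)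
  have UD: "U \<subseteq> D" by (auto simp: U_def K_def)
  have K_eq: "K = {(r, g2), (al, g1)} \<union> U"
  proof -
    have "(r, g2) \<in> K" "(al, g1) \<in> K" using two one ineq r_al g12 by (simp_all add: K_def)
    then show ?thesis by (auto simp: U_def)
  qed
  have U_se: "al < fst u \<and> g2 < snd u" if "u \<in> U" for u
  proof -
    have u: "u \<in> D" "fst u < p" "snd u < q" "u \<noteq> (r, g2)" "u \<noteq> (al, g1)" using that by (auto simp: U_def K_def)
    obtain a b where ab: "u = (a, b)" by (cases u)
    have neq: "a \<noteq> r" "a \<noteq> al" "b \<noteq> g2" "b \<noteq> g1"
      using u(4,5) row_unique[OF u(1) two] row_unique[OF u(1) one] col_unique[OF u(1) two] col_unique[OF u(1) one]
      unfolding ab by (metis fst_conv snd_conv)+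
    show ?thesis
    proof (rule ccontr)
      assume not: "\<not> (al < fst u \<and> g2 < snd u)"
      from se[OF u(1)] show False
      proof
        assume "r \<le> fst u \<and> g2 \<le> snd u"
        then have a: "r < a" "a < al" "g2 < b" using neq not by (auto simp: ab)
        have "conf_hook (D - {(r, g2)})"
          by (rule conf_hookI[of a b _ al g1 p pe p4 pe4 r3 q r5 y]) (use dots one u ab a ineq r_al g12 in auto)
        then show False using irr2 by simp
      next
        assume "al \<le> fst u \<and> g1 \<le> snd u"
        then have a: "al < a" "g1 < b" "b < g2" using neq not by (auto simp: ab)
        have "conf_hook (D - {(al, g1)})"
          by (rule conf_hookI[of r g2 _ a b p pe p4 pe4 r3 q r5 y]) (use dots two u ab a ineq r_al g12 in auto)
        then show False using irr1 by simp
      qed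
    qed
  qed
  have Uprops: "fst z < p" "snd z < q" if "z \<in> U" for z
    using that by (auto simp: U_def K_def)
  have Qc: "snd z < snd z'" if "z \<in> U" "z' \<in> U" "fst z < fst z'" for z z'
  proof (rule ccontr)
    assume "\<not> snd z < snd z'"
    moreover have "snd z \<noteq> snd z'"
      using col_fst[of z z'] that UD by auto
    ultimately have lt: "snd z' < snd z" by simp
    have "conf_13254 D"
      by (rule conf_13254I[of al g1 D "fst z" "snd z" "fst z'" "snd z'" p pe r3 q])
        (use that one dots ineq UD lt U_se[OF that(1)] U_se[OF that(2)] Uprops[OF that(1)] Uprops[OF that(2)] g12 in auto)
    then show False using no by simp
  qed
  define RU CU where "RU = fst ` U" and "CU = snd ` U"
  have injU: "inj_on fst U" "inj_on snd U"
    using row_unique col_unique UD by (meson inj_onI subsetD)+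
  have cardU: "card RU = card U" "card CU = card U" and finR: "finite RU" "finite CU"
    using injU fin by (simp_all add: RU_def CU_def card_image)
  have RU: "al < k \<and> r < k \<and> k < p \<and> k < p4" if k: "k \<in> RU" for k
  proof -
    obtain u where "u \<in> U" "k = fst u" using k by (auto simp: RU_def)
    then show ?thesis using U_se[of u] Uprops[of u] r_al ineq by simp
  qed
  have CU: "g2 < l \<and> g1 < l \<and> l < q \<and> l < y" if l: "l \<in> CU" for l
  proof -
    obtain u where "u \<in> U" "l = snd u" using l by (auto simp: CU_def)
    then show ?thesis using U_se[of u] Uprops[of u] g12 ineq by simp
  qed
  define A B1 A2 B2 where "A = {r, al, p} \<union> RU" and "B1 = {g2, q, y} \<union> CU"
    and "A2 = {r, p, p4} \<union> RU" and "B2 = {g1, g2, q} \<union> CU"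
  have notin: "r \<notin> RU" "al \<notin> RU" "p \<notin> RU" "p4 \<notin> RU" "g1 \<notin> CU" "g2 \<notin> CU" "q \<notin> CU" "y \<notin> CU"
    using RU CU by blast+
  have finA: "finite A" "finite B1" "finite A2" "finite B2"
    using finR by (simp_all add: A_def B1_def A2_def B2_def)
  have cardA: "card A = card U + 3" "card B1 = card U + 3" "card A2 = card U + 3" "card B2 = card U + 3"
    using notin finR cardU r_al ineq g12 by (simp_all add: A_def B1_def A2_def B2_def)
  have AD: "A \<subseteq> fst ` D" "B1 \<subseteq> snd ` D" "A2 \<subseteq> fst ` D" "B2 \<subseteq> snd ` D"
    using imageI[OF two, of fst] imageI[OF one, of fst] imageI[OF dots(1), of fst] imageI[OF dots(2), of fst]
      imageI[OF two, of snd] imageI[OF one, of snd] imageI[OF dots(3), of snd] imageI[OF dots(4), of snd]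
      image_mono[OF UD, of fst] image_mono[OF UD, of snd]
    by (simp_all add: A_def B1_def A2_def B2_def RU_def CU_def)
  have Ale: "A \<subseteq> {..p}" "B1 \<subseteq> {..y}" "A2 \<subseteq> {..p4}" "B2 \<subseteq> {..q}"
    using r_al g12 ineq by (auto simp: A_def B1_def A2_def B2_def dest: RU CU)
  have cardK: "card K = card U + 2"
  proof -
    have "(r, g2) \<notin> U" "(al, g1) \<notin> U" by (auto simp: U_def)
    then show ?thesis using fin r_al by (simp add: K_eq)
  qed
  have rkp: "rk D p y = card U + 2"
  proof -
    have "z \<in> K" if "z \<in> D" "fst z \<le> p" "snd z \<le> y" for z
    proof -
      have "fst z \<noteq> p" using row_snd[OF that(1) dots(1)] that ineq by auto
      moreover have "snd z \<noteq> y" using col_fst[OF that(1) dots(4)] that ineq by auto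
      ultimately show ?thesis using that no_right[OF that(1)] by (auto simp: K_def)
    qed
    then have "{z \<in> D. fst z \<le> p \<and> snd z \<le> y} = K" using ineq by (auto simp: K_def)
    then show ?thesis using cardK by (simp add: rk_def)
  qed
  have rkp4: "rk D p4 q = card U + 2"
  proof -
    have "z \<in> K" if "z \<in> D" "fst z \<le> p4" "snd z \<le> q" for z
    proof -
      have "fst z \<noteq> p4" using row_snd[OF that(1) dots(2)] that ineq by auto
      moreover have "snd z \<noteq> q" using col_fst[OF that(1) dots(3)] that ineq by auto
      ultimately show ?thesis using that no_down[OF that(1)] by (auto simp: K_def)
    qed
    then have "{z \<in> D. fst z \<le> p4 \<and> snd z \<le> q} = K" using ineq by (auto simp: K_def)
    then show ?thesis using cardK by (simp add: rk_def)
  qed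
  have idx: "minor_index D A B1" "minor_index D A2 B2"
    using minor_indexI[OF AD(1,2) Ale(1,2)] minor_indexI[OF AD(3,4) Ale(3,4)] cardA rkp rkp4 by simp_all
  \<comment> \<open>Each row of the two blocks has exactly one entry; that of row \<open>r\<close>
    is in column \<open>y\<close>, which the second block lacks.\<close>
  define E where "E = {(r, y), (al, g2), (p, q), (p4, g1)} \<union> U"
  have EU: "k \<in> RU" if "(k, l) \<in> U" for k l using that by (force simp: RU_def)
  have Er: "l = y" if "(r, l) \<in> E" for l
    using that r_al ineq EU[of r l] notin by (auto simp: E_def)
  have Eal: "l = g2" if "(al, l) \<in> E" for l
    using that r_al ineq EU[of al l] notin by (auto simp: E_def)
  have Ep: "l = q" if "(p, l) \<in> E" for l
    using that r_al ineq EU[of p l] notin by (auto simp: E_def)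
  have Ep4: "l = g1" if "(p4, l) \<in> E" for l
    using that r_al ineq EU[of p4 l] notin by (auto simp: E_def)
  have Eu: "l = snd u" if "(fst u, l) \<in> E" "u \<in> U" for l u
  proof -
    have "fst u \<in> RU" using that(2) by (simp add: RU_def)
    then have "(fst u, l) \<in> U" using that(1) notin by (auto simp: E_def)
    then show ?thesis using row_snd[of "(fst u, l)" u] that(2) UD by auto
  qed
  have zero: "E \<inter> zero_cells D = {}"
  proof -
    have "rk D (fst z) (snd z) \<noteq> 0" if "z \<in> E" for z
      using that unfolding rk0_iff E_def
    proof (elim UnE insertE emptyE)
      assume "z \<in> U"
      then show "\<not> (\<not> (r \<le> fst z \<and> g2 \<le> snd z) \<and> \<not> (al \<le> fst z \<and> g1 \<le> snd z))"
        using U_se[of z] r_al by auto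
    qed (use r_al g12 ineq in simp_all)
    then show ?thesis unfolding zero_cells_def by blast
  qed
  have aE: "(r, g2) \<notin> E" using Er[of g2] ineq by auto
  have aN: "(r, g2) \<notin> zero_cells D" by (simp add: zero_cells_def rk0_iff)
  have cards: "card A = card B1" "card A2 = card B2" using cardA by simp_all
  have match: "{(k1, l1), (k2, l2), (k3, l3)} \<union> U \<in> matchings ({k1, k2, k3} \<union> RU) ({l1, l2, l3} \<union> CU)"
    if c: "card ({k1, k2, k3} \<union> RU) = card U + 3" "card ({l1, l2, l3} \<union> CU) = card U + 3" for k1 l1 k2 l2 k3 l3
  proof (rule matchingsI)
    have "card ({(k1, l1), (k2, l2), (k3, l3)} \<union> U) \<le> 3 + card U"
      by (intro order.trans[OF card_Un_le] add_mono card_le_3 order.refl)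
    then show "card ({(k1, l1), (k2, l2), (k3, l3)} \<union> U) \<le> card ({k1, k2, k3} \<union> RU)" using c by simp
  qed (use c fin in \<open>simp_all add: RU_def CU_def\<close>)
  have forcedU: "U \<subseteq> C" if CS: "C \<in> matchings S S'" "C \<subseteq> insert (r, l) E" "RU \<subseteq> S" for C S S' l
  proof
    fix u assume u: "u \<in> U"
    then have "fst u \<in> RU" by (auto simp: RU_def)
    then obtain l' where "(fst u, l') \<in> C" using matchings_rowE[OF CS(1), of "fst u"] CS(3) by blast
    moreover have "(fst u, l') \<noteq> (r, l)" using \<open>fst u \<in> RU\<close> notin by auto
    ultimately have "(fst u, l') \<in> C \<and> l' = snd u" using Eu[OF _ u] CS(2) by blast
    then show "u \<in> C" by (metis prod.collapse)
  qed
  have M1: "mn (ind E) A B1 \<noteq> 0"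
  proof (rule mn_ind_nonzero_forced[OF finA(1) cards(1)])
    have "{y, g2, q} \<union> CU = B1" by (auto simp: B1_def)
    then show "{(r, y), (al, g2), (p, q)} \<union> U \<in> matchings A B1"
      using match[of r al p y g2 q] cardA by (simp add: A_def)
    show "{(r, y), (al, g2), (p, q)} \<union> U \<subseteq> E" by (auto simp: E_def)
    fix C assume C: "C \<in> matchings A B1" "C \<subseteq> E"
    have "r \<in> A" "al \<in> A" "p \<in> A" by (simp_all add: A_def)
    then obtain l1 l2 l3 where l: "(r, l1) \<in> C" "(al, l2) \<in> C" "(p, l3) \<in> C"
      using matchings_rowE[OF C(1)] by metis
    then have "l1 = y" "l2 = g2" "l3 = q" using Er Eal Ep C(2) by blast+
    moreover have "U \<subseteq> C" by (rule forcedU[OF C(1), of y]) (use C(2) in \<open>auto simp: A_def\<close>)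
    ultimately show "{(r, y), (al, g2), (p, q)} \<union> U \<subseteq> C" using l by simp
  qed
  have M2: "mn (ind E) A2 B2 = 0"
  proof (rule mn_ind_zero_row[OF finA(3,4) cards(2), of r])
    have "y \<notin> B2" using notin ineq g12 by (simp add: B2_def)
    then show "(r, l) \<notin> E" if "l \<in> B2" for l using Er[of l] that by blast
  qed (simp add: A2_def)
  have M2': "mn (ind (insert (r, g2) E)) A2 B2 \<noteq> 0"
  proof (rule mn_ind_nonzero_forced[OF finA(3) cards(2)])
    have "{g2, q, g1} \<union> CU = B2" by (auto simp: B2_def)
    then show "{(r, g2), (p, q), (p4, g1)} \<union> U \<in> matchings A2 B2"
      using match[of r p p4 g2 q g1] cardA by (simp add: A2_def)
    show "{(r, g2), (p, q), (p4, g1)} \<union> U \<subseteq> insert (r, g2) E" by (auto simp: E_def)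
    fix C assume C: "C \<in> matchings A2 B2" "C \<subseteq> insert (r, g2) E"
    have "r \<in> A2" "p \<in> A2" "p4 \<in> A2" by (simp_all add: A2_def)
    then obtain l1 l2 l3 where l: "(r, l1) \<in> C" "(p, l2) \<in> C" "(p4, l3) \<in> C"
      using matchings_rowE[OF C(1)] by metis
    have "p \<noteq> r" "p4 \<noteq> r" using r_al ineq by simp_all
    then have "(p, l2) \<in> E" "(p4, l3) \<in> E"
      using subsetD[OF C(2) l(2)] subsetD[OF C(2) l(3)] by simp_all
    then have "l2 = q" "l3 = g1" using Ep Ep4 by blast+
    moreover have "y \<notin> B2" using notin ineq g12 by (simp add: B2_def)
    then have "l1 \<noteq> y" using matchings_subset[OF C(1)] l(1) by blast
    then have "l1 = g2" using l(1) C(2) Er[of l1] by auto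
    moreover have "U \<subseteq> C" by (rule forcedU[OF C]) (auto simp: A2_def)
    ultimately show "{(r, g2), (p, q), (p4, g1)} \<union> U \<subseteq> C" using l by simp
  qed
  let ?T = "(A \<times> B1 \<union> A2 \<times> B2) - zero_cells D - {(r, g2)}"
  have T: "k \<in> insert p4 A" "l \<in> {g1, g2, q, y} \<union> CU" "g2 \<le> l \<or> al \<le> k" "(k, l) \<noteq> (r, g2)" "(k, l) \<noteq> (al, g1)"
    "k = p4 \<Longrightarrow> l \<noteq> y" if kl: "(k, l) \<in> ?T" for k l
  proof -
    have "(k \<in> A \<and> l \<in> B1) \<or> (k \<in> A2 \<and> l \<in> B2)" "rk D k l \<noteq> 0" "(k, l) \<noteq> (r, g2)"
      using kl by (auto simp: zero_cells_def)
    moreover have "al \<notin> A2" "g1 \<notin> B1" "p4 \<notin> A" "y \<notin> B2"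
      using notin r_al ineq g12 by (simp_all add: A_def A2_def B1_def B2_def)
    ultimately show "k \<in> insert p4 A" "l \<in> {g1, g2, q, y} \<union> CU" "g2 \<le> l \<or> al \<le> k" "(k, l) \<noteq> (r, g2)"
      "(k, l) \<noteq> (al, g1)" "k = p4 \<Longrightarrow> l \<noteq> y"
      unfolding rk0_iff A_def A2_def B1_def B2_def by blast+
  qed
  have "\<not> bad D ?T"
  proof
    assume "bad D ?T"
    then obtain C i j where C: "C \<subseteq> ?T" "finite C" "C \<subseteq> {..i} \<times> {..j}" "chain D C" "rk D i j < card C"
      unfolding bad_def by blast
    have CT: "k \<in> {r, al, p, p4} \<union> RU" "l \<in> {g1, g2, q, y} \<union> CU" "g2 \<le> l \<or> al \<le> k" "(k, l) \<noteq> (r, g2)" "(k, l) \<noteq> (al, g1)"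
      "k = p4 \<Longrightarrow> l \<noteq> y" "k \<le> i" if "(k, l) \<in> C" for k l
    proof -
      have kl: "(k, l) \<in> ?T" using C(1) that by (rule subsetD)
      show "k \<in> {r, al, p, p4} \<union> RU" using T(1)[OF kl] by (auto simp: A_def)
      show "l \<in> {g1, g2, q, y} \<union> CU" "g2 \<le> l \<or> al \<le> k" "(k, l) \<noteq> (r, g2)" "(k, l) \<noteq> (al, g1)"
        using T(2-5)[OF kl] .
      show "l \<noteq> y" if "k = p4" using T(6)[OF kl that] .
      show "k \<le> i" using subsetD[OF C(3) that] by simp
    qed
    have Cfacts: "r \<le> k \<and> (l = g1 \<or> g2 \<le> l) \<and> (g2 \<le> l \<or> al \<le> k) \<and> (k, l) \<noteq> (r, g2) \<and> (k, l) \<noteq> (al, g1)"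
      if kl: "(k, l) \<in> C" for k l
    proof -
      have "r \<le> k" using CT(1)[OF kl] r_al ineq by (auto dest: RU)
      moreover have "l = g1 \<or> g2 \<le> l" using CT(2)[OF kl] ineq by (auto dest: CU)
      ultimately show ?thesis using CT(3,4,5)[OF kl] by blast
    qed
    have Cball: "\<forall>(k, l)\<in>C. r \<le> k \<and> (l = g1 \<or> g2 \<le> l) \<and> (g2 \<le> l \<or> al \<le> k) \<and> (k, l) \<noteq> (r, g2) \<and> (k, l) \<noteq> (al, g1)"
      by (intro ballI; simp only: split_paired_all split_conv; rule Cfacts)
    note inv = chain_inv[OF C(4) Cball] and no_al = chain_no_al[OF C(4) Cball] and no_r = chain_no_r[OF C(4) Cball]
      and g1row = chain_g1row[OF C(4) Cball]
    have cardC: "card (fst ` C) = card C" "card (snd ` C) = card C"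
      using C(4) by (simp_all add: chain_def card_image)
    have rowsC: "fst ` C \<subseteq> {r, al, p, p4} \<union> RU" and colsC: "snd ` C \<subseteq> {g1, g2, q, y} \<union> CU"
      using CT(1,2) by fastforce+
    have no_al': "al \<notin> fst ` C" if "g1 \<in> snd ` C" using that no_al by fastforce
    have no_r': "r \<notin> fst ` C" if "g2 \<in> snd ` C" using that no_r by fastforce
    have "({g1, g2, q} \<union> snd ` {z \<in> U. snd z < q} \<subseteq> snd ` C) \<or> (i < al \<and> {g2, q} \<subseteq> snd ` C) \<or>
      (p \<le> i \<and> y \<le> j \<and> card U + 3 \<le> card C)"
    proof (rule bad_cases[OF UD _ Qc _ _ _ _ C])
      show "fst z \<noteq> al \<and> r < fst z \<and> g2 < snd z \<and> fst z < p \<and> snd z < y \<and> snd z \<noteq> q" if "z \<in> U" for z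
        using U_se[OF that] Uprops[OF that] r_al ineq by auto
      show "(k \<in> {r, al} \<union> fst ` U \<or> p \<le> k) \<and> l \<in> {g1, g2, q, y} \<union> snd ` U \<and> (g2 \<le> l \<or> al \<le> k)"
        if kl: "(k, l) \<in> ?T" for k l
      proof -
        have "k \<in> {r, al, p, p4} \<union> RU" using T(1)[OF kl] by (auto simp: A_def)
        then have "k \<in> {r, al} \<union> fst ` U \<or> p \<le> k" using ineq by (auto simp: RU_def)
        then show ?thesis using T(2,3)[OF kl] by (simp add: CU_def)
      qed
    qed (use ineq in auto)
    moreover have "snd ` {z \<in> U. snd z < q} = CU"
      using Uprops by (auto simp: CU_def)
    ultimately consider (cols) "{g1, g2, q} \<union> CU \<subseteq> snd ` C" | (top) "i < al" "{g2, q} \<subseteq> snd ` C" | (rows) "card U + 3 \<le> card C"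
      by auto
    then show False
    proof cases
      case cols
      have "fst ` C \<subseteq> {p, p4} \<union> RU"
        using rowsC no_al' no_r' cols by blast
      moreover have "card ({p, p4} \<union> RU) \<le> 2 + card RU"
        by (intro order.trans[OF card_Un_le] add_mono card_le_2 order.refl)
      ultimately have "card C \<le> 2 + card U"
        using card_mono[of "{p, p4} \<union> RU" "fst ` C"] finR cardC cardU by simp
      moreover have "card ({g1, g2, q} \<union> CU) \<le> card C"
        using card_mono[OF _ cols] C(2) cardC by simp
      ultimately show False using cardA by (simp add: B2_def)
    next
      case top
      then obtain k2 kq where k: "(k2, g2) \<in> C" "(kq, q) \<in> C" by auto
      have "kq < al" using CT(7)[OF k(2)] top by simp
      then have "kq = r" using CT(1)[OF k(2)] ineq by (auto dest: RU)
      then show False using no_r[OF k(1)] k(2) by blast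
    next
      case rows
      \<comment> \<open>Pigeonhole for the rows or columns of \<open>C\<close>: two besides those of
        \<open>U\<close> are too few (\<open>small\<close>), and of three all must be used
        (\<open>full\<close>).\<close>
      have small: "\<not> S' \<subseteq> S \<union> X" if "card S \<le> 2" "card X = card U" "finite X" "card S' = card C" "finite S" for S S' X :: "nat set"
      proof
        assume "S' \<subseteq> S \<union> X"
        then have "card C \<le> card (S \<union> X)" using card_mono[of "S \<union> X" S'] that by simp
        also have "\<dots> \<le> 2 + card U" using card_Un_le[of S X] that by simp
        finally show False using rows by simp
      qed
      have full: "S' = S \<union> X" if "S' \<subseteq> S \<union> X" "card S \<le> 3" "card X = card U" "finite X" "card S' = card C" "finite S" for S S' X :: "nat set"
        using that rows card_Un_le[of S X] by (intro card_seteq) auto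
      show False
      proof (cases "g1 \<in> snd ` C")
        case g1: True
        show False
        proof (cases "g2 \<in> snd ` C")
          case True
          then have "fst ` C \<subseteq> {p, p4} \<union> RU" using rowsC no_al'[OF g1] no_r' by blast
          moreover have "\<not> fst ` C \<subseteq> {p, p4} \<union> RU" by (intro small card_le_2 cardU finR cardC) simp
          ultimately show False by simp
        next
          case g2: False
          have "fst ` C = {r, p, p4} \<union> RU"
            using rowsC no_al'[OF g1] by (intro full card_le_3 cardU finR cardC) auto
          moreover have "snd ` C = {g1, q, y} \<union> CU"
            using colsC g2 by (intro full card_le_3 cardU finR cardC) auto
          ultimately have "p4 \<in> fst ` C" "y \<in> snd ` C" "q \<in> snd ` C" by blast+
          then obtain l4 ky kq where k: "(p4, l4) \<in> C" "(ky, y) \<in> C" "(kq, q) \<in> C" by auto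
          \<comment> \<open>\<open>(p4, y)\<close> is not an available variable, so column
            \<open>y\<close> is used above row \<open>p4\<close> and forms an inversion with the
            cell in row \<open>p4\<close>. This forces it into row \<open>r\<close>, where it forms
            a forbidden inversion with the cell in column \<open>q\<close>.\<close>
          have "l4 < y" using CT(2)[OF k(1)] CT(6)[OF k(1)] g12 ineq by (auto dest: CU)
          moreover have "ky \<noteq> p4" using CT(6)[OF k(2)] by auto
          then have "ky < p4" using CT(1)[OF k(2)] r_al ineq by (auto dest: RU)
          ultimately have "ky < al" using inv[OF k(2,1)] by simp
          then have "ky = r" using CT(1)[OF k(2)] ineq by (auto dest: RU)
          moreover have "kq \<noteq> r" using chain_rows[OF C(4) k(3), of y] k(2) \<open>ky = r\<close> ineq by auto
          then have "r < kq" using Cfacts[OF k(3)] by auto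
          ultimately show False using inv[OF k(2,3)] ineq g12 by simp
        qed
      next
        case g1: False
        show False
        proof (cases "g2 \<in> snd ` C")
          case g2: True
          have "fst ` C = {al, p, p4} \<union> RU"
            using rowsC no_r'[OF g2] by (intro full card_le_3 cardU finR cardC) auto
          moreover have "snd ` C = {g2, q, y} \<union> CU"
            using colsC g1 by (intro full card_le_3 cardU finR cardC) auto
          ultimately have "p4 \<in> fst ` C" "y \<in> snd ` C" by blast+
          then obtain l4 ky where k: "(p4, l4) \<in> C" "(ky, y) \<in> C" by auto
          have "l4 < y" using CT(2)[OF k(1)] CT(6)[OF k(1)] g12 ineq by (auto dest: CU)
          moreover have "ky \<noteq> p4" using CT(6)[OF k(2)] by auto
          then have "ky < p4" using CT(1)[OF k(2)] r_al ineq by (auto dest: RU)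
          ultimately have "l4 = g1" using inv[OF k(2,1)] by simp
          then show False using g1 imageI[OF k(1), of snd] by simp
        next
          case False
          then have "snd ` C \<subseteq> {q, y} \<union> CU" using colsC g1 by blast
          moreover have "\<not> snd ` C \<subseteq> {q, y} \<union> CU" by (intro small card_le_2 cardU finR cardC) simp
          ultimately show False by simp
        qed
      qed
    qed
  qed
  then show ?thesis
    by (rule elim_good1[OF idx zero aN aE M1 M2 M2'])
qed

end

subsection \<open>The pattern 4261735\<close>

definition conf_7 :: "cell set \<Rightarrow> bool" where
  "conf_7 D \<longleftrightarrow> (\<exists>r1 r2 r3 r4 r5 r6 r7 c1 c2 c3 c4 c5 c6 c7.
     {(r1, c4), (r2, c2), (r3, c6), (r4, c1), (r5, c7), (r6, c3), (r7, c5)} \<subseteq> D \<and>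
     r1 < r2 \<and> r2 < r3 \<and> r3 < r4 \<and> r4 < r5 \<and> r5 < r6 \<and> r6 < r7 \<and>
     c1 < c2 \<and> c2 < c3 \<and> c3 < c4 \<and> c4 < c5 \<and> c5 < c6 \<and> c6 < c7)"

lemma conf_7I:
  assumes "(r1, c4) \<in> D" "(r2, c2) \<in> D" "(r3, c6) \<in> D" "(r4, c1) \<in> D" "(r5, c7) \<in> D" "(r6, c3) \<in> D" "(r7, c5) \<in> D"
     "r1 < r2" "r2 < r3" "r3 < r4" "r4 < r5" "r5 < r6" "r6 < r7" "c1 < c2" "c2 < c3" "c3 < c4" "c4 < c5" "c5 < c6" "c6 < c7"
  shows "conf_7 D"
  unfolding conf_7_def
  by (rule exI[of _ r1], rule exI[of _ r2], rule exI[of _ r3], rule exI[of _ r4], rule exI[of _ r5], rule exI[of _ r6],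
      rule exI[of _ r7], rule exI[of _ c1], rule exI[of _ c2], rule exI[of _ c3], rule exI[of _ c4], rule exI[of _ c5],
      rule exI[of _ c6], rule exI[of _ c7])
    (use assms in simp)

text \<open>The pattern is its own inverse, and the construction is symmetric under transposition.
  Its corners \<open>(r5, c5)\<close>, \<open>(r3, c5)\<close> and \<open>(r5, c3)\<close> have
  ranks 3, 2 and 2. The minimum \<open>(r2, c2)\<close> lies in none of the three blocks; the other
  two minima are eliminated.\<close>

lemma elim_good_7:
  assumes D: "pperm n D"
    and dots: "(r1, c4) \<in> D" "(r2, c2) \<in> D" "(r3, c6) \<in> D" "(r4, c1) \<in> D" "(r5, c7) \<in> D" "(r6, c3) \<in> D" "(r7, c5) \<in> D"
    and r: "r1 < r2" "r2 < r3" "r3 < r4" "r4 < r5" "r5 < r6" "r6 < r7"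
    and c: "c1 < c2" "c2 < c3" "c3 < c4" "c4 < c5" "c5 < c6" "c6 < c7"
    and se: "\<And>z. z \<in> D \<Longrightarrow> (r1 \<le> fst z \<and> c4 \<le> snd z) \<or> (r2 \<le> fst z \<and> c2 \<le> snd z) \<or> (r4 \<le> fst z \<and> c1 \<le> snd z)"
    and K: "\<And>z. z \<in> D \<Longrightarrow> fst z < r5 \<Longrightarrow> snd z < c5 \<Longrightarrow> z \<in> {(r1, c4), (r2, c2), (r4, c1)}"
  shows "elim_good D"
proof -
  have fD: "finite D" using D by (rule pperm_finite)
  have row_snd: "snd x = snd y" if "x \<in> D" "y \<in> D" "fst x = fst y" for x y
    using D that unfolding pperm_def inj_on_def by blast
  have col_fst: "fst x = fst y" if "x \<in> D" "y \<in> D" "snd x = snd y" for x y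
    using D that unfolding pperm_def inj_on_def by blast
  have rk0_iff: "rk D k l = 0 \<longleftrightarrow> \<not> (r1 \<le> k \<and> c4 \<le> l) \<and> \<not> (r2 \<le> k \<and> c2 \<le> l) \<and> \<not> (r4 \<le> k \<and> c1 \<le> l)" for k l
  proof -
    have "rk D k l > 0 \<longleftrightarrow> (r1 \<le> k \<and> c4 \<le> l) \<or> (r2 \<le> k \<and> c2 \<le> l) \<or> (r4 \<le> k \<and> c1 \<le> l)"
      unfolding rk_pos_iff[OF fD]
    proof
      assume "\<exists>x\<in>D. fst x \<le> k \<and> snd x \<le> l"
      then show "(r1 \<le> k \<and> c4 \<le> l) \<or> (r2 \<le> k \<and> c2 \<le> l) \<or> (r4 \<le> k \<and> c1 \<le> l)"
        using se le_trans by blast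
    next
      assume "(r1 \<le> k \<and> c4 \<le> l) \<or> (r2 \<le> k \<and> c2 \<le> l) \<or> (r4 \<le> k \<and> c1 \<le> l)"
      then show "\<exists>x\<in>D. fst x \<le> k \<and> snd x \<le> l"
        using dots(1,2,4) by (metis fst_conv snd_conv)
    qed
    then show ?thesis by auto
  qed
  have NW: "z \<in> {(r1, c4), (r2, c2), (r4, c1)}" if "z \<in> D" "fst z \<le> r5" "snd z \<le> c5" for z
  proof -
    have "fst z \<noteq> r5" using row_snd[OF that(1) dots(5)] that c by auto
    moreover have "snd z \<noteq> c5" using col_fst[OF that(1) dots(7)] that r by auto
    ultimately show ?thesis using K[OF that(1)] that by simp
  qed
  have rk1: "rk D r5 c5 = 3"
  proof -
    have "{z \<in> D. fst z \<le> r5 \<and> snd z \<le> c5} = {(r1, c4), (r2, c2), (r4, c1)}" (is "?L = ?R")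
    proof
      show "?L \<subseteq> ?R" using NW by blast
      show "?R \<subseteq> ?L" using dots r c by simp
    qed
    then show ?thesis using r by (simp add: rk_def)
  qed
  have rk2: "rk D r3 c5 = 2"
  proof -
    have "{z \<in> D. fst z \<le> r3 \<and> snd z \<le> c5} = {(r1, c4), (r2, c2)}" (is "?L = ?R")
    proof
      show "?L \<subseteq> ?R"
      proof
        fix z assume z: "z \<in> ?L"
        then have "z \<in> {(r1, c4), (r2, c2), (r4, c1)}" using NW[of z] r by simp
        then show "z \<in> ?R" using z r by auto
      qed
      show "?R \<subseteq> ?L" using dots r c by simp
    qed
    then show ?thesis using r by (simp add: rk_def)
  qed
  have rk3: "rk D r5 c3 = 2"
  proof -
    have "{z \<in> D. fst z \<le> r5 \<and> snd z \<le> c3} = {(r2, c2), (r4, c1)}" (is "?L = ?R")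
    proof
      show "?L \<subseteq> ?R"
      proof
        fix z assume z: "z \<in> ?L"
        then have "z \<in> {(r1, c4), (r2, c2), (r4, c1)}" using NW[of z] c by simp
        then show "z \<in> ?R" using z c by auto
      qed
      show "?R \<subseteq> ?L" using dots r c by simp
    qed
    then show ?thesis using r by (simp add: rk_def)
  qed
  define A1 B1 where "A1 = {r1, r3, r4, r5}" and "B1 = {c1, c3, c4, c5}"
  define A2 B2 where "A2 = {r1, r2, r3}" and "B2 = {c3, c4, c5}"
  define A3 B3 where "A3 = {r3, r4, r5}" and "B3 = {c1, c2, c3}"
  note defs = A1_def B1_def A2_def B2_def A3_def B3_def
  have rows: "r1 \<in> fst ` D" "r2 \<in> fst ` D" "r3 \<in> fst ` D" "r4 \<in> fst ` D" "r5 \<in> fst ` D"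
    and cols: "c1 \<in> snd ` D" "c2 \<in> snd ` D" "c3 \<in> snd ` D" "c4 \<in> snd ` D" "c5 \<in> snd ` D"
    using dots by force+
  have fin: "finite A1" "finite B1" "finite A2" "finite B2" "finite A3" "finite B3" by (simp_all add: defs)
  have card: "card A1 = card B1" "card A2 = card B2" "card A3 = card B3" using r c by (simp_all add: defs)
  have idx: "minor_index D A1 B1" "minor_index D A2 B2" "minor_index D A3 B3"
  proof -
    show "minor_index D A1 B1"
      by (rule minor_indexI[of _ _ _ r5 c5]) (use r c rows cols rk1 in \<open>simp_all add: defs\<close>)
    show "minor_index D A2 B2"
      by (rule minor_indexI[of _ _ _ r3 c5]) (use r c rows cols rk2 in \<open>simp_all add: defs\<close>)
    show "minor_index D A3 B3"
      by (rule minor_indexI[of _ _ _ r5 c3]) (use r c rows cols rk3 in \<open>simp_all add: defs\<close>)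
  qed
  \<comment> \<open>Rows \<open>r1\<close> and \<open>r2\<close> compete for column
    \<open>c5\<close>, so the second minor vanishes until \<open>(r1, c4)\<close> is added. Row
    \<open>r4\<close> has only \<open>c4\<close>, outside \<open>B3\<close>, so the third vanishes
    until \<open>(r4, c1)\<close> is added.\<close>
  define E where "E = {(r1, c5), (r5, c1), (r3, c3), (r4, c4), (r2, c5), (r5, c2)}"
  have zero: "E \<inter> zero_cells D = {}"
    using r c by (auto simp: E_def zero_cells_def rk0_iff)
  have acN: "(r1, c4) \<notin> zero_cells D" "(r4, c1) \<notin> zero_cells D" by (simp_all add: zero_cells_def rk0_iff)
  have acE: "(r1, c4) \<notin> E" "(r4, c1) \<notin> E" using r c by (auto simp: E_def)
  have a3: "(r1, c4) \<notin> A3 \<times> B3" using r by (simp add: defs)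
  have E1: "l = c5" if "(r1, l) \<in> E" for l using that r by (auto simp: E_def)
  have E2: "l = c5" if "(r2, l) \<in> E" for l using that r by (auto simp: E_def)
  have E3: "l = c3" if "(r3, l) \<in> E" for l using that r by (auto simp: E_def)
  have E4: "l = c4" if "(r4, l) \<in> E" for l using that r by (auto simp: E_def)
  have E5: "l = c1 \<or> l = c2" if "(r5, l) \<in> E" for l using that r by (auto simp: E_def)
  have M1: "mn (ind E) A1 B1 \<noteq> 0"
  proof (rule mn_ind_nonzero_forced[OF fin(1) card(1)])
    show "{(r1, c5), (r3, c3), (r4, c4), (r5, c1)} \<in> matchings A1 B1"
      by (rule matchingsI) (use r c in \<open>auto simp: defs\<close>)
    show "{(r1, c5), (r3, c3), (r4, c4), (r5, c1)} \<subseteq> E" by (auto simp: E_def)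
    fix C assume C: "C \<in> matchings A1 B1" "C \<subseteq> E"
    have "r1 \<in> A1" "r3 \<in> A1" "r4 \<in> A1" "r5 \<in> A1" by (simp_all add: defs)
    then obtain l1 l3 l4 l5 where l: "(r1, l1) \<in> C" "(r3, l3) \<in> C" "(r4, l4) \<in> C" "(r5, l5) \<in> C" "l5 \<in> B1"
      using matchings_rowE[OF C(1)] by metis
    moreover have "c2 \<notin> B1" using c by (simp add: defs)
    ultimately have "l1 = c5" "l3 = c3" "l4 = c4" "l5 = c1"
      using E1 E3 E4 E5 C(2) by blast+
    then show "{(r1, c5), (r3, c3), (r4, c4), (r5, c1)} \<subseteq> C" using l by simp
  qed
  have M2: "mn (ind E) A2 B2 = 0"
  proof (rule mn_ind_zero[OF fin(3,4) card(2)])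
    fix C assume C: "C \<in> matchings A2 B2"
    show "\<not> C \<subseteq> E"
    proof
      assume CE: "C \<subseteq> E"
      have "r1 \<in> A2" "r2 \<in> A2" by (simp_all add: defs)
      then obtain l1 l2 where l: "(r1, l1) \<in> C" "(r2, l2) \<in> C"
        using matchings_rowE[OF C] by metis
      then have "l1 = c5" "l2 = c5" using E1 E2 CE by blast+
      then show False using matchings_col_unique[OF C] l r by fastforce
    qed
  qed
  have M2': "mn (ind (insert (r1, c4) E)) A2 B2 \<noteq> 0"
  proof (rule mn_ind_nonzero_forced[OF fin(3) card(2)])
    show "{(r1, c4), (r2, c5), (r3, c3)} \<in> matchings A2 B2"
      by (rule matchingsI) (use r c in \<open>auto simp: defs\<close>)
    show "{(r1, c4), (r2, c5), (r3, c3)} \<subseteq> insert (r1, c4) E" by (auto simp: E_def)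
    fix C assume C: "C \<in> matchings A2 B2" "C \<subseteq> insert (r1, c4) E"
    have "r1 \<in> A2" "r2 \<in> A2" "r3 \<in> A2" by (simp_all add: defs)
    then obtain l1 l2 l3 where l: "(r1, l1) \<in> C" "(r2, l2) \<in> C" "(r3, l3) \<in> C"
      using matchings_rowE[OF C(1)] by metis
    then have "(r2, l2) \<in> E" "(r3, l3) \<in> E" using C(2) r by auto
    then have eq: "l2 = c5" "l3 = c3" using E2 E3 by blast+
    then have "l1 \<noteq> c5" using matchings_col_unique[OF C(1) l(1), of r2] l(2) r by auto
    then have "l1 = c4" using l(1) C(2) E1[of l1] by auto
    then show "{(r1, c4), (r2, c5), (r3, c3)} \<subseteq> C" using l eq by simp
  qed
  have M3: "mn (ind E) A3 B3 = 0"
  proof (rule mn_ind_zero_row[OF fin(5,6) card(3), of r4])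
    have "c4 \<notin> B3" using c by (simp add: defs)
    then show "(r4, l) \<notin> E" if "l \<in> B3" for l using E4[of l] that by blast
  qed (simp add: defs)
  have M3': "mn (ind (insert (r4, c1) E)) A3 B3 \<noteq> 0"
  proof (rule mn_ind_nonzero_forced[OF fin(5) card(3)])
    show "{(r3, c3), (r4, c1), (r5, c2)} \<in> matchings A3 B3"
      by (rule matchingsI) (use r c in \<open>auto simp: defs\<close>)
    show "{(r3, c3), (r4, c1), (r5, c2)} \<subseteq> insert (r4, c1) E" by (auto simp: E_def)
    fix C assume C: "C \<in> matchings A3 B3" "C \<subseteq> insert (r4, c1) E"
    have "r3 \<in> A3" "r4 \<in> A3" "r5 \<in> A3" by (simp_all add: defs)
    then obtain l3 l4 l5 where l: "(r3, l3) \<in> C" "(r4, l4) \<in> C" "(r5, l5) \<in> C" "l4 \<in> B3"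
      using matchings_rowE[OF C(1)] by metis
    then have in_E: "(r3, l3) \<in> E" "(r5, l5) \<in> E" using C(2) r by auto
    have "c4 \<notin> B3" using c by (simp add: defs)
    then have "l4 = c1" using l(2,4) C(2) E4[of l4] by auto
    moreover from this have "l5 \<noteq> c1" using matchings_col_unique[OF C(1) l(3), of r4] l(2) r by auto
    ultimately have "l3 = c3" "l4 = c1" "l5 = c2" using E3[OF in_E(1)] E5[OF in_E(2)] by blast+
    then show "{(r3, c3), (r4, c1), (r5, c2)} \<subseteq> C" using l by simp
  qed
  let ?T = "(A1 \<times> B1 \<union> A2 \<times> B2 \<union> A3 \<times> B3) - zero_cells D - {(r1, c4), (r4, c1)}"
  have T: "(k = r1 \<and> l = c5) \<or> (k = r2 \<and> l \<in> {c3, c4, c5}) \<or> (k = r3 \<and> l \<in> {c2, c3, c4, c5}) \<or>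
      (k = r4 \<and> l \<in> {c2, c3, c4, c5}) \<or> (k = r5 \<and> l \<in> {c1, c2, c3, c4, c5})" if kl: "(k, l) \<in> ?T" for k l
  proof -
    have "\<not> (r1 \<le> r1 \<and> c4 \<le> c3)" "\<not> (r4 \<le> r1)" "\<not> (r2 \<le> r1)" "\<not> (r4 \<le> r3)" "\<not> c2 \<le> c1" "\<not> c4 \<le> c1"
      using r c by simp_all
    then have "rk D r1 c1 = 0" "rk D r1 c3 = 0" "rk D r3 c1 = 0" by (simp_all add: rk0_iff)
    then show ?thesis
      using kl by (auto simp: defs zero_cells_def)
  qed
  have "\<not> bad D ?T"
  proof
    assume "bad D ?T"
    then obtain C i j where C: "C \<subseteq> ?T" "finite C" "C \<subseteq> {..i} \<times> {..j}" "chain D C" "rk D i j < card C"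
      unfolding bad_def by blast
    have CT: "(k = r1 \<and> l = c5) \<or> (k = r2 \<and> l \<in> {c3, c4, c5}) \<or> (k = r3 \<and> l \<in> {c2, c3, c4, c5}) \<or>
      (k = r4 \<and> l \<in> {c2, c3, c4, c5}) \<or> (k = r5 \<and> l \<in> {c1, c2, c3, c4, c5})" if "(k, l) \<in> C" for k l
      by (rule T) (use C(1) that in blast)
    have ij: "k \<le> i" "l \<le> j" if "(k, l) \<in> C" for k l using C(3) that by auto
    have inv: "\<not> (r1 \<le> k \<and> c4 \<le> l')" "\<not> (r2 \<le> k \<and> c2 \<le> l')" "\<not> (r4 \<le> k \<and> c1 \<le> l')"
      if "(k, l) \<in> C" "(k', l') \<in> C" "k < k'" "l' < l" for k l k' l'
    proof -
      have "rk D (fst (k, l)) (snd (k', l')) = 0"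
        using C(4) that unfolding chain_def by (metis fst_conv snd_conv)
      then show "\<not> (r1 \<le> k \<and> c4 \<le> l')" "\<not> (r2 \<le> k \<and> c2 \<le> l')" "\<not> (r4 \<le> k \<and> c1 \<le> l')"
        by (simp_all add: rk0_iff)
    qed
    have cu: "k = k'" if "(k, l) \<in> C" "(k', l) \<in> C" for k k' l
      using C(4) that unfolding chain_def inj_on_def by fastforce
    have ru: "l = l'" if "(k, l) \<in> C" "(k, l') \<in> C" for k l l'
      using C(4) that unfolding chain_def inj_on_def by fastforce
    have cardC: "card (fst ` C) = card C" "card (snd ` C) = card C"
      using C(4) by (simp_all add: chain_def card_image)
    have rowsC: "fst ` C \<subseteq> {r1, r2, r3, r4, r5}" and colsC: "snd ` C \<subseteq> {c1, c2, c3, c4, c5}"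
      using CT by fastforce+
    have R1: "l = c5" if "(r1, l) \<in> C" for l using CT[OF that] r by auto
    have L1: "k = r5" if "(k, c1) \<in> C" for k using CT[OF that] c by auto
    \<comment> \<open>\<open>P3\<close>, \<open>P2\<close> and \<open>P2'\<close> say that a chain
      cannot use both the row and the column of a minimum. \<open>P1\<close> and its transpose
      \<open>P1'\<close> deduce that it cannot use all of the first three rows, nor all of the first
      three columns.\<close>
    have P3: False if "(r2, l) \<in> C" "(k, c2) \<in> C" for k l
      using inv(2)[OF that] CT[OF that(1)] CT[OF that(2)] r c by auto
    have P2: False if "(k, c1) \<in> C" "(r4, l) \<in> C" for k l
      using inv(3)[OF that(2,1)] CT[OF that(2)] L1[OF that(1)] r c by auto
    have P2': False if "(r1, l) \<in> C" "(k, c4) \<in> C" for k l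
      using inv(1)[OF that] CT[OF that(2)] R1[OF that(1)] r c by auto
    have P1: False if t: "r1 \<in> fst ` C" "r2 \<in> fst ` C" "r3 \<in> fst ` C"
    proof -
      obtain l1 l2 l3 where l: "(r1, l1) \<in> C" "(r2, l2) \<in> C" "(r3, l3) \<in> C" using t by auto
      have "l2 \<noteq> c5" "l3 \<noteq> c5" using cu[of r1 c5] l R1[OF l(1)] r by fastforce+
      moreover have "l2 \<noteq> c4" "l3 \<noteq> c4" using P2' l by blast+
      ultimately have "l2 = c3" "l3 = c2 \<or> l3 = c3" using CT[OF l(2)] CT[OF l(3)] r by auto
      moreover have "l3 \<noteq> c2" using P3 l by blast
      ultimately show False using cu[of r2 c3 r3] l r by auto
    qed
    have P1': False if t: "c1 \<in> snd ` C" "c2 \<in> snd ` C" "c3 \<in> snd ` C"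
    proof -
      obtain k1 k2 k3 where k: "(k1, c1) \<in> C" "(k2, c2) \<in> C" "(k3, c3) \<in> C" using t by auto
      have "k2 \<noteq> r5" "k3 \<noteq> r5" using ru[of r5 c1] k L1[OF k(1)] c by fastforce+
      moreover have "k2 \<noteq> r4" "k3 \<noteq> r4" using P2 k by blast+
      ultimately have "k2 = r3" "k3 = r2 \<or> k3 = r3" using CT[OF k(2)] CT[OF k(3)] c by auto
      moreover have "k3 \<noteq> r2" using P3 k by blast
      ultimately show False using ru[of r3 c2 c3] k c by auto
    qed
    have rkge: "card S \<le> rk D i j" if "S \<subseteq> D" "S \<subseteq> {..i} \<times> {..j}" for S
      unfolding rk_def by (rule card_mono) (use that fD in auto)
    have full: "S = S'" if "S \<subseteq> S'" "card S' \<le> m" "m \<le> card S" "finite S'" for S S' :: "nat set" and m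
      using card_seteq[OF that(4,1)] that(2,3) by simp
    have ne: "C \<noteq> {}" using C(5) by auto
    \<comment> \<open>The minima inside a box bound its rank from below and thereby the size of the
      chain.\<close>
    consider "i < r2" | "r2 \<le> i" "j < c2" | "r2 \<le> i" "i < r4" "c2 \<le> j" "j < c4" | "r2 \<le> i" "i < r4" "c4 \<le> j"
      | "r4 \<le> i" "c2 \<le> j" "j < c4" | "r4 \<le> i" "c4 \<le> j" by linarith
    then show False
    proof cases
      case 1
      have all: "(k, l) = (r1, c5)" if "(k, l) \<in> C" for k l using CT[OF that] ij[OF that] 1 r by auto
      then have "C \<subseteq> {(r1, c5)}" by auto
      with ne have "C = {(r1, c5)}" by auto
      then have "card {(r1, c4)} \<le> rk D i j" using ij[of r1 c5] dots(1) c by (intro rkge) auto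
      then show False using C(5) \<open>C = _\<close> by simp
    next
      case 2
      have all: "(k, l) = (r5, c1)" if "(k, l) \<in> C" for k l using CT[OF that] ij[OF that] 2 c by auto
      then have "C \<subseteq> {(r5, c1)}" by auto
      with ne have "C = {(r5, c1)}" by auto
      then have "card {(r4, c1)} \<le> rk D i j" using ij[of r5 c1] dots(4) r by (intro rkge) auto
      then show False using C(5) \<open>C = _\<close> by simp
    next
      case 3
      have "card {(r2, c2)} \<le> rk D i j" using dots(2) 3 by (intro rkge) auto
      then have "2 \<le> card C" using C(5) by simp
      have row: "(k = r2 \<or> k = r3) \<and> (l = c2 \<or> l = c3)" if "(k, l) \<in> C" for k l
        using CT[OF that] ij[OF that] 3 r c by auto
      then have "fst ` C \<subseteq> {r2, r3}" "snd ` C \<subseteq> {c2, c3}" by fastforce+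
      then have "fst ` C = {r2, r3}" "snd ` C = {c2, c3}"
        using \<open>2 \<le> card C\<close> cardC by (intro full[of _ _ 2] card_le_2; simp)+
      then have "r2 \<in> fst ` C" "c2 \<in> snd ` C" by simp_all
      then show False using P3 by auto
    next
      case 4
      have "card {(r1, c4), (r2, c2)} \<le> rk D i j" using dots(1,2) 4 r c by (intro rkge) auto
      then have "3 \<le> card C" using C(5) r by simp
      have "k \<in> {r1, r2, r3}" if "(k, l) \<in> C" for k l
        using CT[OF that] ij[OF that] 4 r by auto
      then have "fst ` C \<subseteq> {r1, r2, r3}" by fastforce
      then have "fst ` C = {r1, r2, r3}"
        using \<open>3 \<le> card C\<close> cardC by (intro full[of _ _ 3] card_le_3; simp)
      then show False using P1 by simp
    next
      case 5
      have "card {(r2, c2), (r4, c1)} \<le> rk D i j" using dots(2,4) 5 r c by (intro rkge) auto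
      then have "3 \<le> card C" using C(5) r by simp
      have "l \<in> {c1, c2, c3}" if "(k, l) \<in> C" for k l
        using CT[OF that] ij[OF that] 5 c by auto
      then have "snd ` C \<subseteq> {c1, c2, c3}" by fastforce
      then have "snd ` C = {c1, c2, c3}"
        using \<open>3 \<le> card C\<close> cardC by (intro full[of _ _ 3] card_le_3; simp)
      then show False using P1' by simp
    next
      case 6
      have "card {(r1, c4), (r2, c2), (r4, c1)} \<le> rk D i j" using dots(1,2,4) 6 r c by (intro rkge) auto
      then have four: "4 \<le> card C" using C(5) r by simp
      \<comment> \<open>Four cells within five rows: row \<open>r4\<close> is used, since otherwise
        the first three rows all are. This excludes column \<open>c1\<close>, so columns
        \<open>c2\<close> to \<open>c5\<close> are used; \<open>c4\<close> excludes row
        \<open>r1\<close>, and then row \<open>r2\<close> is used together with column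
        \<open>c2\<close>.\<close>
      have "r4 \<in> fst ` C"
      proof (rule ccontr)
        assume "r4 \<notin> fst ` C"
        then have "fst ` C \<subseteq> {r1, r2, r3, r5}" using rowsC by blast
        then have "fst ` C = {r1, r2, r3, r5}" using four cardC by (intro full[of _ _ 4] card_le_4; simp)
        then show False using P1 by simp
      qed
      then have "c1 \<notin> snd ` C" using P2 by auto
      then have "snd ` C \<subseteq> {c2, c3, c4, c5}" using colsC by blast
      then have sC: "snd ` C = {c2, c3, c4, c5}" using four cardC by (intro full[of _ _ 4] card_le_4; simp)
      then have "c4 \<in> snd ` C" "c2 \<in> snd ` C" by simp_all
      then have "r1 \<notin> fst ` C" using P2' by auto
      then have "fst ` C \<subseteq> {r2, r3, r4, r5}" using rowsC by blast
      then have "fst ` C = {r2, r3, r4, r5}" using four cardC by (intro full[of _ _ 4] card_le_4; simp)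
      then have "r2 \<in> fst ` C" by simp
      with \<open>c2 \<in> snd ` C\<close> show False using P3 by auto
    qed
  qed
  then show ?thesis
    by (rule elim_good2[OF idx zero acN(1) acE(1) acN(2) acE(2) a3 M1 M2 M2' M3 M3'])
qed

subsection \<open>Left-to-right minima\<close>

definition lr_min :: "cell set \<Rightarrow> cell \<Rightarrow> bool" where
  "lr_min D z \<longleftrightarrow> z \<in> D \<and> (\<forall>x\<in>D. \<not> (fst x < fst z \<and> snd x < snd z))"

lemma lr_min_below: "x \<in> D \<Longrightarrow> \<exists>z. lr_min D z \<and> fst z \<le> fst x \<and> snd z \<le> snd x"
proof (induction "fst x" arbitrary: x rule: less_induct)
  case less
  show ?case
  proof (cases "lr_min D x")
    case False
    then obtain y where "y \<in> D" "fst y < fst x" "snd y < snd x"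
      using less.prems by (auto simp: lr_min_def)
    with less.hyps[of y] show ?thesis by force
  next
    case True
    then show ?thesis by blast
  qed
qed

lemma lr_min_tr: "lr_min (tr D) z \<longleftrightarrow> lr_min D (prod.swap z)"
  by (cases z) (auto simp: lr_min_def)

text \<open>Here \<open>S\<close> are the dots of a configuration that does not survive the deletion of a
  left-to-right minimum.\<close>

lemma lr_min_config:
  assumes irr: "Collect (lr_min D) \<subseteq> S" and M: "M \<subseteq> D"
    and S: "\<forall>s\<in>S. s \<in> M \<or> (\<exists>m\<in>M. fst m < fst s \<and> snd m < snd s)"
  shows "\<forall>x\<in>D. \<exists>m\<in>M. fst m \<le> fst x \<and> snd m \<le> snd x"
    and "\<forall>x\<in>M. (\<forall>m\<in>M. fst m \<le> fst x \<and> snd m \<le> snd x \<longrightarrow> m = x) \<longrightarrow> lr_min D x"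
proof -
  have lr: "z \<in> M" if "lr_min D z" for z
  proof -
    have "z \<in> M \<or> (\<exists>m\<in>M. fst m < fst z \<and> snd m < snd z)" using S irr that by blast
    moreover have "\<not> (fst m < fst z \<and> snd m < snd z)" if "m \<in> M" for m
      using \<open>lr_min D z\<close> M that unfolding lr_min_def by blast
    ultimately show ?thesis by blast
  qed
  show "\<forall>x\<in>D. \<exists>m\<in>M. fst m \<le> fst x \<and> snd m \<le> snd x"
    using lr_min_below lr by blast
  show "\<forall>x\<in>M. (\<forall>m\<in>M. fst m \<le> fst x \<and> snd m \<le> snd x \<longrightarrow> m = x) \<longrightarrow> lr_min D x"
  proof (intro ballI impI)
    fix x assume x: "x \<in> M" "\<forall>m\<in>M. fst m \<le> fst x \<and> snd m \<le> snd x \<longrightarrow> m = x"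
    obtain z where z: "lr_min D z" "fst z \<le> fst x" "snd z \<le> snd x"
      using lr_min_below[OF subsetD[OF M x(1)]] by blast
    then have "z = x" using x(2) lr[OF z(1)] by blast
    with z show "lr_min D x" by simp
  qed
qed

subsection \<open>Irreducible configurations\<close>

lemma (in diag_order) irreducible_13254:
  assumes D: "pperm n D" and conf: "conf_13254 D"
    and irr: "\<And>z. lr_min D z \<Longrightarrow> \<not> conf_13254 (D - {z})"
  shows "good D"
proof -
  obtain p1 p2 p3 p4 p5 v1 v2 v3 v4 v5 where
    "{(p1, v1), (p2, v3), (p3, v2), (p4, v5), (p5, v4)} \<subseteq> D \<and>
    p1 < p2 \<and> p2 < p3 \<and> p3 < p4 \<and> p4 < p5 \<and> v1 < v2 \<and> v2 < v3 \<and> v3 < v4 \<and> v4 < v5"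
    using conf unfolding conf_13254_def by (elim exE) (rule that)
  then have c:
    "(p1, v1) \<in> D" "(p2, v3) \<in> D" "(p3, v2) \<in> D" "(p4, v5) \<in> D" "(p5, v4) \<in> D"
    "p1 < p2" "p2 < p3" "p3 < p4" "p4 < p5" "v1 < v2" "v2 < v3" "v3 < v4" "v4 < v5"
    by simp_all
  let ?S = "{(p1, v1), (p2, v3), (p3, v2), (p4, v5), (p5, v4)}"
  \<comment> \<open>A minimum outside the chosen occurrence could be deleted without destroying it.
    The other irreducible cases begin in the same way.\<close>
  have S: "Collect (lr_min D) \<subseteq> ?S"
  proof (rule subsetI, rule ccontr)
    fix z assume z: "z \<in> Collect (lr_min D)" "z \<notin> ?S"
    have "conf_13254 (D - {z})"
      by (intro conf_13254I[of p1 v1 _ p2 v3 p3 v2 p4 v5 p5 v4]) (use c z(2) in auto)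
    then show False using irr z(1) by simp
  qed
  have "\<forall>x\<in>D. \<exists>m\<in>{(p1, v1)}. fst m \<le> fst x \<and> snd m \<le> snd x"
    by (rule lr_min_config(1)[OF S]) (use c in auto)
  then show ?thesis
    using good_13254[OF D c] by simp
qed

text \<open>The remaining dots \<open>S\<close> of the configuration lie south-east of
  \<open>(r, g2)\<close> and so cannot be minima; this leaves the two given dots.\<close>

lemma two_minI:
  assumes D: "pperm n D" and dots: "(r, g2) \<in> D" "(al, g1) \<in> D" and ineq: "r < al" "g1 < g2"
    and irr: "Collect (lr_min D) \<subseteq> insert (r, g2) (insert (al, g1) S)"
    and S: "\<forall>s\<in>S. r < fst s \<and> g2 < snd s"
  shows "two_min n D r g2 al g1" "lr_min D (r, g2)" "lr_min D (al, g1)"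
proof -
  let ?M = "{(r, g2), (al, g1)}" and ?S = "insert (r, g2) (insert (al, g1) S)"
  have M: "?M \<subseteq> D" using dots by simp
  have dom: "\<forall>s\<in>?S. s \<in> ?M \<or> (\<exists>m\<in>?M. fst m < fst s \<and> snd m < snd s)"
    using S by simp
  note lr = lr_min_config[OF irr M dom]
  show "two_min n D r g2 al g1"
  proof
    show "r \<le> fst z \<and> g2 \<le> snd z \<or> al \<le> fst z \<and> g1 \<le> snd z" if "z \<in> D" for z
      using bspec[OF lr(1) that] by simp
  qed (rule D dots ineq)+
  show "lr_min D (r, g2)" "lr_min D (al, g1)"
    using lr(2) ineq by simp_all
qed

lemma irreducible_up:
  assumes D: "pperm n D" and conf: "conf_up D" and no: "\<not> conf_13254 D"
    and irr: "\<And>z. lr_min D z \<Longrightarrow> \<not> conf_up (D - {z})"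
  shows "elim_good D"
proof -
  obtain r g2 al g1 x e p pe r3 q r5 y where
    "{(r, g2), (al, g1), (x, e), (p, pe), (r3, q), (r5, y)} \<subseteq> D \<and>
    r < al \<and> al < p \<and> r < x \<and> x < p \<and> p < r3 \<and> p < r5 \<and>
    g1 < g2 \<and> g2 < q \<and> q < e \<and> e < y \<and> y < pe"
    using conf unfolding conf_up_def by (elim exE) (rule that)
  then have c:
    "(r, g2) \<in> D" "(al, g1) \<in> D" "(x, e) \<in> D" "(p, pe) \<in> D" "(r3, q) \<in> D" "(r5, y) \<in> D"
    "r < al" "al < p" "r < x" "x < p" "p < r3" "p < r5" "g1 < g2" "g2 < q" "q < e" "e < y" "y < pe"
    by simp_all
  let ?S = "{(x, e), (p, pe), (r3, q), (r5, y)}"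
  have S: "Collect (lr_min D) \<subseteq> insert (r, g2) (insert (al, g1) ?S)"
  proof (rule subsetI, rule ccontr)
    fix z assume z: "z \<in> Collect (lr_min D)" "z \<notin> insert (r, g2) (insert (al, g1) ?S)"
    have "conf_up (D - {z})"
      by (intro conf_upI[of r g2 _ al g1 x e p pe r3 q r5 y]) (use c z(2) in auto)
    then show False using irr z(1) by simp
  qed
  have T: "\<forall>s\<in>?S. r < fst s \<and> g2 < snd s"
    using c by simp
  note two_min = two_minI[OF D c(1,2,7,13) S T]
  interpret two_min n D r g2 al g1 by (rule two_min)
  show ?thesis
    by (rule elim_good_up[OF c(3-6,8-12,14-17) no irr[OF two_min(2)] irr[OF two_min(3)]])
qed

lemma conf_13254_tr:
  assumes "conf_13254 (tr D)"
  shows "conf_13254 D"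
proof -
  obtain p1 p2 p3 p4 p5 v1 v2 v3 v4 v5 where
    "{(p1, v1), (p2, v3), (p3, v2), (p4, v5), (p5, v4)} \<subseteq> tr D \<and>
    p1 < p2 \<and> p2 < p3 \<and> p3 < p4 \<and> p4 < p5 \<and> v1 < v2 \<and> v2 < v3 \<and> v3 < v4 \<and> v4 < v5"
    using assms unfolding conf_13254_def[of "tr D"] by (elim exE) (rule that)
  then show ?thesis
    by (intro conf_13254I[of v1 p1 _ v2 p3 v3 p2 v4 p5 v5 p4])
      (simp_all only: insert_subset mem_tr)
qed

lemma irreducible_up_tr:
  assumes D: "pperm n D" and conf: "conf_up (tr D)" and no: "\<not> conf_13254 D"
    and irr: "\<And>z. lr_min D z \<Longrightarrow> \<not> conf_up (tr (D - {z}))"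
  shows "elim_good D"
proof (rule elim_good_tr, rule irreducible_up[OF pperm_tr[OF D] conf])
  show "\<not> conf_13254 (tr D)" using no conf_13254_tr by blast
  show "\<not> conf_up (tr D - {z})" if "lr_min (tr D) z" for z
  proof -
    have "tr D - {z} = tr (D - {prod.swap z})" by (cases z) auto
    then show ?thesis using irr[of "prod.swap z"] that lr_min_tr by simp
  qed
qed

text \<open>A dot that would make the two ranks in \<open>elim_good_hook\<close> differ completes
  \<open>conf_up\<close> or its transpose.\<close>

lemma irreducible_hook:
  assumes D: "pperm n D" and conf: "conf_hook D" and no: "\<not> conf_13254 D"
    and up: "\<not> conf_up D" and up_tr: "\<not> conf_up (tr D)"
    and irr: "\<And>z. lr_min D z \<Longrightarrow> \<not> conf_hook (D - {z})"
  shows "elim_good D"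
proof -
  obtain r g2 al g1 p pe p4 pe4 r3 q r5 y where
    "{(r, g2), (al, g1), (p, pe), (p4, pe4), (r3, q), (r5, y)} \<subseteq> D \<and>
    r < al \<and> al < p \<and> p < p4 \<and> p4 < r3 \<and> p < r5 \<and>
    g1 < g2 \<and> g2 < q \<and> q < y \<and> y < pe \<and> q < pe4"
    using conf unfolding conf_hook_def by (elim exE) (rule that)
  then have c:
    "(r, g2) \<in> D" "(al, g1) \<in> D" "(p, pe) \<in> D" "(p4, pe4) \<in> D" "(r3, q) \<in> D" "(r5, y) \<in> D"
    "r < al" "al < p" "p < p4" "p4 < r3" "p < r5" "g1 < g2" "g2 < q" "q < y" "y < pe" "q < pe4"
    by simp_all
  let ?S = "{(p, pe), (p4, pe4), (r3, q), (r5, y)}"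
  have S: "Collect (lr_min D) \<subseteq> insert (r, g2) (insert (al, g1) ?S)"
  proof (rule subsetI, rule ccontr)
    fix z assume z: "z \<in> Collect (lr_min D)" "z \<notin> insert (r, g2) (insert (al, g1) ?S)"
    have "conf_hook (D - {z})"
      by (intro conf_hookI[of r g2 _ al g1 p pe p4 pe4 r3 q r5 y]) (use c z(2) in auto)
    then show False using irr z(1) by simp
  qed
  have T: "\<forall>s\<in>?S. r < fst s \<and> g2 < snd s"
    using c by simp
  note two_min = two_minI[OF D c(1,2,7,12) S T]
  interpret two_min n D r g2 al g1 by (rule two_min)
  have no_right: "snd z < q" if z: "z \<in> D" "fst z < p" "snd z < y" for z
  proof (rule ccontr)
    assume "\<not> snd z < q"
    moreover have "snd z \<noteq> q" using col_fst[OF z(1) c(5)] z(2) c by auto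
    ultimately have q: "q < snd z" by simp
    have "fst z \<noteq> r" using row_snd[OF z(1) c(1)] q c by auto
    then have "r < fst z" using se[OF z(1)] c by auto
    then have "conf_up D"
      by (intro conf_upI[of r g2 _ al g1 "fst z" "snd z" p pe r3 q r5 y]) (use c z q in auto)
    then show False using up by simp
  qed
  have no_down: "fst z < p" if z: "z \<in> D" "fst z < p4" "snd z < q" for z
  proof (rule ccontr)
    assume "\<not> fst z < p"
    moreover have "fst z \<noteq> p" using row_snd[OF z(1) c(3)] z(3) c by auto
    ultimately have p: "p < fst z" by simp
    have "snd z \<noteq> g1" using col_fst[OF z(1) c(2)] p c by auto
    then have "g1 < snd z" using se[OF z(1)] c by auto
    then have "conf_up (tr D)"
      by (intro conf_upI[of g1 al _ g2 r "snd z" "fst z" q r3 pe p pe4 p4]) (use c z p in auto)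
    then show False using up_tr by simp
  qed
  show ?thesis
    by (rule elim_good_hook[OF c(3-6,8-11,13-16) no irr[OF two_min(2)] irr[OF two_min(3)] no_right no_down])
qed

lemma irreducible_7:
  assumes D: "pperm n D" and conf: "conf_7 D"
    and up: "\<not> conf_up D" and up_tr: "\<not> conf_up (tr D)"
    and irr: "\<And>z. lr_min D z \<Longrightarrow> \<not> conf_7 (D - {z})"
  shows "elim_good D"
proof -
  obtain r1 r2 r3 r4 r5 r6 r7 c1 c2 c3 c4 c5 c6 c7 where
    "{(r1, c4), (r2, c2), (r3, c6), (r4, c1), (r5, c7), (r6, c3), (r7, c5)} \<subseteq> D \<and>
    r1 < r2 \<and> r2 < r3 \<and> r3 < r4 \<and> r4 < r5 \<and> r5 < r6 \<and> r6 < r7 \<and>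
    c1 < c2 \<and> c2 < c3 \<and> c3 < c4 \<and> c4 < c5 \<and> c5 < c6 \<and> c6 < c7"
    using conf unfolding conf_7_def by (elim exE) (rule that)
  then have d: "(r1, c4) \<in> D" "(r2, c2) \<in> D" "(r3, c6) \<in> D" "(r4, c1) \<in> D" "(r5, c7) \<in> D" "(r6, c3) \<in> D" "(r7, c5) \<in> D"
    and r: "r1 < r2" "r2 < r3" "r3 < r4" "r4 < r5" "r5 < r6" "r6 < r7"
    and c: "c1 < c2" "c2 < c3" "c3 < c4" "c4 < c5" "c5 < c6" "c6 < c7"
    by simp_all
  let ?S = "{(r1, c4), (r2, c2), (r3, c6), (r4, c1), (r5, c7), (r6, c3), (r7, c5)}"
  let ?M = "{(r1, c4), (r2, c2), (r4, c1)}"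
  have S: "Collect (lr_min D) \<subseteq> ?S"
  proof (rule subsetI, rule ccontr)
    fix z assume z: "z \<in> Collect (lr_min D)" "z \<notin> ?S"
    have "conf_7 (D - {z})"
      by (intro conf_7I[of r1 c4 _ r2 c2 r3 c6 r4 c1 r5 c7 r6 c3 r7 c5]) (use d r c z(2) in auto)
    then show False using irr z(1) by simp
  qed
  have M: "?M \<subseteq> D" using d by simp
  have dom: "\<forall>s\<in>?S. s \<in> ?M \<or> (\<exists>m\<in>?M. fst m < fst s \<and> snd m < snd s)"
    using r c by simp
  note lr = lr_min_config[OF S M dom]
  have min: "lr_min D (r1, c4)" "lr_min D (r2, c2)" "lr_min D (r4, c1)"
    using lr(2) r c by simp_all
  have se: "(r1 \<le> fst z \<and> c4 \<le> snd z) \<or> (r2 \<le> fst z \<and> c2 \<le> snd z) \<or> (r4 \<le> fst z \<and> c1 \<le> snd z)"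
    if "z \<in> D" for z
    using bspec[OF lr(1) that] by simp
  have row_snd: "snd x = snd y" if "x \<in> D" "y \<in> D" "fst x = fst y" for x y
    using D that unfolding pperm_def inj_on_def by blast
  have col_fst: "fst x = fst y" if "x \<in> D" "y \<in> D" "snd x = snd y" for x y
    using D that unfolding pperm_def inj_on_def by blast
  \<comment> \<open>A further dot north-west of \<open>(r5, c5)\<close> either replaces a minimum in
    the pattern (1 to 3) or completes \<open>conf_up\<close> (4) or its transpose (5). The staircase
    of minima leaves it no other place.\<close>
  have "z \<in> ?M" if z: "z \<in> D" "fst z < r5" "snd z < c5" for z
  proof (rule ccontr)
    assume zM: "z \<notin> ?M"
    obtain i j where ij: "z = (i, j)" by (cases z)
    have D: "(i, j) \<in> D" and less: "i < r5" "j < c5" using z ij by auto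
    have neq: "i \<noteq> fst m \<and> j \<noteq> snd m" if m: "m \<in> ?M" for m
    proof -
      have "m \<in> D" using M m by (rule subsetD)
      then have "m = (i, j)" if "i = fst m \<or> j = snd m"
        using that row_snd[OF D, of m] col_fst[OF D, of m] by (cases m) auto
      moreover have "m \<noteq> (i, j)"
      proof
        assume "m = (i, j)"
        with m have "z \<in> ?M" unfolding ij by simp
        with zM show False by (rule notE)
      qed
      ultimately show ?thesis by metis
    qed
    have new: "i \<noteq> r1" "i \<noteq> r2" "i \<noteq> r4" "j \<noteq> c4" "j \<noteq> c2" "j \<noteq> c1"
      using neq[of "(r1, c4)"] neq[of "(r2, c2)"] neq[of "(r4, c1)"] by simp_all
    have new': "i \<noteq> r3" "j \<noteq> c3"
      using row_snd[OF D d(3)] less(2) c(5) col_fst[OF D d(6)] less(1) r(5) by auto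
    have 1: "\<not> (i < r2 \<and> r1 < i \<and> c4 < j)"
    proof
      assume a: "i < r2 \<and> r1 < i \<and> c4 < j"
      have "conf_7 (D - {(r1, c4)})"
        by (rule conf_7I[of i j _ r2 c2 r3 c6 r4 c1 r5 c7 r6 c3 r7 c5]) (use d D a less r c in auto)
      then show False using irr[OF min(1)] by simp
    qed
    have 2: "\<not> (r2 < i \<and> i < r3 \<and> c2 < j \<and> j < c3)"
    proof
      assume a: "r2 < i \<and> i < r3 \<and> c2 < j \<and> j < c3"
      have "conf_7 (D - {(r2, c2)})"
        by (rule conf_7I[of r1 c4 _ i j r3 c6 r4 c1 r5 c7 r6 c3 r7 c5]) (use d D a less r c in auto)
      then show False using irr[OF min(2)] by simp
    qed
    have 3: "\<not> (r4 < i \<and> c1 < j \<and> j < c2)"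
    proof
      assume a: "r4 < i \<and> c1 < j \<and> j < c2"
      have "conf_7 (D - {(r4, c1)})"
        by (rule conf_7I[of r1 c4 _ r2 c2 r3 c6 i j r5 c7 r6 c3 r7 c5]) (use d D a less r c in auto)
      then show False using irr[OF min(3)] by simp
    qed
    have 4: "\<not> (r2 < i \<and> c3 < j)"
    proof
      assume a: "r2 < i \<and> c3 < j"
      have "conf_up D"
        by (rule conf_upI[of r2 c2 _ r4 c1 i j r5 c7 r6 c3 r7 c5]) (use d D a less r c in auto)
      then show False using up by simp
    qed
    have 5: "\<not> (r3 < i \<and> c2 < j)"
    proof
      assume a: "r3 < i \<and> c2 < j"
      have "conf_up (tr D)"
        by (rule conf_upI[of c2 r2 _ c4 r1 j i c5 r7 c6 r3 c7 r5]) (use d D a less r c in auto)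
      then show False using up_tr by simp
    qed
    have "(r1 < i \<and> c4 < j) \<or> (r2 < i \<and> c2 < j) \<or> (r4 < i \<and> c1 < j)"
      using se[OF D] new by auto
    then show False
    proof (elim disjE conjE)
      assume a: "r1 < i" "c4 < j"
      then have "r2 < i" using 1 new(2) by linarith
      with 4 a c show False by linarith
    next
      assume a: "r2 < i" "c2 < j"
      then have "i < r3" using 5 new'(1) by linarith
      with 2 a have "c3 < j" using new'(2) by linarith
      with 4 a show False by simp
    next
      assume a: "r4 < i" "c1 < j"
      then have "c2 < j" using 3 new(5) by linarith
      with 5 a r show False by linarith
    qed
  qed
  then show ?thesis using elim_good_7[OF D d r c] se by blast
qed

subsection \<open>From patterns to good dot sets\<close>

text \<open>Only \<open>conf_up\<close> is listed with its transpose; the other three configurations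
  are symmetric.\<close>

definition conf :: "cell set \<Rightarrow> bool" where
  "conf D \<longleftrightarrow> conf_13254 D \<or> conf_up D \<or> conf_up (tr D) \<or> conf_hook D \<or> conf_7 D"

text \<open>Induction on the number of dots. The order of the cases matters: \<open>conf_up\<close>
  and its transpose are treated when 13254 is absent, \<open>conf_hook\<close> and
  \<open>conf_7\<close> when these are absent too.\<close>

lemma (in diag_order) conf_good:
  assumes "pperm n D" "conf D"
  shows "good D"
  using assms
proof (induction "card D" arbitrary: D rule: less_induct)
  case less
  note D = less.prems(1)
  show ?case
  proof (cases "\<exists>z. lr_min D z \<and> conf (D - {z})")
    case True
    then obtain z where z: "lr_min D z" "conf (D - {z})" by blast
    have zD: "z \<in> D" using z(1) by (simp add: lr_min_def)
    have "card (D - {z}) < card D"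
      using card_Diff1_less[OF pperm_finite[OF D] zD] .
    then have "good (D - {z})"
      using less.hyps pperm_subset[OF D] z(2) by blast
    then show ?thesis
      using good_delete_min[OF D, of "fst z" "snd z"] z(1) by (auto simp: lr_min_def)
  next
    case False
    then have irr: "\<not> conf_13254 (D - {z})" "\<not> conf_up (D - {z})" "\<not> conf_up (tr (D - {z}))"
      "\<not> conf_hook (D - {z})" "\<not> conf_7 (D - {z})" if "lr_min D z" for z
      using that unfolding conf_def by blast+
    show ?thesis
    proof (cases "conf_13254 D")
      case True
      then show ?thesis by (intro irreducible_13254[OF D] irr)
    next
      case no: False
      consider "conf_up D" | "conf_up (tr D)"
        | "\<not> conf_up D" "\<not> conf_up (tr D)" "conf_hook D" | "\<not> conf_up D" "\<not> conf_up (tr D)" "conf_7 D"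
        using less.prems(2) no unfolding conf_def by blast
      then have "elim_good D"
      proof cases
        case 1
        then show ?thesis using irreducible_up[OF D _ no] irr(2) by blast
      next
        case 2
        then show ?thesis using irreducible_up_tr[OF D _ no] irr(3) by blast
      next
        case 3
        then show ?thesis using irreducible_hook[OF D _ no] irr(4) by blast
      next
        case 4
        then show ?thesis using irreducible_7[OF D] irr(5) by blast
      qed
      then show ?thesis by (rule elim_good_imp_good[OF D])
    qed
  qed
qed

lemma contains_patternE:
  assumes "contains_pattern n w v"
  obtains f where "\<And>j. j < length v \<Longrightarrow> (f j, w (f j)) \<in> graph n w"
    "\<And>j l. j < l \<Longrightarrow> l < length v \<Longrightarrow> f j < f l"
    "\<And>j l. v ! j < v ! l \<Longrightarrow> j < length v \<Longrightarrow> l < length v \<Longrightarrow> w (f j) < w (f l)"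
proof -
  obtain f where f: "f ` {..<length v} \<subseteq> {1..n}" "strict_mono_on {..<length v} f"
    "\<And>j l. j < length v \<Longrightarrow> l < length v \<Longrightarrow> w (f j) < w (f l) \<longleftrightarrow> v ! j < v ! l"
    using assms unfolding contains_pattern_def by blast
  show thesis
  proof (rule that[of f])
    show "(f j, w (f j)) \<in> graph n w" if "j < length v" for j
      using f(1) that by (auto simp: graph_def)
    show "f j < f l" if "j < l" "l < length v" for j l
      using strict_mono_onD[OF f(2)] that by simp
  qed (use f(3) in auto)
qed

text \<open>\<open>conf_up\<close> leaves the order of rows \<open>al\<close> and \<open>x\<close>
  open and thus covers 214635 and 241635; its transpose covers 215364 and 315264. In
  \<open>conf_hook\<close> the dots \<open>(p4, pe4)\<close> and \<open>(r5, y)\<close> coincide for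
  21543 and differ for 215634.\<close>

lemma conf_pattern:
  assumes "contains_pattern n w v"
    and "v \<in> {[1,3,2,5,4], [2,1,5,4,3], [2,1,4,6,3,5], [2,1,5,3,6,4], [2,1,5,6,3,4],
                [2,4,1,6,3,5], [3,1,5,2,6,4], [4,2,6,1,7,3,5]}"
  shows "conf (graph n w)"
proof -
  obtain f where f: "\<And>j. j < length v \<Longrightarrow> (f j, w (f j)) \<in> graph n w"
    "\<And>j l. j < l \<Longrightarrow> l < length v \<Longrightarrow> f j < f l"
    "\<And>j l. v ! j < v ! l \<Longrightarrow> j < length v \<Longrightarrow> l < length v \<Longrightarrow> w (f j) < w (f l)"
    using contains_patternE[OF assms(1)] by blast
  let ?D = "graph n w"
  from assms(2) show ?thesis
  proof (elim insertE emptyE)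
    assume v: "v = [1,3,2,5,4]"
    have "conf_13254 ?D"
      by (rule conf_13254I[of "f 0" "w (f 0)" _ "f 1" "w (f 1)" "f 2" "w (f 2)" "f 3" "w (f 3)" "f 4" "w (f 4)"])
        (use f in \<open>simp_all add: v\<close>)
    then show ?thesis by (simp add: conf_def)
  next
    assume v: "v = [2,1,4,6,3,5]"
    have "conf_up ?D"
      by (rule conf_upI[of "f 0" "w (f 0)" _ "f 1" "w (f 1)" "f 2" "w (f 2)" "f 3" "w (f 3)" "f 4" "w (f 4)" "f 5" "w (f 5)"])
        (use f in \<open>simp_all add: v\<close>)
    then show ?thesis by (simp add: conf_def)
  next
    assume v: "v = [2,4,1,6,3,5]"
    have "conf_up ?D"
      by (rule conf_upI[of "f 0" "w (f 0)" _ "f 2" "w (f 2)" "f 1" "w (f 1)" "f 3" "w (f 3)" "f 4" "w (f 4)" "f 5" "w (f 5)"])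
        (use f in \<open>simp_all add: v\<close>)
    then show ?thesis by (simp add: conf_def)
  next
    assume v: "v = [2,1,5,3,6,4]"
    have "conf_up (tr ?D)"
      by (rule conf_upI[of "w (f 1)" "f 1" _ "w (f 0)" "f 0" "w (f 3)" "f 3" "w (f 5)" "f 5" "w (f 2)" "f 2" "w (f 4)" "f 4"])
        (use f in \<open>simp_all add: v\<close>)
    then show ?thesis by (simp add: conf_def)
  next
    assume v: "v = [3,1,5,2,6,4]"
    have "conf_up (tr ?D)"
      by (rule conf_upI[of "w (f 1)" "f 1" _ "w (f 0)" "f 0" "w (f 3)" "f 3" "w (f 5)" "f 5" "w (f 2)" "f 2" "w (f 4)" "f 4"])
        (use f in \<open>simp_all add: v\<close>)
    then show ?thesis by (simp add: conf_def)
  next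
    assume v: "v = [2,1,5,4,3]"
    have "conf_hook ?D"
      by (rule conf_hookI[of "f 0" "w (f 0)" _ "f 1" "w (f 1)" "f 2" "w (f 2)" "f 3" "w (f 3)" "f 4" "w (f 4)" "f 3" "w (f 3)"])
        (use f in \<open>simp_all add: v\<close>)
    then show ?thesis by (simp add: conf_def)
  next
    assume v: "v = [2,1,5,6,3,4]"
    have "conf_hook ?D"
      by (rule conf_hookI[of "f 0" "w (f 0)" _ "f 1" "w (f 1)" "f 2" "w (f 2)" "f 3" "w (f 3)" "f 4" "w (f 4)" "f 5" "w (f 5)"])
        (use f in \<open>simp_all add: v\<close>)
    then show ?thesis by (simp add: conf_def)
  next
    assume v: "v = [4,2,6,1,7,3,5]"
    have "conf_7 ?D"
      by (rule conf_7I[of "f 0" "w (f 0)" _ "f 1" "w (f 1)" "f 2" "w (f 2)" "f 3" "w (f 3)" "f 4" "w (f 4)" "f 5" "w (f 5)" "f 6" "w (f 6)"])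
        (use f in \<open>simp_all add: v\<close>)
    then show ?thesis by (simp add: conf_def)
  qed
qed

theorem corollary4p3:
  fixes n :: nat and w :: "nat \<Rightarrow> nat"
  assumes "n \<ge> 1"
    and "w permutes {1..n}"
    and "\<exists>\<sigma>. diagonal_term_order n \<sigma> \<and>
           groebner_basis n \<sigma> (CDG_generators n w) (schubert_ideal n w)"
  shows "\<forall>v \<in> {[1,3,2,5,4], [2,1,5,4,3], [2,1,4,6,3,5], [2,1,5,3,6,4], [2,1,5,6,3,4],
                [2,4,1,6,3,5], [3,1,5,2,6,4], [4,2,6,1,7,3,5]}.
           avoids_pattern n w v"
proof
  fix v :: "nat list"
  assume v: "v \<in> {[1,3,2,5,4], [2,1,5,4,3], [2,1,4,6,3,5], [2,1,5,3,6,4], [2,1,5,6,3,4],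
                [2,4,1,6,3,5], [3,1,5,2,6,4], [4,2,6,1,7,3,5]}"
  obtain \<sigma> where \<sigma>: "diagonal_term_order n \<sigma>"
    "groebner_basis n \<sigma> (CDG_generators n w) (schubert_ideal n w)"
    using assms(3) by blast
  interpret diag_order n \<sigma> by unfold_locales (rule \<sigma>(1))
  show "avoids_pattern n w v"
  proof
    assume pattern: "contains_pattern n w v"
    have "good (graph n w)"
      by (rule conf_good[OF pperm_graph[OF assms(2)] conf_pattern[OF pattern v]])
    then show False by (rule good_not_groebner[OF assms(2) \<sigma>(2)])
  qed
qed

end
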